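(* Let $R=\mathbb{Z}[x_1,x_2,\ldots]$ be the ring of polynomials with integer coefficients in countably many commuting variables. Each of the following three rings is isomorphic to $R$: (i) the ring $\tilde\Gamma$ of simple graphs with integer-weighted components, with multiplication induced by the Cartesian product; (ii) the ring $\tilde\Gamma$ with multiplication induced by the strong product; (iii) the subring $\tilde\Gamma_{0,\mathrm{odd}}$ of $\tilde\Gamma_0$ additively generated by the connected nonbipartite graphs (loops allowed), with multiplication induced by the direct product.
   Context: Graphs are finite, undirected, considered up to isomorphism; $\Gamma_0$ denotes all such graphs (loops allowed), $\Gamma$ the simple ones. Cartesian product $G\,\Box\,H$ on $V(G)\times V(H)$: $(u,v)\sim(u',v')$ iff ($u=u'$ and $(v,v')\in E(H)$) or ($(u,u')\in E(G)$ and $v=v'$). Strong product $G\boxtimes H$: distinct $(u,v),(u',v')$ adjacent iff ($u=u'$ or $(u,u')\in E(G)$) and ($v=v'$ or $(v,v')\in E(H)$), and $(u,v)$ has a loop iff $u$ or $v$ has one. Direct product $G\times H$: $(u,v)\sim(u',v')$ iff $(u,u')\in E(G)$ and $(v,v')\in E(H)$. The set $\tilde\Gamma_0$ (resp. $\tilde\Gamma$) of graphs with integer-weighted components consists of formal finite sums $\sum_G a_G G$ with $a_G\in\mathbb{Z}$, $G$ ranging over connected graphs in $\Gamma_0$ (resp. connected simple graphs); it is the free abelian group on these connected graphs, addition being coefficientwise, and a graph with nonnegative weights corresponds to the disjoint union of its components with multiplicities. For a product $\odot$, multiplication is $(\sum a_H H)\odot(\sum b_L L)=\sum_G\big(\sum_{H\odot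 L=G}a_Hb_L\big)G$, i.e. the bilinear extension of $\odot$ on connected graphs. The unit is $K_1$ (one vertex) for Cartesian/strong and $K_1^*$ (one vertex with a loop) for direct. *)

theory Defs
  imports "HOL-Algebra.QuotRing" "HOL-Library.Poly_Mapping" "HOL-Library.Nat_Bijection"
begin

section \<open>The polynomial ring Z[x_1, x_2, ...]\<close>

text \<open>Polynomials in countably many commuting variables x_0, x_1, ... with integer
  coefficients: finitely supported maps from monomials (finitely supported exponent
  vectors, nat =>0 nat) to int, with the convolution product of HOL-Library.Poly_Mapping.\<close>

type_synonym int_poly_inf = "(nat \<Rightarrow>\<^sub>0 nat) \<Rightarrow>\<^sub>0 int"

definition Z_poly_ring :: "int_poly_inf ring" where
  "Z_poly_ring = \<lparr>carrier = UNIV, mult = (*), one = 1, zero = 0, add = (+)\<rparr>"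

section \<open>Finite graphs (loops allowed) with vertices labelled by naturals\<close>

text \<open>A graph is a pair (V, E) of a finite vertex set and a symmetric edge relation on V;
  (v,v) \<in> E means a loop at v.\<close>

type_synonym graph = "nat set \<times> (nat \<times> nat) set"

definition wf_graph :: "graph \<Rightarrow> bool" where
  "wf_graph G \<longleftrightarrow> finite (fst G) \<and> snd G \<subseteq> fst G \<times> fst G \<and> sym (snd G)"

definition simple_graph :: "graph \<Rightarrow> bool" where
  "simple_graph G \<longleftrightarrow> wf_graph G \<and> (\<forall>v. (v, v) \<notin> snd G)"

definition graph_iso :: "graph \<Rightarrow> graph \<Rightarrow> bool" where
  "graph_iso G H \<longleftrightarrow> (\<exists>f. bij_betw f (fst G) (fst H) \<and>
      (\<forall>u\<in>fst G. \<forall>v\<in>fst G. (u, v) \<in> snd G \<longleftrightarrow> (f u, f v) \<in> snd H))"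

definition connected_graph :: "graph \<Rightarrow> bool" where
  "connected_graph G \<longleftrightarrow> fst G \<noteq> {} \<and> (\<forall>u\<in>fst G. \<forall>v\<in>fst G. (u, v) \<in> (snd G)\<^sup>*)"

definition bipartite_graph :: "graph \<Rightarrow> bool" where
  "bipartite_graph G \<longleftrightarrow> (\<exists>S. \<forall>(u, v)\<in>snd G. (u \<in> S \<longleftrightarrow> v \<notin> S))"

text \<open>One vertex; one vertex with a loop.\<close>
definition K1 :: graph where "K1 = ({0}, {})"
definition K1_loop :: graph where "K1_loop = ({0}, {(0, 0)})"

section \<open>Graph products (vertex set V(G) \<times> V(H), encoded into nat by prod_encode)\<close>

definition cartesian_prod :: "graph \<Rightarrow> graph \<Rightarrow> graph" where
  "cartesian_prod G H = (prod_encode ` (fst G \<times> fst H),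
     {(prod_encode (u, v), prod_encode (u', v')) | u v u' v'.
        u \<in> fst G \<and> v \<in> fst H \<and> u' \<in> fst G \<and> v' \<in> fst H \<and>
        ((u = u' \<and> (v, v') \<in> snd H) \<or> ((u, u') \<in> snd G \<and> v = v'))})"

definition strong_prod :: "graph \<Rightarrow> graph \<Rightarrow> graph" where
  "strong_prod G H = (prod_encode ` (fst G \<times> fst H),
     {(prod_encode (u, v), prod_encode (u', v')) | u v u' v'.
        u \<in> fst G \<and> v \<in> fst H \<and> u' \<in> fst G \<and> v' \<in> fst H \<and>
        (if (u, v) = (u', v') then (u, u) \<in> snd G \<or> (v, v) \<in> snd H
         else (u = u' \<or> (u, u') \<in> snd G) \<and> (v = v' \<or> (v, v') \<in> snd H))})"

definition direct_prod :: "graph \<Rightarrow> graph \<Rightarrow> graph" where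
  "direct_prod G H = (prod_encode ` (fst G \<times> fst H),
     {(prod_encode (u, v), prod_encode (u', v')) | u v u' v'.
        (u, u') \<in> snd G \<and> (v, v') \<in> snd H})"

section \<open>Isomorphism classes and the rings of graphs with integer-weighted components\<close>

definition iso_class :: "graph \<Rightarrow> graph set" where
  "iso_class G = {H. wf_graph H \<and> graph_iso G H}"

definition class_rep :: "graph set \<Rightarrow> graph" where
  "class_rep C = (SOME G. G \<in> C)"

text \<open>Product of two isomorphism classes, computed on representatives.\<close>
definition class_prod :: "(graph \<Rightarrow> graph \<Rightarrow> graph) \<Rightarrow> graph set \<Rightarrow> graph set \<Rightarrow> graph set" where
  "class_prod P C D = iso_class (P (class_rep C) (class_rep D))"

text \<open>The ring of formal finite Z-linear combinations of the classes in Gens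
  (isomorphism classes of connected graphs), with the bilinear extension of the
  product P and unit the class of U. An element is a coefficient function
  with finite support contained in Gens.\<close>
definition graph_ring ::
  "graph set set \<Rightarrow> (graph \<Rightarrow> graph \<Rightarrow> graph) \<Rightarrow> graph \<Rightarrow> (graph set \<Rightarrow> int) ring" where
  "graph_ring Gens P U =
    \<lparr>carrier = {a. finite {C. a C \<noteq> 0} \<and> {C. a C \<noteq> 0} \<subseteq> Gens},
     mult = (\<lambda>a b C. \<Sum>(H, L) \<in> {H. a H \<noteq> 0} \<times> {L. b L \<noteq> 0}.
                         if class_prod P H L = C then a H * b L else 0),
     one = (\<lambda>C. if C = iso_class U then 1 else 0),
     zero = (\<lambda>C. 0),
     add = (\<lambda>a b C. a C + b C)\<rparr>"

text \<open>Classes of connected simple graphs (basis of Gamma~) and of connected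
  nonbipartite graphs with loops allowed (basis of Gamma~_0,odd).\<close>
definition conn_simple_classes :: "graph set set" where
  "conn_simple_classes = iso_class ` {G. simple_graph G \<and> connected_graph G}"

definition conn_nonbip_classes :: "graph set set" where
  "conn_nonbip_classes = iso_class ` {G. wf_graph G \<and> connected_graph G \<and> \<not> bipartite_graph G}"

end

(*
  A commutative monoid is free as soon as it carries a multiplicative size and has the refinement
  property: ab = cd implies a = xy, b = zw, c = xz, d = yw for some x, y, z, w. Each of the three
  rings is the monoid ring over Z of such a monoid, and graphs with a prime number of vertices
  provide infinitely many atoms.

  Refinement comes from metrics. If two product decompositions A x B and C x D of one vertex set both
  write the same (quasi-)metric as a sum of metrics of the factors, then the fibres of one
  decomposition are geodesically convex, hence boxes for the other one, and the intersections of
  fibres are the four common factors. For the Cartesian product the graph distance is such a metric.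
  For the direct product of thin nonbipartite connected graphs one may take
  max_z (ln W(x,z) - ln W(y,z)), where W counts walks of a fixed large length: W is multiplicative
  for the direct product, and the distance separates points because the adjacency matrix is
  symmetric. A general graph is a blow-up of a thin graph with integer vertex weights, and weights
  are refined by splitting them into content and primitive part. The strong product is the direct
  product of reflexive closures.
*)

theory Submission
  imports Defs Complex_Main "HOL-Computational_Algebra.Primes" "HOL-Library.Countable_Set"
begin


section \<open>Refinement monoids are free\<close>

text \<open>Refinement turns irreducible into prime: an atom that divides a product divides one of
  the factors, and the multiplicative size makes the splitting terminate. The obstacle is the direct
  product, where every step moves both coordinates: walk lengths have to agree instead of adding up,
  and graph distance is no sum over the factors. Counting walks repairs this. Counts multiply, a
  logarithm makes them additive, and a maximum over pairs of a sum of two separate terms splits as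
  well. The logarithm demands positive counts for all pairs, and lengths with this property exist
  exactly when the graph is connected and nonbipartite. Twins have equal rows of counts, so no such
  distance can tell them apart; this forces the detour through thin graphs with weights. The
  coordinates fix the four common factors and, up to integer contents, their weights; the contents
  are then shared out by a divisibility argument.\<close>

locale refinement_monoid = comm_monoid G for G (structure) +
  fixes size :: "'a \<Rightarrow> nat"
  assumes size_mult: "\<lbrakk>x \<in> carrier G; y \<in> carrier G\<rbrakk> \<Longrightarrow> size (x \<otimes> y) = size x * size y"
    and size_pos: "x \<in> carrier G \<Longrightarrow> 0 < size x"
    and size_eq_one: "\<lbrakk>x \<in> carrier G; size x = 1\<rbrakk> \<Longrightarrow> x = \<one>"
    and refine: "\<lbrakk>a \<in> carrier G; b \<in> carrier G; c \<in> carrier G; d \<in> carrier G; a \<otimes> b = c \<otimes> d\<rbrakk>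
      \<Longrightarrow> \<exists>x\<in>carrier G. \<exists>y\<in>carrier G. \<exists>z\<in>carrier G. \<exists>w\<in>carrier G.
            a = x \<otimes> y \<and> b = z \<otimes> w \<and> c = x \<otimes> z \<and> d = y \<otimes> w"
begin

definition atoms :: "'a set" where
  "atoms = {p \<in> carrier G. p \<noteq> \<one> \<and> (\<forall>x\<in>carrier G. \<forall>y\<in>carrier G. p = x \<otimes> y \<longrightarrow> x = \<one> \<or> y = \<one>)}"

lemma atoms_closed: "p \<in> atoms \<Longrightarrow> p \<in> carrier G"
  by (simp add: atoms_def)

lemma size_ge_2:
  assumes "x \<in> carrier G" "x \<noteq> \<one>"
  shows "2 \<le> size x"
  using size_pos[OF assms(1)] size_eq_one[OF assms(1)] assms(2) by (cases "size x = 1") auto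

lemma size_one [simp]: "size \<one> = 1"
  using size_mult[of \<one> \<one>] size_pos[of \<one>] by (metis mult_cancel2 mult_1 less_irrefl one_closed r_one)

lemma prime_size_atom:
  assumes "x \<in> carrier G" "prime (size x)"
  shows "x \<in> atoms"
proof -
  have "x \<noteq> \<one>"
    using assms(2) size_one by auto
  moreover have "y = \<one> \<or> z = \<one>" if "y \<in> carrier G" "z \<in> carrier G" "x = y \<otimes> z" for y z
    using prime_product[of "size y" "size z"] that assms(2) size_mult[of y z] size_eq_one[of y] size_eq_one[of z]
    by auto
  ultimately show ?thesis
    using assms(1) by (auto simp: atoms_def)
qed

end

locale enumerated_refinement_monoid = refinement_monoid +
  fixes e :: "nat \<Rightarrow> 'a"
  assumes e_bij: "bij_betw e UNIV atoms"
begin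

lemma e_atom: "e i \<in> atoms"
  using e_bij by (auto simp: bij_betw_def)

lemma e_closed [simp]: "e i \<in> carrier G"
  using e_atom atoms_closed by blast

definition monomial :: "(nat \<Rightarrow>\<^sub>0 nat) \<Rightarrow> 'a" where
  "monomial m = (\<Otimes>i\<in>Poly_Mapping.keys m. e i [^] Poly_Mapping.lookup m i)"

lemma monomial_closed [simp]: "monomial m \<in> carrier G"
  by (auto simp: monomial_def)

lemma monomial_superset:
  assumes "finite S" "Poly_Mapping.keys m \<subseteq> S"
  shows "monomial m = (\<Otimes>i\<in>S. e i [^] Poly_Mapping.lookup m i)"
  unfolding monomial_def
  by (rule finprod_mono_neutral_cong_left) (use assms in \<open>auto simp: in_keys_iff\<close>)

lemma monomial_zero [simp]: "monomial 0 = \<one>"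
  by (simp add: monomial_def)

lemma monomial_add: "monomial (m + n) = monomial m \<otimes> monomial n"
proof -
  let ?S = "Poly_Mapping.keys m \<union> Poly_Mapping.keys n"
  have "monomial (m + n) = (\<Otimes>i\<in>?S. e i [^] Poly_Mapping.lookup (m + n) i)"
    by (rule monomial_superset) (auto simp: keys_add)
  also have "\<dots> = (\<Otimes>i\<in>?S. e i [^] Poly_Mapping.lookup m i \<otimes> e i [^] Poly_Mapping.lookup n i)"
    by (rule finprod_cong') (auto simp: lookup_add nat_pow_mult)
  also have "\<dots> = (\<Otimes>i\<in>?S. e i [^] Poly_Mapping.lookup m i) \<otimes> (\<Otimes>i\<in>?S. e i [^] Poly_Mapping.lookup n i)"
    by (rule finprod_multf) auto
  also have "\<dots> = monomial m \<otimes> monomial n"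
    by (simp add: monomial_superset[of ?S])
  finally show ?thesis .
qed

lemma monomial_single [simp]: "monomial (Poly_Mapping.single i (Suc 0)) = e i"
  by (simp add: monomial_def)

lemma remove_key:
  assumes "i \<in> Poly_Mapping.keys m"
  obtains m' where "m = m' + Poly_Mapping.single i (1::nat)"
proof
  show "m = (m - Poly_Mapping.single i 1) + Poly_Mapping.single i 1"
    using assms by (intro poly_mapping_eqI) (auto simp: lookup_add lookup_minus lookup_single when_def in_keys_iff)
qed

text \<open>Atoms are prime: refining \<open>p \<otimes> u = e j \<otimes> monomial m\<close> gives
  \<open>p = x \<otimes> y\<close> and \<open>e j = x \<otimes> z\<close>, and irreducibility leaves
  \<open>p = e j\<close> or \<open>p\<close> dividing the smaller \<open>monomial m\<close>. Naming
  the cofactor \<open>u\<close> in the conclusion stands in for a cancellation law.\<close>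

lemma monomial_divisible_by_atom:
  assumes "p \<in> atoms" "u \<in> carrier G" "p \<otimes> u = monomial n"
  shows "\<exists>j n'. n = n' + Poly_Mapping.single j 1 \<and> p = e j \<and> u = monomial n'"
  using assms(2,3)
proof (induction "size (monomial n)" arbitrary: n u rule: less_induct)
  case less
  have p: "p \<in> carrier G" "p \<noteq> \<one>"
    using assms(1) by (auto simp: atoms_def)
  have "2 * 1 \<le> size p * size u"
    using size_ge_2[OF p] size_pos[OF less.prems(1)] by (intro mult_mono) auto
  then have "size (monomial n) \<noteq> size \<one>"
    using size_mult[OF p(1) less.prems(1)] less.prems(2) by auto
  then have "n \<noteq> 0"
    by auto
  then obtain j where "j \<in> Poly_Mapping.keys n"
    by (metis all_not_in_conv keys_eq_empty)
  then obtain m where n: "n = m + Poly_Mapping.single j 1"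
    by (rule remove_key)
  have mon_n: "monomial n = e j \<otimes> monomial m"
    by (simp add: n monomial_add m_comm)
  obtain x y z w where xyzw: "x \<in> carrier G" "y \<in> carrier G" "z \<in> carrier G" "w \<in> carrier G"
    and eq: "p = x \<otimes> y" "u = z \<otimes> w" "e j = x \<otimes> z" "monomial m = y \<otimes> w"
    using refine[of p u "e j" "monomial m"] p less.prems mon_n by auto
  have "x = \<one> \<or> y = \<one>"
    using assms(1) xyzw eq by (auto simp: atoms_def)
  then show ?case
  proof
    assume "x = \<one>"
    then have *: "p = y" "e j = z"
      using eq xyzw by auto
    have "size (monomial m) < size (monomial n)"
      using size_mult[of "e j" "monomial m"] size_ge_2[of "e j"] e_atom[of j] size_pos[of "monomial m"]
      by (auto simp: mon_n atoms_def)
    then obtain k m' where m': "m = m' + Poly_Mapping.single k 1" "p = e k" "w = monomial m'"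
      using less.hyps[of m w] xyzw eq * by auto
    have "n = (m' + Poly_Mapping.single j 1) + Poly_Mapping.single k 1"
      using n m' by (simp add: ac_simps)
    moreover have "u = monomial (m' + Poly_Mapping.single j 1)"
      using eq * m' xyzw by (simp add: monomial_add m_comm)
    ultimately show ?thesis
      using m' by blast
  next
    assume y: "y = \<one>"
    then have "p = x"
      using eq xyzw by auto
    moreover have "z = \<one>"
      using e_atom[of j] xyzw eq \<open>p = x\<close> p by (auto simp: atoms_def)
    ultimately show ?thesis
      using n eq xyzw y by auto
  qed
qed

text \<open>An atom stripped from \<open>m\<close> occurs in \<open>n\<close> with an equal
  cofactor, so the induction passes to \<open>m'\<close> and \<open>n'\<close>; the size drops
  because atoms have size at least two.\<close>

lemma monomial_inj: "monomial m = monomial n \<Longrightarrow> m = n"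
proof (induction "size (monomial m)" arbitrary: m n rule: less_induct)
  case less
  show ?case
  proof (cases "m = 0")
    case False
    then obtain j where "j \<in> Poly_Mapping.keys m"
      by (metis all_not_in_conv keys_eq_empty)
    then obtain m' where m': "m = m' + Poly_Mapping.single j 1"
      by (rule remove_key)
    then have mon_m: "monomial m = e j \<otimes> monomial m'"
      by (simp add: monomial_add m_comm)
    then obtain k n' where n': "n = n' + Poly_Mapping.single k 1" "e j = e k" "monomial m' = monomial n'"
      using monomial_divisible_by_atom[OF e_atom[of j] monomial_closed[of m'], of n] less.prems by auto
    have "size (monomial m') < size (monomial m)"
      using size_mult[of "e j" "monomial m'"] size_ge_2[of "e j"] e_atom[of j] size_pos[of "monomial m'"]
      by (auto simp: mon_m atoms_def)
    then have "m' = n'"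
      using less.hyps n' by blast
    moreover have "j = k"
      using n'(2) e_bij by (auto simp: bij_betw_def inj_on_def)
    ultimately show ?thesis
      using m' n' by simp
  next
    case True
    show ?thesis
    proof (rule ccontr)
      assume "m \<noteq> n"
      then obtain j where "j \<in> Poly_Mapping.keys n"
        using True by (metis all_not_in_conv keys_eq_empty)
      then obtain n' where "n = n' + Poly_Mapping.single j 1"
        by (rule remove_key)
      then have "\<one> = monomial n' \<otimes> e j"
        using less.prems True by (simp add: monomial_add)
      then have "1 = size (monomial n') * size (e j)"
        using size_mult[of "monomial n'" "e j"] size_one by auto
      then show False
        using size_ge_2[of "e j"] e_atom[of j] by (auto simp: atoms_def)
    qed
  qed
qed

lemma monomial_surj: "x \<in> carrier G \<Longrightarrow> x \<in> range monomial"
proof (induction "size x" arbitrary: x rule: less_induct)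
  case less
  consider "x = \<one>" | "x \<in> atoms"
    | y z where "y \<in> carrier G" "z \<in> carrier G" "y \<noteq> \<one>" "z \<noteq> \<one>" "x = y \<otimes> z"
    using less.prems by (auto simp: atoms_def)
  then show ?case
  proof cases
    case 1
    then show ?thesis
      by (metis monomial_zero rangeI)
  next
    case 2
    then obtain i where "x = e i"
      using e_bij by (auto simp: bij_betw_def)
    then show ?thesis
      by (metis monomial_single rangeI)
  next
    case 3
    then have "2 \<le> size y" "2 \<le> size z" "size x = size y * size z"
      by (auto simp: size_ge_2 size_mult)
    then have "size y < size x" "size z < size x"
      by auto
    then obtain m n where "y = monomial m" "z = monomial n"
      using 3 less.hyps[of y] less.hyps[of z] by auto
    then have "x = monomial (m + n)"
      using 3 by (simp add: monomial_add)
    then show ?thesis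
      by blast
  qed
qed

lemma monomial_bij: "bij_betw monomial UNIV (carrier G)"
  using monomial_inj monomial_surj by (auto simp: bij_betw_def inj_on_def)

end

text \<open>Both sides are the monoid ring over the integers of the monoid of exponent vectors,
  written once as the convolution of \<open>Poly_Mapping\<close> and once as the bilinear extension
  of \<open>class_prod\<close>.\<close>

lemma Z_poly_ring_iso_graph_ring:
  fixes \<beta> :: "(nat \<Rightarrow>\<^sub>0 nat) \<Rightarrow> graph set"
  assumes bij: "bij_betw \<beta> UNIV Gens"
    and add: "\<And>m n. \<beta> (m + n) = class_prod P (\<beta> m) (\<beta> n)"
    and zero: "\<beta> 0 = iso_class U"
  shows "Z_poly_ring \<simeq> graph_ring Gens P U"
proof -
  have inj: "\<beta> m = \<beta> n \<longleftrightarrow> m = n" for m n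
    using bij by (auto simp: bij_betw_def inj_on_def)
  have rng: "C \<in> Gens \<longleftrightarrow> (\<exists>m. C = \<beta> m)" for C
    using bij by (auto simp: bij_betw_def)
  \<comment> \<open>Elements of \<open>graph_ring\<close> are functions on all sets of graphs, so
    coefficients off \<open>Gens\<close> have to be set to zero.\<close>
  define h :: "int_poly_inf \<Rightarrow> graph set \<Rightarrow> int" where
    "h = (\<lambda>p C. if C \<in> Gens then Poly_Mapping.lookup p (inv_into UNIV \<beta> C) else 0)"
  have h_\<beta>: "h p (\<beta> m) = Poly_Mapping.lookup p m" for p m
    using inj rng by (auto simp: h_def inv_f_f inj_def)
  have h_out: "C \<notin> Gens \<Longrightarrow> h p C = 0" for p C
    by (simp add: h_def)
  have supp: "{C. h p C \<noteq> 0} = \<beta> ` Poly_Mapping.keys p" for p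
  proof (intro Set.set_eqI iffI)
    fix C assume "C \<in> {C. h p C \<noteq> 0}"
    then have "C \<in> Gens" "h p C \<noteq> 0"
      using h_out by auto
    then show "C \<in> \<beta> ` Poly_Mapping.keys p"
      using rng h_\<beta> by (auto simp: in_keys_iff)
  qed (auto simp: h_\<beta> in_keys_iff)
  have eqI: "f = g" if "\<And>m. f (\<beta> m) = g (\<beta> m)" "\<And>C. C \<notin> Gens \<Longrightarrow> f C = g C"
    for f g :: "graph set \<Rightarrow> int"
    using that rng by (intro ext) metis
  let ?S = "graph_ring Gens P U"
  have "h \<in> ring_iso Z_poly_ring ?S"
  proof (rule ring_iso_memI)
    fix p q :: int_poly_inf
    show "h p \<in> carrier ?S"
      using supp[of p] rng by (auto simp: graph_ring_def)
    show "h (p \<oplus>\<^bsub>Z_poly_ring\<^esub> q) = h p \<oplus>\<^bsub>?S\<^esub> h q"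
      by (rule eqI) (auto simp: graph_ring_def Z_poly_ring_def h_\<beta> h_out lookup_add)
    show "h \<one>\<^bsub>Z_poly_ring\<^esub> = \<one>\<^bsub>?S\<^esub>"
    proof (rule eqI)
      show "h \<one>\<^bsub>Z_poly_ring\<^esub> (\<beta> m) = \<one>\<^bsub>?S\<^esub> (\<beta> m)" for m
        by (simp add: graph_ring_def Z_poly_ring_def h_\<beta> lookup_one zero[symmetric] inj when_def)
      show "h \<one>\<^bsub>Z_poly_ring\<^esub> C = \<one>\<^bsub>?S\<^esub> C" if "C \<notin> Gens" for C
        using that rng by (auto simp: graph_ring_def h_out zero[symmetric])
    qed
    have mult: "(h p \<otimes>\<^bsub>?S\<^esub> h q) C =
        (\<Sum>(m, n) \<in> Poly_Mapping.keys p \<times> Poly_Mapping.keys q. if \<beta> (m + n) = C then Poly_Mapping.lookup p m * Poly_Mapping.lookup q n else 0)" for C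
    proof -
      have "(h p \<otimes>\<^bsub>?S\<^esub> h q) C = (\<Sum>(H, L) \<in> (\<beta> ` Poly_Mapping.keys p) \<times> (\<beta> ` Poly_Mapping.keys q).
          if class_prod P H L = C then h p H * h q L else 0)"
        by (simp add: graph_ring_def supp)
      also have "\<dots> = (\<Sum>(H, L) \<in> map_prod \<beta> \<beta> ` (Poly_Mapping.keys p \<times> Poly_Mapping.keys q).
          if class_prod P H L = C then h p H * h q L else 0)"
        by (simp add: map_prod_surj_on)
      also have "\<dots> = (\<Sum>(m, n) \<in> Poly_Mapping.keys p \<times> Poly_Mapping.keys q.
          if \<beta> (m + n) = C then Poly_Mapping.lookup p m * Poly_Mapping.lookup q n else 0)"
        by (subst sum.reindex) (auto simp: inj_on_def inj add h_\<beta> intro!: sum.cong)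
      finally show ?thesis .
    qed
    show "h (p \<otimes>\<^bsub>Z_poly_ring\<^esub> q) = h p \<otimes>\<^bsub>?S\<^esub> h q"
    proof (rule eqI)
      show "h (p \<otimes>\<^bsub>Z_poly_ring\<^esub> q) C = (h p \<otimes>\<^bsub>?S\<^esub> h q) C" if "C \<notin> Gens" for C
      proof -
        have "\<beta> k \<noteq> C" for k
          using that rng by blast
        then show ?thesis
          unfolding mult using that by (simp add: h_out split_beta)
      qed
      fix k
      have "h (p \<otimes>\<^bsub>Z_poly_ring\<^esub> q) (\<beta> k) = Poly_Mapping.lookup (p * q) k"
        by (simp add: Z_poly_ring_def h_\<beta>)
      \<comment> \<open>\<open>lookup_mult\<close> sums over all exponent vectors; cutting both sums
        down to the supports yields the finite double sum of \<open>mult\<close>.\<close>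
      also have "\<dots> = (\<Sum>l. Poly_Mapping.lookup p l * (\<Sum>r. Poly_Mapping.lookup q r when k = l + r))"
        by (rule lookup_mult)
      also have "\<dots> = (\<Sum>l\<in>Poly_Mapping.keys p. Poly_Mapping.lookup p l * (\<Sum>r. Poly_Mapping.lookup q r when k = l + r))"
        by (rule Sum_any.expand_superset) (auto simp: in_keys_iff)
      also have "\<dots> = (\<Sum>l\<in>Poly_Mapping.keys p. Poly_Mapping.lookup p l * (\<Sum>r\<in>Poly_Mapping.keys q. Poly_Mapping.lookup q r when k = l + r))"
        by (intro sum.cong arg_cong2[where f = "(*)"] Sum_any.expand_superset) (auto simp: in_keys_iff)
      also have "\<dots> = (h p \<otimes>\<^bsub>?S\<^esub> h q) (\<beta> k)"
        unfolding mult sum_distrib_left sum.cartesian_product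
        by (intro sum.cong) (auto simp: inj)
      finally show "h (p \<otimes>\<^bsub>Z_poly_ring\<^esub> q) (\<beta> k) = (h p \<otimes>\<^bsub>?S\<^esub> h q) (\<beta> k)" .
    qed
  next
    show "bij_betw h (carrier Z_poly_ring) (carrier ?S)"
    proof (rule bij_betw_imageI)
      show "inj_on h (carrier Z_poly_ring)"
        by (auto simp: inj_on_def intro!: poly_mapping_eqI) (metis h_\<beta>)
      have "a \<in> range h" if "finite {C. a C \<noteq> 0}" "{C. a C \<noteq> 0} \<subseteq> Gens" for a
      proof -
        have "finite (\<beta> ` {m. a (\<beta> m) \<noteq> 0})"
          by (rule finite_subset[OF _ that(1)]) auto
        then have "finite {m. a (\<beta> m) \<noteq> 0}"
          by (rule finite_imageD) (auto simp: inj_on_def inj)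
        then have "Poly_Mapping.lookup (Abs_poly_mapping (\<lambda>m. a (\<beta> m))) m = a (\<beta> m)" for m
          by simp
        then have "h (Abs_poly_mapping (\<lambda>m. a (\<beta> m))) = a"
          using that(2) by (intro eqI) (auto simp: h_\<beta> h_out)
        then show ?thesis
          using range_eqI by metis
      qed
      then show "h ` carrier Z_poly_ring = carrier ?S"
        using h_out by (auto simp: Z_poly_ring_def graph_ring_def supp)
    qed
  qed
  then show ?thesis
    by (auto simp: is_ring_iso_def)
qed


section \<open>Graph products given by a local rule\<close>

lemma graph_isoI:
  assumes "bij_betw f (fst G) (fst H)"
    and "\<And>u v. \<lbrakk>u \<in> fst G; v \<in> fst G\<rbrakk> \<Longrightarrow> (u, v) \<in> snd G \<longleftrightarrow> (f u, f v) \<in> snd H"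
  shows "graph_iso G H"
  using assms by (auto simp: graph_iso_def)

lemma graph_iso_refl [simp]: "graph_iso G G"
  by (rule graph_isoI[of id]) (auto simp: bij_betw_def)

lemma graph_iso_sym:
  assumes "graph_iso G H"
  shows "graph_iso H G"
proof -
  obtain f where f: "bij_betw f (fst G) (fst H)"
    and E: "\<And>u v. \<lbrakk>u \<in> fst G; v \<in> fst G\<rbrakk> \<Longrightarrow> (u, v) \<in> snd G \<longleftrightarrow> (f u, f v) \<in> snd H"
    using assms by (auto simp: graph_iso_def)
  show ?thesis
  proof (rule graph_isoI)
    show g: "bij_betw (inv_into (fst G) f) (fst H) (fst G)"
      by (rule bij_betw_inv_into[OF f])
    show "(u, v) \<in> snd H \<longleftrightarrow> (inv_into (fst G) f u, inv_into (fst G) f v) \<in> snd G"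
      if "u \<in> fst H" "v \<in> fst H" for u v
      using that E bij_betw_apply[OF g] bij_betw_inv_into_right[OF f] by simp
  qed
qed

lemma graph_iso_trans:
  assumes "graph_iso G H" "graph_iso H K"
  shows "graph_iso G K"
proof -
  obtain f where f: "bij_betw f (fst G) (fst H)"
    "\<And>u v. \<lbrakk>u \<in> fst G; v \<in> fst G\<rbrakk> \<Longrightarrow> (u, v) \<in> snd G \<longleftrightarrow> (f u, f v) \<in> snd H"
    using assms by (auto simp: graph_iso_def)
  obtain g where g: "bij_betw g (fst H) (fst K)"
    "\<And>u v. \<lbrakk>u \<in> fst H; v \<in> fst H\<rbrakk> \<Longrightarrow> (u, v) \<in> snd H \<longleftrightarrow> (g u, g v) \<in> snd K"
    using assms by (auto simp: graph_iso_def)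
  show ?thesis
    by (rule graph_isoI[of "g \<circ> f"]) (use f g bij_betw_trans bij_betw_apply[OF f(1)] in auto)
qed

lemma graph_iso_card: "graph_iso G H \<Longrightarrow> card (fst G) = card (fst H)"
  by (auto simp: graph_iso_def bij_betw_same_card)

lemma iso_class_eq_iff:
  assumes "wf_graph G" "wf_graph H"
  shows "iso_class G = iso_class H \<longleftrightarrow> graph_iso G H"
proof
  assume eq: "iso_class G = iso_class H"
  have "H \<in> iso_class G"
    unfolding eq using assms by (simp add: iso_class_def)
  then show "graph_iso G H"
    by (simp add: iso_class_def)
next
  assume "graph_iso G H"
  then have "graph_iso G K \<longleftrightarrow> graph_iso H K" for K
    using graph_iso_trans graph_iso_trans[OF graph_iso_sym] by blast
  then show "iso_class G = iso_class H"
    by (simp add: iso_class_def)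
qed

lemma class_rep_iso_class:
  assumes "wf_graph G"
  shows "wf_graph (class_rep (iso_class G))" "graph_iso G (class_rep (iso_class G))"
proof -
  have "G \<in> iso_class G"
    using assms by (simp add: iso_class_def)
  then have "class_rep (iso_class G) \<in> iso_class G"
    unfolding class_rep_def by (rule someI)
  then show "wf_graph (class_rep (iso_class G))" "graph_iso G (class_rep (iso_class G))"
    by (auto simp: iso_class_def)
qed

text \<open>Allows the atoms to be numbered by naturals: vertex labels are naturals, so a graph is a
  pair of finite sets over countable types.\<close>

lemma countable_wf_graphs: "countable {G. wf_graph G}"
proof (rule countable_subset)
  show "{G. wf_graph G} \<subseteq> Collect finite \<times> Collect finite"
  proof
    fix G assume "G \<in> {G. wf_graph G}"
    then have "finite (fst G)" "finite (snd G)"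
      by (auto simp: wf_graph_def intro: finite_subset[OF _ finite_cartesian_product])
    then show "G \<in> Collect finite \<times> Collect finite"
      by (simp add: mem_Times_iff)
  qed
  show "countable ((Collect finite \<times> Collect finite) :: graph set)"
    by (intro countable_SIGMA countable_Collect_finite)
qed

text \<open>The truth value \<open>\<Phi> e p f q\<close> decides adjacency of two pairs from equality (\<open>e\<close>, \<open>f\<close>)
  and adjacency (\<open>p\<close>, \<open>q\<close>) of their first and second coordinates.\<close>
definition gprod :: "(bool \<Rightarrow> bool \<Rightarrow> bool \<Rightarrow> bool \<Rightarrow> bool) \<Rightarrow> graph \<Rightarrow> graph \<Rightarrow> graph" where
  "gprod \<Phi> G H = (prod_encode ` (fst G \<times> fst H),
     {(prod_encode (u, v), prod_encode (u', v')) | u v u' v'.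
        u \<in> fst G \<and> v \<in> fst H \<and> u' \<in> fst G \<and> v' \<in> fst H \<and>
        \<Phi> (u = u') ((u, u') \<in> snd G) (v = v') ((v, v') \<in> snd H)})"

lemma fst_gprod: "fst (gprod \<Phi> G H) = prod_encode ` (fst G \<times> fst H)"
  by (simp add: gprod_def)

lemma gprod_vertex: "prod_encode (u, v) \<in> fst (gprod \<Phi> G H) \<longleftrightarrow> u \<in> fst G \<and> v \<in> fst H"
  by (auto simp: gprod_def)

lemma gprod_edge:
  "(prod_encode (u, v), prod_encode (u', v')) \<in> snd (gprod \<Phi> G H) \<longleftrightarrow>
     u \<in> fst G \<and> v \<in> fst H \<and> u' \<in> fst G \<and> v' \<in> fst H \<and>
     \<Phi> (u = u') ((u, u') \<in> snd G) (v = v') ((v, v') \<in> snd H)"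
  by (auto simp: gprod_def)

lemma card_gprod: "card (fst (gprod \<Phi> G H)) = card (fst G) * card (fst H)"
  by (simp add: fst_gprod card_image inj_prod_encode card_cartesian_product)

lemma wf_gprod:
  assumes "wf_graph G" "wf_graph H"
  shows "wf_graph (gprod \<Phi> G H)"
proof -
  have "(u, v) \<in> snd G \<longleftrightarrow> (v, u) \<in> snd G" "(u, v) \<in> snd H \<longleftrightarrow> (v, u) \<in> snd H" for u v
    using assms by (auto simp: wf_graph_def sym_def)
  moreover from this have "(b, a) \<in> snd (gprod \<Phi> G H)" if "(a, b) \<in> snd (gprod \<Phi> G H)" for a b
    using that by (auto simp: gprod_def eq_commute)
  moreover have "snd (gprod \<Phi> G H) \<subseteq> fst (gprod \<Phi> G H) \<times> fst (gprod \<Phi> G H)"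
    by (auto simp: gprod_def)
  ultimately show ?thesis
    using assms by (auto simp: wf_graph_def fst_gprod sym_def)
qed

text \<open>Lets a factorization be given by two coordinate functions on the vertices of
  \<open>K\<close>, so that the encoding of pairs drops out of later arguments.\<close>

lemma graph_iso_gprodI:
  assumes bij: "bij_betw (\<lambda>u. (\<alpha> u, \<beta> u)) (fst K) (fst G \<times> fst H)"
    and E: "\<And>u v. \<lbrakk>u \<in> fst K; v \<in> fst K\<rbrakk> \<Longrightarrow> (u, v) \<in> snd K \<longleftrightarrow>
      \<Phi> (\<alpha> u = \<alpha> v) ((\<alpha> u, \<alpha> v) \<in> snd G) (\<beta> u = \<beta> v) ((\<beta> u, \<beta> v) \<in> snd H)"
  shows "graph_iso K (gprod \<Phi> G H)"
proof (rule graph_isoI)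
  have "bij_betw (prod_encode \<circ> (\<lambda>u. (\<alpha> u, \<beta> u))) (fst K) (fst (gprod \<Phi> G H))"
    unfolding fst_gprod by (rule bij_betw_trans[OF bij]) (simp add: bij_betw_def inj_prod_encode)
  then show "bij_betw (\<lambda>u. prod_encode (\<alpha> u, \<beta> u)) (fst K) (fst (gprod \<Phi> G H))"
    by (simp add: comp_def)
  show "(u, v) \<in> snd K \<longleftrightarrow>
      (prod_encode (\<alpha> u, \<beta> u), prod_encode (\<alpha> v, \<beta> v)) \<in> snd (gprod \<Phi> G H)"
    if "u \<in> fst K" "v \<in> fst K" for u v
    using E[OF that] bij_betw_apply[OF bij that(1)] bij_betw_apply[OF bij that(2)]
    by (simp add: gprod_edge)
qed

lemma gprod_vertexE:
  assumes "n \<in> fst (gprod \<Phi> G H)"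
  obtains u v where "n = prod_encode (u, v)" "u \<in> fst G" "v \<in> fst H"
  using assms by (auto simp: gprod_def)

lemma gprod_cong:
  assumes "graph_iso G G'" "graph_iso H H'"
  shows "graph_iso (gprod \<Phi> G H) (gprod \<Phi> G' H')"
proof -
  obtain f where f: "bij_betw f (fst G) (fst G')"
    "\<And>u v. \<lbrakk>u \<in> fst G; v \<in> fst G\<rbrakk> \<Longrightarrow> (u, v) \<in> snd G \<longleftrightarrow> (f u, f v) \<in> snd G'"
    using assms by (auto simp: graph_iso_def)
  obtain g where g: "bij_betw g (fst H) (fst H')"
    "\<And>u v. \<lbrakk>u \<in> fst H; v \<in> fst H\<rbrakk> \<Longrightarrow> (u, v) \<in> snd H \<longleftrightarrow> (g u, g v) \<in> snd H'"
    using assms by (auto simp: graph_iso_def)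
  have eq: "f u = f v \<longleftrightarrow> u = v" if "u \<in> fst G" "v \<in> fst G" for u v
    using f(1) that by (auto simp: bij_betw_def inj_on_def)
  have eq': "g u = g v \<longleftrightarrow> u = v" if "u \<in> fst H" "v \<in> fst H" for u v
    using g(1) that by (auto simp: bij_betw_def inj_on_def)
  have "bij_betw prod_decode (prod_encode ` (fst G \<times> fst H)) (fst G \<times> fst H)"
    by (auto simp: bij_betw_def inj_on_def image_image)
  then have "bij_betw (map_prod f g \<circ> prod_decode) (prod_encode ` (fst G \<times> fst H)) (fst G' \<times> fst H')"
    by (rule bij_betw_trans[OF _ bij_betw_map_prod[OF f(1) g(1)]])
  then show ?thesis
    by (intro graph_iso_gprodI[of "\<lambda>n. f (fst (prod_decode n))" "\<lambda>n. g (snd (prod_decode n))"])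
      (auto simp: fst_gprod gprod_edge comp_def map_prod_def split_beta eq eq' f(2) g(2))
qed

lemma gprod_comm:
  assumes "\<And>e p f q. \<Phi> e p f q = \<Phi> f q e p"
  shows "graph_iso (gprod \<Phi> G H) (gprod \<Phi> H G)"
proof (rule graph_iso_gprodI[of "\<lambda>n. snd (prod_decode n)" "\<lambda>n. fst (prod_decode n)"])
  show "bij_betw (\<lambda>n. (snd (prod_decode n), fst (prod_decode n))) (fst (gprod \<Phi> G H)) (fst H \<times> fst G)"
    by (rule bij_betwI[where g = "\<lambda>p. prod_encode (snd p, fst p)"]) (auto simp: fst_gprod)
qed (auto simp: fst_gprod gprod_edge assms elim!: gprod_vertexE)

text \<open>For pairs, equality is \<open>e \<and> f\<close> and adjacency is
  \<open>\<Phi> e p f q\<close>; the hypothesis is therefore associativity on the level of truth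
  values, and the rest is a reindexing of triples.\<close>

lemma gprod_assoc:
  assumes "\<And>e p f q g r. \<Phi> (e \<and> f) (\<Phi> e p f q) g r = \<Phi> e p (f \<and> g) (\<Phi> f q g r)"
  shows "graph_iso (gprod \<Phi> (gprod \<Phi> G H) K) (gprod \<Phi> G (gprod \<Phi> H K))"
proof (rule graph_iso_gprodI[of "\<lambda>n. fst (prod_decode (fst (prod_decode n)))"
      "\<lambda>n. prod_encode (snd (prod_decode (fst (prod_decode n))), snd (prod_decode n))"])
  show "bij_betw (\<lambda>n. (fst (prod_decode (fst (prod_decode n))),
      prod_encode (snd (prod_decode (fst (prod_decode n))), snd (prod_decode n))))
     (fst (gprod \<Phi> (gprod \<Phi> G H) K)) (fst G \<times> fst (gprod \<Phi> H K))"
    by (rule bij_betwI[where g = "\<lambda>p. prod_encode (prod_encode (fst p, fst (prod_decode (snd p))),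
          snd (prod_decode (snd p)))"]) (auto simp: fst_gprod)
qed (auto simp: fst_gprod gprod_edge assms[symmetric])

lemma gprod_unit:
  assumes "fst U = {0}" "\<And>e p. \<Phi> e p True ((0, 0) \<in> snd U) = p"
  shows "graph_iso G (gprod \<Phi> G U)"
proof (rule graph_iso_gprodI[of "\<lambda>u. u" "\<lambda>_. 0"])
  show "bij_betw (\<lambda>u. (u, 0)) (fst G) (fst G \<times> fst U)"
    using assms by (auto simp: bij_betw_def inj_on_def)
qed (use assms in auto)

text \<open>The interface shared by the three rings. Its substance is \<open>Cl_refine\<close>;
  \<open>Cl_exists\<close> provides graphs of prime size, hence atoms. \<open>P_eq\<close> is stated
  inside the class because \<open>direct_prod\<close> collects edges without testing their
  endpoints, and only well-formed graphs make it agree with \<open>gprod\<close>.\<close>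

locale graph_monoid =
  fixes Cl :: "graph \<Rightarrow> bool" and P :: "graph \<Rightarrow> graph \<Rightarrow> graph"
    and \<Phi> :: "bool \<Rightarrow> bool \<Rightarrow> bool \<Rightarrow> bool \<Rightarrow> bool" and U :: graph
  assumes P_eq: "\<lbrakk>Cl G; Cl H\<rbrakk> \<Longrightarrow> P G H = gprod \<Phi> G H"
    and Cl_wf: "Cl G \<Longrightarrow> wf_graph G"
    and Cl_iso: "\<lbrakk>Cl G; wf_graph H; graph_iso G H\<rbrakk> \<Longrightarrow> Cl H"
    and Cl_nonempty: "Cl G \<Longrightarrow> fst G \<noteq> {}"
    and Cl_gprod: "\<lbrakk>Cl G; Cl H\<rbrakk> \<Longrightarrow> Cl (gprod \<Phi> G H)"
    and Cl_U: "Cl U"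
    and fst_U: "fst U = {0}"
    and Cl_one_vertex: "\<lbrakk>Cl G; card (fst G) = 1\<rbrakk> \<Longrightarrow> graph_iso G U"
    and Cl_exists: "0 < n \<Longrightarrow> \<exists>G. Cl G \<and> card (fst G) = n"
    and \<Phi>_comm: "\<Phi> e p f q = \<Phi> f q e p"
    and \<Phi>_assoc: "\<Phi> (e \<and> f) (\<Phi> e p f q) g r = \<Phi> e p (f \<and> g) (\<Phi> f q g r)"
    and \<Phi>_unit: "\<Phi> e p True ((0, 0) \<in> snd U) = p"
    and Cl_refine: "\<lbrakk>Cl A; Cl B; Cl C; Cl D; graph_iso (gprod \<Phi> A B) (gprod \<Phi> C D)\<rbrakk> \<Longrightarrow>
      \<exists>X Y Z W. Cl X \<and> Cl Y \<and> Cl Z \<and> Cl W \<and> graph_iso A (gprod \<Phi> X Y) \<and> graph_iso B (gprod \<Phi> Z W)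
        \<and> graph_iso C (gprod \<Phi> X Z) \<and> graph_iso D (gprod \<Phi> Y W)"
begin

definition class_monoid :: "graph set monoid" where
  "class_monoid = \<lparr>carrier = iso_class ` Collect Cl, monoid.mult = class_prod P, one = iso_class U\<rparr>"

lemma iso_class_eqI: "\<lbrakk>Cl G; Cl H; graph_iso G H\<rbrakk> \<Longrightarrow> iso_class G = iso_class H"
  by (simp add: iso_class_eq_iff Cl_wf)

lemma class_rep_Cl:
  assumes "Cl G"
  shows "Cl (class_rep (iso_class G))"
  using Cl_iso[OF assms] class_rep_iso_class[OF Cl_wf[OF assms]] by blast

lemma class_prod_iso_class:
  assumes "Cl G" "Cl H"
  shows "class_prod P (iso_class G) (iso_class H) = iso_class (gprod \<Phi> G H)"
  unfolding class_prod_def P_eq[OF class_rep_Cl class_rep_Cl, OF assms]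
  by (intro iso_class_eqI Cl_gprod class_rep_Cl assms gprod_cong graph_iso_sym[OF class_rep_iso_class(2)] Cl_wf)

lemma size_iso_class:
  assumes "Cl G"
  shows "card (fst (class_rep (iso_class G))) = card (fst G)"
  using graph_iso_card[OF class_rep_iso_class(2)[OF Cl_wf[OF assms]]] by simp

lemma one_class_monoid: "\<one>\<^bsub>class_monoid\<^esub> = iso_class U"
  by (simp add: class_monoid_def)

lemma mult_class_monoid:
  "\<lbrakk>Cl G; Cl H\<rbrakk> \<Longrightarrow> iso_class G \<otimes>\<^bsub>class_monoid\<^esub> iso_class H = iso_class (gprod \<Phi> G H)"
  by (simp add: class_monoid_def class_prod_iso_class)

lemma class_monoidE:
  assumes "x \<in> carrier class_monoid"
  obtains G where "Cl G" "x = iso_class G"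
  using assms by (auto simp: class_monoid_def)

lemma class_monoidI: "Cl G \<Longrightarrow> iso_class G \<in> carrier class_monoid"
  by (simp add: class_monoid_def)

lemma comm_monoid_class_monoid: "comm_monoid class_monoid"
proof (rule comm_monoidI)
  show "\<one>\<^bsub>class_monoid\<^esub> \<in> carrier class_monoid"
    by (simp add: class_monoid_def Cl_U)
next
  fix x assume "x \<in> carrier class_monoid"
  then obtain G where G: "Cl G" "x = iso_class G"
    by (rule class_monoidE)
  have "graph_iso (gprod \<Phi> U G) G"
    by (rule graph_iso_trans[OF gprod_comm[of \<Phi>, OF \<Phi>_comm]
          graph_iso_sym[OF gprod_unit[of U \<Phi>, OF fst_U \<Phi>_unit]]])
  then show "\<one>\<^bsub>class_monoid\<^esub> \<otimes>\<^bsub>class_monoid\<^esub> x = x"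
    unfolding one_class_monoid G(2) mult_class_monoid[OF Cl_U G(1)]
    by (intro iso_class_eqI Cl_gprod Cl_U G)
  fix y assume "y \<in> carrier class_monoid"
  then obtain H where H: "Cl H" "y = iso_class H"
    by (rule class_monoidE)
  show "x \<otimes>\<^bsub>class_monoid\<^esub> y \<in> carrier class_monoid"
    unfolding G(2) H(2) mult_class_monoid[OF G(1) H(1)] by (intro class_monoidI Cl_gprod G H)
  show "x \<otimes>\<^bsub>class_monoid\<^esub> y = y \<otimes>\<^bsub>class_monoid\<^esub> x"
    unfolding G(2) H(2) mult_class_monoid[OF G(1) H(1)] mult_class_monoid[OF H(1) G(1)]
    by (intro iso_class_eqI Cl_gprod G H gprod_comm \<Phi>_comm)
  fix z assume "z \<in> carrier class_monoid"
  then obtain K where K: "Cl K" "z = iso_class K"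
    by (rule class_monoidE)
  show "x \<otimes>\<^bsub>class_monoid\<^esub> y \<otimes>\<^bsub>class_monoid\<^esub> z = x \<otimes>\<^bsub>class_monoid\<^esub> (y \<otimes>\<^bsub>class_monoid\<^esub> z)"
    unfolding G(2) H(2) K(2) mult_class_monoid[OF G(1) H(1)] mult_class_monoid[OF H(1) K(1)]
      mult_class_monoid[OF Cl_gprod[OF G(1) H(1)] K(1)] mult_class_monoid[OF G(1) Cl_gprod[OF H(1) K(1)]]
    by (intro iso_class_eqI Cl_gprod G H K gprod_assoc \<Phi>_assoc)
qed

text \<open>The number of vertices, read off a representative, serves as size: it is invariant under
  isomorphism and multiplicative for every rule \<open>\<Phi>\<close>.\<close>

lemma refinement_monoid_class_monoid:
  "refinement_monoid class_monoid (\<lambda>C. card (fst (class_rep C)))"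
proof -
  interpret comm_monoid class_monoid
    by (rule comm_monoid_class_monoid)
  show ?thesis
  proof
    fix x assume x: "x \<in> carrier class_monoid"
    then obtain G where G: "Cl G" "x = iso_class G"
      by (rule class_monoidE)
    show "0 < card (fst (class_rep x))"
      using G Cl_nonempty[of G] Cl_wf[of G] by (auto simp: size_iso_class wf_graph_def card_gt_0_iff)
    show "x = \<one>\<^bsub>class_monoid\<^esub>" if "card (fst (class_rep x)) = 1"
      unfolding G(2) one_class_monoid using that G
      by (intro iso_class_eqI Cl_one_vertex Cl_U) (auto simp: size_iso_class)
    fix y assume "y \<in> carrier class_monoid"
    then obtain H where H: "Cl H" "y = iso_class H"
      by (auto simp: class_monoid_def)
    show "card (fst (class_rep (x \<otimes>\<^bsub>class_monoid\<^esub> y))) = card (fst (class_rep x)) * card (fst (class_rep y))"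
      using G H by (simp add: class_monoid_def class_prod_iso_class size_iso_class Cl_gprod card_gprod)
  next
    fix a b c d
    assume "a \<in> carrier class_monoid" "b \<in> carrier class_monoid"
      "c \<in> carrier class_monoid" "d \<in> carrier class_monoid"
    then obtain A B C D where Cl: "Cl A" "Cl B" "Cl C" "Cl D"
      and abcd: "a = iso_class A" "b = iso_class B" "c = iso_class C" "d = iso_class D"
      by (auto simp: class_monoid_def)
    assume "a \<otimes>\<^bsub>class_monoid\<^esub> b = c \<otimes>\<^bsub>class_monoid\<^esub> d"
    then have "graph_iso (gprod \<Phi> A B) (gprod \<Phi> C D)"
      using Cl abcd by (simp add: class_monoid_def class_prod_iso_class iso_class_eq_iff Cl_gprod Cl_wf)
    then obtain X Y Z W where XYZW: "Cl X" "Cl Y" "Cl Z" "Cl W"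
      and iso: "graph_iso A (gprod \<Phi> X Y)" "graph_iso B (gprod \<Phi> Z W)"
        "graph_iso C (gprod \<Phi> X Z)" "graph_iso D (gprod \<Phi> Y W)"
      using Cl_refine[OF Cl] by blast
    have "a = iso_class (gprod \<Phi> X Y)" "b = iso_class (gprod \<Phi> Z W)"
        "c = iso_class (gprod \<Phi> X Z)" "d = iso_class (gprod \<Phi> Y W)"
      unfolding abcd by (intro iso_class_eqI Cl Cl_gprod XYZW iso)+
    then show "\<exists>x\<in>carrier class_monoid. \<exists>y\<in>carrier class_monoid. \<exists>z\<in>carrier class_monoid. \<exists>w\<in>carrier class_monoid.
            a = x \<otimes>\<^bsub>class_monoid\<^esub> y \<and> b = z \<otimes>\<^bsub>class_monoid\<^esub> w \<and> c = x \<otimes>\<^bsub>class_monoid\<^esub> z \<and> d = y \<otimes>\<^bsub>class_monoid\<^esub> w"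
      using XYZW by (intro bexI[of _ "iso_class X"] bexI[of _ "iso_class Y"]
        bexI[of _ "iso_class Z"] bexI[of _ "iso_class W"]) (simp_all add: mult_class_monoid class_monoidI)
  qed
qed

theorem Z_poly_ring_iso: "Z_poly_ring \<simeq> graph_ring (iso_class ` Collect Cl) P U"
proof -
  interpret refinement_monoid class_monoid "\<lambda>C. card (fst (class_rep C))"
    by (rule refinement_monoid_class_monoid)
  \<comment> \<open>Each atom becomes a variable, and \<open>Z_poly_ring\<close> has one variable
    for every natural number.\<close>
  have "infinite atoms"
  proof
    assume "finite atoms"
    moreover have "{p::nat. prime p} \<subseteq> (\<lambda>C. card (fst (class_rep C))) ` atoms"
    proof
      fix p :: nat assume "p \<in> {p. prime p}"
      then have p: "prime p" by simp
      then obtain G where G: "Cl G" "card (fst G) = p"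
        using Cl_exists[of p] by (auto simp: prime_gt_0_nat)
      then have "iso_class G \<in> atoms"
        using p by (intro prime_size_atom) (auto simp: class_monoid_def size_iso_class)
      then show "p \<in> (\<lambda>C. card (fst (class_rep C))) ` atoms"
        using G size_iso_class[OF G(1)] by (intro image_eqI) auto
    qed
    ultimately show False
      using primes_infinite finite_surj by blast
  qed
  moreover have "countable (iso_class ` Collect Cl)"
    by (rule countable_image[OF countable_subset[OF _ countable_wf_graphs]]) (auto simp: Cl_wf)
  then have "countable atoms"
    by (rule countable_subset[rotated]) (use atoms_closed in \<open>auto simp: class_monoid_def\<close>)
  ultimately have "bij_betw (from_nat_into atoms) UNIV atoms"
    by (rule bij_betw_from_nat_into[rotated])
  then interpret enumerated_refinement_monoid class_monoid "\<lambda>C. card (fst (class_rep C))" "from_nat_into atoms"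
    by unfold_locales
  show ?thesis
    using monomial_bij monomial_add monomial_zero
    by (intro Z_poly_ring_iso_graph_ring[of monomial]) (simp_all add: class_monoid_def)
qed

end


section \<open>Two product decompositions of one metric\<close>

text \<open>Values may be asymmetric and negative, as happens for the logarithmic distance of walk
  counts. Separation therefore speaks of the sum of both directions, which the triangle inequality
  keeps nonnegative.\<close>

definition quasi_metric :: "'a set \<Rightarrow> ('a \<Rightarrow> 'a \<Rightarrow> real) \<Rightarrow> bool" where
  "quasi_metric S D \<longleftrightarrow> (\<forall>x\<in>S. D x x = 0) \<and> (\<forall>x\<in>S. \<forall>y\<in>S. \<forall>z\<in>S. D x z \<le> D x y + D y z)
     \<and> (\<forall>x\<in>S. \<forall>y\<in>S. D x y + D y x \<le> 0 \<longrightarrow> x = y)"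

definition mix :: "'t set \<Rightarrow> ('t \<Rightarrow> 'a) \<Rightarrow> ('t \<Rightarrow> 'b) \<Rightarrow> 't \<Rightarrow> 't \<Rightarrow> 't" where
  "mix T a b s t = (THE r. r \<in> T \<and> a r = a s \<and> b r = b t)"

text \<open>If \<open>a\<close>, \<open>b\<close> and \<open>c\<close>, \<open>d\<close> are two coordinate systems on \<open>T\<close>, this is the component of \<open>t\<close>
  in the part common to the \<open>a\<close>-factor and the \<open>c\<close>-factor, realised inside \<open>T\<close> relative to the
  base point \<open>p\<close>.\<close>
definition coord ::
  "'t set \<Rightarrow> ('t \<Rightarrow> 'a) \<Rightarrow> ('t \<Rightarrow> 'b) \<Rightarrow> ('t \<Rightarrow> 'c) \<Rightarrow> ('t \<Rightarrow> 'd) \<Rightarrow> 't \<Rightarrow> 't \<Rightarrow> 't" where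
  "coord T a b c d p t = mix T c d (mix T a b t p) p"

text \<open>Both decompositions are coordinate maps on one set \<open>T\<close>, so that exchanging
  factors or decompositions is a permutation of parameters; the swap lemmas then deliver all four
  common factors from a single construction.\<close>

locale two_products =
  fixes T :: "'t set" and a :: "'t \<Rightarrow> 'a" and b :: "'t \<Rightarrow> 'b" and c :: "'t \<Rightarrow> 'c" and d :: "'t \<Rightarrow> 'd"
    and DA DB DC DD
  assumes ex_ab: "\<lbrakk>s \<in> T; t \<in> T\<rbrakk> \<Longrightarrow> \<exists>r\<in>T. a r = a s \<and> b r = b t"
    and inj_ab: "\<lbrakk>s \<in> T; t \<in> T; a s = a t; b s = b t\<rbrakk> \<Longrightarrow> s = t"
    and ex_cd: "\<lbrakk>s \<in> T; t \<in> T\<rbrakk> \<Longrightarrow> \<exists>r\<in>T. c r = c s \<and> d r = d t"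
    and inj_cd: "\<lbrakk>s \<in> T; t \<in> T; c s = c t; d s = d t\<rbrakk> \<Longrightarrow> s = t"
    and qmA: "quasi_metric (a ` T) DA" and qmB: "quasi_metric (b ` T) DB"
    and qmC: "quasi_metric (c ` T) DC" and qmD: "quasi_metric (d ` T) DD"
    and dist_eq: "\<lbrakk>s \<in> T; t \<in> T\<rbrakk> \<Longrightarrow>
      DA (a s) (a t) + DB (b s) (b t) = DC (c s) (c t) + DD (d s) (d t)"
begin

lemma swap_ab: "two_products T b a c d DB DA DC DD"
proof
  show "\<exists>r\<in>T. b r = b s \<and> a r = a t" if "s \<in> T" "t \<in> T" for s t
    using ex_ab[OF that(2,1)] by blast
  show "DB (b s) (b t) + DA (a s) (a t) = DC (c s) (c t) + DD (d s) (d t)" if "s \<in> T" "t \<in> T" for s t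
    using dist_eq[OF that] by simp
qed (use inj_ab ex_cd inj_cd qmA qmB qmC qmD in blast)+

lemma swap_pairs: "two_products T c d a b DC DD DA DB"
proof
  show "DC (c s) (c t) + DD (d s) (d t) = DA (a s) (a t) + DB (b s) (b t)" if "s \<in> T" "t \<in> T" for s t
    using dist_eq[OF that] by simp
qed (use ex_ab inj_ab ex_cd inj_cd qmA qmB qmC qmD in blast)+

lemma
  assumes "s \<in> T" "t \<in> T"
  shows mix_ab_in: "mix T a b s t \<in> T"
    and a_mix_ab: "a (mix T a b s t) = a s"
    and b_mix_ab: "b (mix T a b s t) = b t"
proof -
  have "\<exists>!r. r \<in> T \<and> a r = a s \<and> b r = b t"
    using ex_ab[OF assms] inj_ab by metis
  then have "mix T a b s t \<in> T \<and> a (mix T a b s t) = a s \<and> b (mix T a b s t) = b t"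
    unfolding mix_def by (rule theI')
  then show "mix T a b s t \<in> T" "a (mix T a b s t) = a s" "b (mix T a b s t) = b t"
    by auto
qed

text \<open>Fibres of \<open>b\<close> are geodesically convex, and \<open>r\<close> lies on a geodesic from \<open>s\<close> to \<open>t\<close>.\<close>
lemma box:
  assumes T: "r \<in> T" "s \<in> T" "t \<in> T" and eq: "b s = b t" "c r = c s" "d r = d t"
  shows "b r = b s"
proof -
  have DB: "DB (b r) (b r) = 0" "DB (b s) (b r) + DB (b r) (b s) \<le> 0 \<longrightarrow> b s = b r" "DB (b s) (b s) = 0"
    using qmB T unfolding quasi_metric_def by auto
  have DA: "DA (a s) (a t) \<le> DA (a s) (a r) + DA (a r) (a t)"
    using qmA T unfolding quasi_metric_def by auto
  have "DC (c s) (c s) = 0" "DD (d t) (d t) = 0"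
    using qmC qmD T unfolding quasi_metric_def by auto
  \<comment> \<open>Measured by \<open>c\<close> and \<open>d\<close>, the path s, r, t is exactly
    as long as the direct way from s to t, whose \<open>b\<close>-part is zero. The triangle
    inequality for \<open>DA\<close> leaves at most zero for the \<open>b\<close>-part of the
    path.\<close>
  then have "DB (b s) (b r) + DB (b r) (b s) \<le> 0"
    using dist_eq[OF T(2,1)] dist_eq[OF T(1,3)] dist_eq[OF T(2,3)] DA DB eq by auto
  then show ?thesis
    using DB by simp
qed

text \<open>\<open>n\<close> lies on a geodesic from \<open>t\<close> to \<open>p\<close>, and \<open>p\<close> on one from \<open>l\<close> to \<open>n\<close>.\<close>
lemma parallel:
  assumes T: "t \<in> T" "l \<in> T" "n \<in> T" "p \<in> T"
    and eq: "a t = a n" "a l = a p" "b t = b l" "b n = b p" "c t = c l"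
  shows "c n = c p"
proof -
  have DA: "DA (a n) (a n) = 0" "DA (a p) (a p) = 0"
    using qmA T unfolding quasi_metric_def by auto
  have DB: "DB (b p) (b p) = 0"
    using qmB T unfolding quasi_metric_def by auto
  have DC: "DC (c l) (c p) \<le> DC (c l) (c n) + DC (c n) (c p)"
      "DC (c l) (c n) \<le> DC (c l) (c p) + DC (c p) (c n)"
      "DC (c n) (c p) + DC (c p) (c n) \<le> 0 \<longrightarrow> c n = c p"
    using qmC T unfolding quasi_metric_def by auto
  have DD: "DD (d t) (d p) \<le> DD (d t) (d n) + DD (d n) (d p)"
      "DD (d l) (d n) \<le> DD (d l) (d p) + DD (d p) (d n)"
    using qmD T unfolding quasi_metric_def by auto
  \<comment> \<open>Equality along each geodesic forces equality in the \<open>c\<close>-part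
    separately. Since \<open>c t = c l\<close>, adding the two equalities cancels
    \<open>DC (c l) (c p)\<close> and \<open>DC (c l) (c n)\<close>.\<close>
  have "DC (c n) (c p) + DC (c p) (c n) \<le> 0"
    using dist_eq[OF T(1,3)] dist_eq[OF T(1,4)] dist_eq[OF T(2,3)] dist_eq[OF T(2,4)]
      dist_eq[OF T(3,4)] dist_eq[OF T(4,3)] DA DB DC DD eq by simp
  then show ?thesis
    using DC by simp
qed

lemmas swap_cd = two_products.swap_pairs[OF two_products.swap_ab[OF swap_pairs]]

lemmas mix_cd_in = two_products.mix_ab_in[OF swap_pairs]
  and c_mix_cd = two_products.a_mix_ab[OF swap_pairs]
  and d_mix_cd = two_products.b_mix_ab[OF swap_pairs]

section \<open>The common factors of two decompositions\<close>

context
  fixes p assumes p: "p \<in> T"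
begin

text \<open>The projection \<open>mix T a b t p\<close> and \<open>p\<close> both lie in the fibre
  \<open>b = b p\<close>, so \<open>box\<close> keeps the corner with \<open>c\<close> from the
  former and \<open>d\<close> from the latter in it. All values of \<open>coord\<close> thus lie in
  two fibres through \<open>p\<close> at once, that of \<open>b\<close> and that of
  \<open>d\<close>.\<close>

lemma
  assumes t: "t \<in> T"
  shows coord_in: "coord T a b c d p t \<in> T"
    and b_coord: "b (coord T a b c d p t) = b p"
    and c_coord: "c (coord T a b c d p t) = c (mix T a b t p)"
    and d_coord: "d (coord T a b c d p t) = d p"
proof -
  let ?n = "mix T a b t p"
  have n: "?n \<in> T" "b ?n = b p"
    using p t by (auto simp: mix_ab_in b_mix_ab)
  show *: "coord T a b c d p t \<in> T" "c (coord T a b c d p t) = c ?n" "d (coord T a b c d p t) = d p"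
    using n p by (auto simp: coord_def mix_cd_in c_mix_cd d_mix_cd)
  show "b (coord T a b c d p t) = b p"
    using box[of "coord T a b c d p t" ?n p] n p * by simp
qed

lemma coord_cong_a: "a s = a t \<Longrightarrow> coord T a b c d p s = coord T a b c d p t"
  by (simp add: coord_def mix_def)

end

text \<open>This makes the factor common to A and C one and the same set, whichever decomposition is
  projected first. Both points lie in the fibre \<open>d = d p\<close>, so only \<open>c\<close> has
  to be compared; the auxiliary corner \<open>l\<close> completes \<open>t\<close>,
  \<open>n\<close>, \<open>q\<close> to a rectangle to which \<open>parallel\<close>
  applies.\<close>

lemma coord_commute:
  assumes p: "p \<in> T" and t: "t \<in> T"
  shows "coord T a b c d p t = coord T c d a b p t"
proof -
  define m n l q where "m = mix T c d t p" and "n = mix T a b t p" and "l = mix T a b m t"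
    and "q = coord T c d a b p t"
  have m: "m \<in> T" "c m = c t"
    using p t by (auto simp: m_def mix_cd_in c_mix_cd)
  have n: "n \<in> T" "a n = a t" "b n = b p"
    using p t by (auto simp: n_def mix_ab_in a_mix_ab b_mix_ab)
  have l: "l \<in> T" "a l = a m" "b l = b t"
    using m t by (auto simp: l_def mix_ab_in a_mix_ab b_mix_ab)
  have "c l = c t"
    using two_products.box[OF two_products.swap_ab[OF swap_pairs], of l m t] l m t by simp
  have q: "q \<in> T" "a q = a m" "b q = b p" "d q = d p"
    using two_products.coord_in[OF swap_pairs p t] two_products.b_coord[OF swap_pairs p t] two_products.c_coord[OF swap_pairs p t] two_products.d_coord[OF swap_pairs p t]
    by (auto simp: q_def m_def)
  have "c n = c q"
    using parallel[of t l n q] t l n q m \<open>c l = c t\<close> by simp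
  then show ?thesis
    using coord_in[OF p t] c_coord[OF p t] d_coord[OF p t] q
    by (intro inj_cd) (auto simp: q_def n_def)
qed

lemma coord_cong_c:
  assumes "p \<in> T" "s \<in> T" "t \<in> T" "c s = c t"
  shows "coord T a b c d p s = coord T a b c d p t"
  unfolding coord_commute[OF assms(1,2)] coord_commute[OF assms(1,3)]
  by (rule two_products.coord_cong_a[OF swap_pairs]) (use assms in auto)

text \<open>Knowing \<open>a t\<close> means knowing the point \<open>mix T a b t p\<close>, which
  is determined by its \<open>c\<close>- and \<open>d\<close>-values; the two coordinates retain
  exactly these.\<close>

lemma coord_split:
  assumes "p \<in> T" "s \<in> T" "t \<in> T"
  shows "a s = a t \<longleftrightarrow>
    coord T a b c d p s = coord T a b c d p t \<and> coord T a b d c p s = coord T a b d c p t"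
proof
  assume "coord T a b c d p s = coord T a b c d p t \<and> coord T a b d c p s = coord T a b d c p t"
  then have "mix T a b s p = mix T a b t p"
    using c_coord[OF assms(1,2)] c_coord[OF assms(1,3)] two_products.c_coord[OF swap_cd assms(1,2)]
      two_products.c_coord[OF swap_cd assms(1,3)] mix_ab_in assms by (intro inj_cd) auto
  then show "a s = a t"
    using a_mix_ab assms by metis
next
  assume "a s = a t"
  then show "coord T a b c d p s = coord T a b c d p t \<and> coord T a b d c p s = coord T a b d c p t"
    using coord_cong_a[OF assms(1)] two_products.coord_cong_a[OF swap_cd assms(1)] by blast
qed

text \<open>One coordinate depends on \<open>c\<close> alone and the other on \<open>d\<close>
  alone, so they can be prescribed independently.\<close>

lemma coord_mix:
  assumes "p \<in> T" "s \<in> T" "t \<in> T"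
  shows "coord T a b c d p (mix T c d s t) = coord T a b c d p s"
    and "coord T a b d c p (mix T c d s t) = coord T a b d c p t"
  using assms by (auto intro: coord_cong_c two_products.coord_cong_c[OF swap_cd] simp: mix_cd_in c_mix_cd d_mix_cd)

lemma coord_eq_iff:
  assumes "p \<in> T" "s \<in> T" "t \<in> T"
  shows "coord T a b c d p s = coord T a b c d p t \<longleftrightarrow> c (mix T a b s p) = c (mix T a b t p)"
proof
  assume "c (mix T a b s p) = c (mix T a b t p)"
  then show "coord T a b c d p s = coord T a b c d p t"
    using assms by (intro inj_cd) (auto simp: coord_in c_coord d_coord)
qed (metis assms c_coord)

text \<open>The choice made by \<open>inv_into T a \<alpha>\<close> is harmless, both coordinates
  being functions of \<open>a t\<close>. Surjectivity comes from \<open>coord_mix\<close>.\<close>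

lemma coord_bij:
  assumes p: "p \<in> T"
  shows "bij_betw (\<lambda>\<alpha>. (coord T a b c d p (inv_into T a \<alpha>), coord T a b d c p (inv_into T a \<alpha>)))
    (a ` T) (coord T a b c d p ` T \<times> coord T a b d c p ` T)"
    (is "bij_betw ?f _ (?X \<times> ?Y)")
proof (rule bij_betw_imageI)
  have f: "?f (a t) = (coord T a b c d p t, coord T a b d c p t)" if "t \<in> T" for t
    using that p coord_split[of p "inv_into T a (a t)" t]
    by (auto simp: f_inv_into_f inv_into_into)
  show "inj_on ?f (a ` T)"
  proof (rule inj_onI)
    fix x y assume "x \<in> a ` T" "y \<in> a ` T" and eq: "?f x = ?f y"
    then obtain s t where "s \<in> T" "x = a s" "t \<in> T" "y = a t"
      by auto
    then show "x = y"
      using eq coord_split[OF p, of s t] f[of s] f[of t] by simp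
  qed
  show "?f ` a ` T = ?X \<times> ?Y"
  proof
    show "?f ` a ` T \<subseteq> ?X \<times> ?Y"
      using f by auto
    show "?X \<times> ?Y \<subseteq> ?f ` a ` T"
    proof clarify
      fix s t assume st: "s \<in> T" "t \<in> T"
      then have "?f (a (mix T c d s t)) = (coord T a b c d p s, coord T a b d c p t)"
        using f coord_mix[OF p st] mix_cd_in by simp
      then show "(coord T a b c d p s, coord T a b d c p t) \<in> ?f ` a ` T"
        using mix_cd_in[OF st] by (intro image_eqI[of _ _ "a (mix T c d s t)"]) auto
    qed
  qed
qed

end


section \<open>Walks and connectedness\<close>

lemma wf_graph_edge: "\<lbrakk>wf_graph G; (u, v) \<in> snd G\<rbrakk> \<Longrightarrow> u \<in> fst G \<and> v \<in> fst G"
  by (auto simp: wf_graph_def)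

lemma wf_graph_sym: "wf_graph G \<Longrightarrow> (u, v) \<in> snd G \<longleftrightarrow> (v, u) \<in> snd G"
  by (auto simp: wf_graph_def sym_def)

lemma relpow_iso:
  assumes wf: "wf_graph G" "wf_graph H" and f: "bij_betw f (fst G) (fst H)"
    and E: "\<And>u v. \<lbrakk>u \<in> fst G; v \<in> fst G\<rbrakk> \<Longrightarrow> (u, v) \<in> snd G \<longleftrightarrow> (f u, f v) \<in> snd H"
    and u: "u \<in> fst G"
  shows "v \<in> fst G \<Longrightarrow> (u, v) \<in> snd G ^^ n \<longleftrightarrow> (f u, f v) \<in> snd H ^^ n"
proof (induction n arbitrary: v)
  case 0
  then show ?case
    using f u by (auto simp: bij_betw_def inj_on_def)
next
  case (Suc n)
  have "(u, v) \<in> snd G ^^ Suc n \<longleftrightarrow> (\<exists>w\<in>fst G. (u, w) \<in> snd G ^^ n \<and> (w, v) \<in> snd G)"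
    using wf_graph_edge[OF wf(1)] by auto
  also have "\<dots> \<longleftrightarrow> (\<exists>w\<in>fst G. (f u, f w) \<in> snd H ^^ n \<and> (f w, f v) \<in> snd H)"
    using Suc E by auto
  also have "\<dots> \<longleftrightarrow> (\<exists>w\<in>fst H. (f u, w) \<in> snd H ^^ n \<and> (w, f v) \<in> snd H)"
    unfolding bij_betw_imp_surj_on[OF f, symmetric] by simp
  also have "\<dots> \<longleftrightarrow> (f u, f v) \<in> snd H ^^ Suc n"
    using wf_graph_edge[OF wf(2)] by auto
  finally show ?case .
qed

lemma connected_graph_relpow:
  "connected_graph G \<longleftrightarrow> fst G \<noteq> {} \<and> (\<forall>u\<in>fst G. \<forall>v\<in>fst G. \<exists>n. (u, v) \<in> snd G ^^ n)"
  by (simp add: connected_graph_def rtrancl_is_UN_relpow)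

lemma connected_graph_iso:
  assumes "wf_graph G" "wf_graph H" "graph_iso G H" "connected_graph G"
  shows "connected_graph H"
proof -
  obtain f where f: "bij_betw f (fst G) (fst H)"
    "\<And>u v. \<lbrakk>u \<in> fst G; v \<in> fst G\<rbrakk> \<Longrightarrow> (u, v) \<in> snd G \<longleftrightarrow> (f u, f v) \<in> snd H"
    using assms by (auto simp: graph_iso_def)
  have im: "fst H = f ` fst G"
    using f(1) by (simp add: bij_betw_def)
  show ?thesis
    using assms(4) relpow_iso[OF assms(1,2) f] unfolding connected_graph_relpow im by auto
qed

lemma simple_graph_iso:
  assumes "simple_graph G" "wf_graph H" "graph_iso G H"
  shows "simple_graph H"
proof -
  obtain f where f: "bij_betw f (fst G) (fst H)"
    "\<And>u v. \<lbrakk>u \<in> fst G; v \<in> fst G\<rbrakk> \<Longrightarrow> (u, v) \<in> snd G \<longleftrightarrow> (f u, f v) \<in> snd H"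
    using assms by (auto simp: graph_iso_def)
  have "(v, v) \<notin> snd H" for v
  proof
    assume v: "(v, v) \<in> snd H"
    then have "v \<in> f ` fst G"
      using wf_graph_edge[OF assms(2)] f(1) by (auto simp: bij_betw_def)
    then show False
      using v f(2) assms(1) by (auto simp: simple_graph_def)
  qed
  then show ?thesis
    using assms(2) by (simp add: simple_graph_def)
qed

section \<open>Graph distance\<close>

definition gdist :: "graph \<Rightarrow> nat \<Rightarrow> nat \<Rightarrow> real" where
  "gdist G u v = real (LEAST n. (u, v) \<in> snd G ^^ n)"

lemma gdist_le: "(u, v) \<in> snd G ^^ n \<Longrightarrow> gdist G u v \<le> n"
  by (simp add: gdist_def Least_le)

lemma gdist_attained:
  assumes "connected_graph G" "u \<in> fst G" "v \<in> fst G"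
  obtains n where "gdist G u v = real n" "(u, v) \<in> snd G ^^ n"
  using assms by (metis LeastI connected_graph_relpow gdist_def)

lemma quasi_metric_gdist:
  assumes "connected_graph G"
  shows "quasi_metric (fst G) (gdist G)"
  unfolding quasi_metric_def
proof (intro conjI ballI impI)
  fix u v assume u: "u \<in> fst G" and v: "v \<in> fst G"
  have nonneg: "0 \<le> gdist G s t" for s t
    by (simp add: gdist_def)
  show "gdist G u u = 0"
    using gdist_le[of u u 0 G] nonneg[of u u] by simp
  show "u = v" if "gdist G u v + gdist G v u \<le> 0"
  proof -
    have "gdist G u v = 0"
      using that nonneg[of u v] nonneg[of v u] by linarith
    then show ?thesis
      using gdist_attained[OF assms u v] by (metis of_nat_eq_0_iff pair_in_Id_conv relpow.simps(1))
  qed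
  fix w assume w: "w \<in> fst G"
  obtain m n where "gdist G u v = real m" "(u, v) \<in> snd G ^^ m"
    "gdist G v w = real n" "(v, w) \<in> snd G ^^ n"
    using gdist_attained[OF assms u v] gdist_attained[OF assms v w] by metis
  then show "gdist G u w \<le> gdist G u v + gdist G v w"
    using gdist_le[of u w "m + n" G] by (auto simp: relpow_add)
qed

lemma gdist_iso:
  assumes "wf_graph G" "wf_graph H" "bij_betw f (fst G) (fst H)"
    and "\<And>u v. \<lbrakk>u \<in> fst G; v \<in> fst G\<rbrakk> \<Longrightarrow> (u, v) \<in> snd G \<longleftrightarrow> (f u, f v) \<in> snd H"
    and "u \<in> fst G" "v \<in> fst G"
  shows "gdist G u v = gdist H (f u) (f v)"
  unfolding gdist_def using relpow_iso[OF assms] by simp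

section \<open>The Cartesian product\<close>

abbreviation cart_rule :: "bool \<Rightarrow> bool \<Rightarrow> bool \<Rightarrow> bool \<Rightarrow> bool" where
  "cart_rule e p f q \<equiv> e \<and> q \<or> p \<and> f"

text \<open>Each step moves a single coordinate, so a walk in the product is a shuffle of one walk
  in each factor, and lengths add.\<close>

lemma relpow_cart:
  assumes wf: "wf_graph G" "wf_graph H" and u: "u \<in> fst G" and v: "v \<in> fst H"
  shows "u' \<in> fst G \<Longrightarrow> v' \<in> fst H \<Longrightarrow>
    (prod_encode (u, v), prod_encode (u', v')) \<in> snd (gprod cart_rule G H) ^^ n \<longleftrightarrow>
      (\<exists>i j. i + j = n \<and> (u, u') \<in> snd G ^^ i \<and> (v, v') \<in> snd H ^^ j)"
proof (induction n arbitrary: u' v')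
  case 0
  then show ?case by auto
next
  case (Suc n)
  let ?R = "snd (gprod cart_rule G H)"
  have edge: "(w, prod_encode (u', v')) \<in> ?R \<longleftrightarrow>
      (\<exists>v''\<in>fst H. w = prod_encode (u', v'') \<and> (v'', v') \<in> snd H) \<or>
      (\<exists>u''\<in>fst G. w = prod_encode (u'', v') \<and> (u'', u') \<in> snd G)" for w
    using Suc.prems by (auto simp: gprod_def)
  have "(prod_encode (u, v), prod_encode (u', v')) \<in> ?R ^^ Suc n \<longleftrightarrow>
      (\<exists>v''\<in>fst H. (prod_encode (u, v), prod_encode (u', v'')) \<in> ?R ^^ n \<and> (v'', v') \<in> snd H) \<or>
      (\<exists>u''\<in>fst G. (prod_encode (u, v), prod_encode (u'', v')) \<in> ?R ^^ n \<and> (u'', u') \<in> snd G)"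
    unfolding relpow.simps relcomp_unfold using edge by auto
  also have "\<dots> \<longleftrightarrow>
      (\<exists>i j. i + j = n \<and> (u, u') \<in> snd G ^^ i \<and> (\<exists>v''. (v, v'') \<in> snd H ^^ j \<and> (v'', v') \<in> snd H)) \<or>
      (\<exists>i j. i + j = n \<and> (\<exists>u''. (u, u'') \<in> snd G ^^ i \<and> (u'', u') \<in> snd G) \<and> (v, v') \<in> snd H ^^ j)"
    using Suc.IH Suc.prems wf_graph_edge[OF wf(1)] wf_graph_edge[OF wf(2)] by blast
  also have "\<dots> \<longleftrightarrow> (\<exists>i j. i + j = n \<and> (u, u') \<in> snd G ^^ i \<and> (v, v') \<in> snd H ^^ Suc j) \<or>
      (\<exists>i j. i + j = n \<and> (u, u') \<in> snd G ^^ Suc i \<and> (v, v') \<in> snd H ^^ j)"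
    by (simp add: relcomp_unfold)
  also have "\<dots> \<longleftrightarrow> (\<exists>i j. i + j = Suc n \<and> (u, u') \<in> snd G ^^ i \<and> (v, v') \<in> snd H ^^ j)"
    (is "?L \<longleftrightarrow> ?R")
  proof
    assume ?L
    then show ?R
      by (metis add_Suc add_Suc_right)
  next
    assume ?R
    then obtain i j where ij: "i + j = Suc n" "(u, u') \<in> snd G ^^ i" "(v, v') \<in> snd H ^^ j"
      by blast
    show ?L
    proof (cases i)
      case 0
      then show ?thesis
        using ij by (intro disjI1 exI[of _ 0] exI[of _ n]) auto
    next
      case (Suc k)
      then show ?thesis
        using ij by (intro disjI2 exI[of _ k] exI[of _ j]) auto
    qed
  qed
  finally show ?case .
qed

text \<open>The direction from the product to its factors is the one that makes the common factors
  connected again.\<close>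

lemma connected_cart:
  assumes "wf_graph G" "wf_graph H"
  shows "connected_graph (gprod cart_rule G H) \<longleftrightarrow> connected_graph G \<and> connected_graph H"
proof
  assume L: "connected_graph (gprod cart_rule G H)"
  then have ne: "fst G \<noteq> {}" "fst H \<noteq> {}"
    by (auto simp: connected_graph_def fst_gprod)
  then show "connected_graph G \<and> connected_graph H"
    using L unfolding connected_graph_relpow fst_gprod by (auto simp: relpow_cart[OF assms])
next
  assume "connected_graph G \<and> connected_graph H"
  then show "connected_graph (gprod cart_rule G H)"
    unfolding connected_graph_relpow fst_gprod by (auto simp: relpow_cart[OF assms])
qed

lemma gdist_cart:
  assumes wf: "wf_graph G" "wf_graph H" and conn: "connected_graph G" "connected_graph H"
    and u: "u \<in> fst G" "u' \<in> fst G" and v: "v \<in> fst H" "v' \<in> fst H"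
  shows "gdist (gprod cart_rule G H) (prod_encode (u, v)) (prod_encode (u', v')) = gdist G u u' + gdist H v v'"
proof (rule antisym)
  obtain i j where "gdist G u u' = real i" "(u, u') \<in> snd G ^^ i"
    "gdist H v v' = real j" "(v, v') \<in> snd H ^^ j"
    using gdist_attained[OF conn(1) u] gdist_attained[OF conn(2) v] by metis
  then show "gdist (gprod cart_rule G H) (prod_encode (u, v)) (prod_encode (u', v')) \<le> gdist G u u' + gdist H v v'"
    using gdist_le[of "prod_encode (u, v)" "prod_encode (u', v')" "i + j" "gprod cart_rule G H"]
      relpow_cart[OF wf u(1) v(1) u(2) v(2), of "i + j"] by auto
  have "connected_graph (gprod cart_rule G H)"
    using connected_cart[OF wf] conn by simp
  then obtain n where n: "gdist (gprod cart_rule G H) (prod_encode (u, v)) (prod_encode (u', v')) = real n"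
      "(prod_encode (u, v), prod_encode (u', v')) \<in> snd (gprod cart_rule G H) ^^ n"
    by (rule gdist_attained) (use u v in \<open>auto simp: gprod_vertex\<close>)
  then obtain i j where "i + j = n" "(u, u') \<in> snd G ^^ i" "(v, v') \<in> snd H ^^ j"
    using relpow_cart[OF wf u(1) v(1) u(2) v(2)] by blast
  then show "gdist G u u' + gdist H v v' \<le> gdist (gprod cart_rule G H) (prod_encode (u, v)) (prod_encode (u', v'))"
    using n(1) gdist_le[of u u' i G] gdist_le[of v v' j H] by simp
qed

definition fst_of :: "nat \<Rightarrow> nat" where "fst_of n = fst (prod_decode n)"
definition snd_of :: "nat \<Rightarrow> nat" where "snd_of n = snd (prod_decode n)"

lemma fst_of_encode [simp]: "fst_of (prod_encode (u, v)) = u"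
  and snd_of_encode [simp]: "snd_of (prod_encode (u, v)) = v"
  by (simp_all add: fst_of_def snd_of_def)

lemma gprod_vertex_of: "n \<in> fst (gprod \<Phi> G H) \<Longrightarrow> fst_of n \<in> fst G \<and> snd_of n \<in> fst H"
  by (auto simp: fst_gprod)

lemma gprod_edge_of:
  "\<lbrakk>m \<in> fst (gprod \<Phi> G H); n \<in> fst (gprod \<Phi> G H)\<rbrakk> \<Longrightarrow> (m, n) \<in> snd (gprod \<Phi> G H) \<longleftrightarrow>
    \<Phi> (fst_of m = fst_of n) ((fst_of m, fst_of n) \<in> snd G) (snd_of m = snd_of n) ((snd_of m, snd_of n) \<in> snd H)"
  by (auto simp: fst_gprod gprod_edge)

lemma image_fst_of: "fst H \<noteq> {} \<Longrightarrow> fst_of ` fst (gprod \<Phi> G H) = fst G"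
  and image_snd_of: "fst G \<noteq> {} \<Longrightarrow> snd_of ` fst (gprod \<Phi> G H) = fst H"
  by (force simp: fst_gprod image_iff)+

text \<open>The coordinates of the second product are pulled back along \<open>\<phi>\<close>, which
  places both decompositions on the vertices of the first.\<close>

lemma two_products_gprod:
  assumes ne: "fst A \<noteq> {}" "fst B \<noteq> {}" "fst C \<noteq> {}" "fst D \<noteq> {}"
    and \<phi>: "bij_betw \<phi> (fst (gprod \<Phi> A B)) (fst (gprod \<Phi> C D))"
    and qm: "quasi_metric (fst A) DA" "quasi_metric (fst B) DB" "quasi_metric (fst C) DC" "quasi_metric (fst D) DD"
    and dist: "\<And>s t. \<lbrakk>s \<in> fst (gprod \<Phi> A B); t \<in> fst (gprod \<Phi> A B)\<rbrakk> \<Longrightarrow>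
      DA (fst_of s) (fst_of t) + DB (snd_of s) (snd_of t) =
      DC (fst_of (\<phi> s)) (fst_of (\<phi> t)) + DD (snd_of (\<phi> s)) (snd_of (\<phi> t))"
  shows "two_products (fst (gprod \<Phi> A B)) fst_of snd_of (\<lambda>t. fst_of (\<phi> t)) (\<lambda>t. snd_of (\<phi> t)) DA DB DC DD"
    and "fst_of ` fst (gprod \<Phi> A B) = fst A" "snd_of ` fst (gprod \<Phi> A B) = fst B"
    and "(\<lambda>t. fst_of (\<phi> t)) ` fst (gprod \<Phi> A B) = fst C" "(\<lambda>t. snd_of (\<phi> t)) ` fst (gprod \<Phi> A B) = fst D"
proof -
  let ?T = "fst (gprod \<Phi> A B)" and ?T' = "fst (gprod \<Phi> C D)"
  have im_\<phi>: "\<phi> ` ?T = ?T'"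
    using \<phi> by (simp add: bij_betw_def)
  show im: "fst_of ` ?T = fst A" "snd_of ` ?T = fst B"
    using ne by (simp_all add: image_fst_of image_snd_of)
  show im': "(\<lambda>t. fst_of (\<phi> t)) ` ?T = fst C" "(\<lambda>t. snd_of (\<phi> t)) ` ?T = fst D"
    using ne image_image[of fst_of \<phi> ?T] image_image[of snd_of \<phi> ?T]
    by (simp_all add: im_\<phi> image_fst_of image_snd_of)
  have ex: "\<exists>r\<in>fst (gprod \<Phi> G H). fst_of r = fst_of s \<and> snd_of r = snd_of t"
    if "s \<in> fst (gprod \<Phi> G H)" "t \<in> fst (gprod \<Phi> G H)" for s t G H
    using gprod_vertex_of[OF that(1)] gprod_vertex_of[OF that(2)]
    by (intro bexI[of _ "prod_encode (fst_of s, snd_of t)"]) (auto simp: gprod_vertex)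
  have inj: "s = t" if "fst_of s = fst_of t" "snd_of s = snd_of t" for s t
    using that by (metis fst_of_def prod_decode_eq prod_eqI snd_of_def)
  show "two_products ?T fst_of snd_of (\<lambda>t. fst_of (\<phi> t)) (\<lambda>t. snd_of (\<phi> t)) DA DB DC DD"
  proof
    show "\<exists>r\<in>?T. fst_of (\<phi> r) = fst_of (\<phi> s) \<and> snd_of (\<phi> r) = snd_of (\<phi> t)"
      if "s \<in> ?T" "t \<in> ?T" for s t
    proof -
      have "\<exists>r\<in>\<phi> ` ?T. fst_of r = fst_of (\<phi> s) \<and> snd_of r = snd_of (\<phi> t)"
        unfolding im_\<phi> using that im_\<phi> by (intro ex) auto
      then show ?thesis
        by blast
    qed
    show "s = t" if "s \<in> ?T" "t \<in> ?T" "fst_of (\<phi> s) = fst_of (\<phi> t)" "snd_of (\<phi> s) = snd_of (\<phi> t)" for s t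
      using inj[of "\<phi> s" "\<phi> t"] that \<phi> by (auto simp: bij_betw_def inj_on_def)
  qed (use ex inj qm dist im im' in auto)
qed

section \<open>Refinement for the Cartesian product\<close>

definition induced :: "(nat \<times> nat) set \<Rightarrow> nat set \<Rightarrow> graph" where
  "induced F K = (K, F \<inter> K \<times> K)"

text \<open>Inside the fibre \<open>b = b p\<close> the edges of \<open>F\<close> are those of A, as
  the base vertex of B has no loop. The rule in \<open>c\<close> and \<open>d\<close> splits the
  same edges: where \<open>d\<close> is constant they come from \<open>EC\<close>, where
  \<open>c\<close> is constant from \<open>ED\<close>. Hence both factors are induced subgraphs
  through \<open>p\<close>.\<close>

lemma cart_factor:
  fixes T :: "nat set"
  assumes "two_products T a b c d DA DB DC DD" and p: "p \<in> T" and A: "fst A = a ` T"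
    and F: "\<And>s t. \<lbrakk>s \<in> T; t \<in> T\<rbrakk> \<Longrightarrow> (s, t) \<in> F \<longleftrightarrow> cart_rule (a s = a t) ((a s, a t) \<in> snd A) (b s = b t) (EB (b s) (b t))"
      "\<And>s t. \<lbrakk>s \<in> T; t \<in> T\<rbrakk> \<Longrightarrow> (s, t) \<in> F \<longleftrightarrow> cart_rule (c s = c t) (EC (c s) (c t)) (d s = d t) (ED (d s) (d t))"
    and irrefl: "\<not> EB (b p) (b p)" "\<not> EC (c p) (c p)" "\<not> ED (d p) (d p)"
  shows "graph_iso A (gprod cart_rule (induced F (coord T a b c d p ` T)) (induced F (coord T a b d c p ` T)))"
proof (rule graph_iso_gprodI)
  interpret two_products T a b c d DA DB DC DD
    by (rule assms(1))
  let ?x = "coord T a b c d p" and ?y = "coord T a b d c p"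
  show "bij_betw (\<lambda>\<alpha>. (?x (inv_into T a \<alpha>), ?y (inv_into T a \<alpha>))) (fst A)
    (fst (induced F (?x ` T)) \<times> fst (induced F (?y ` T)))"
    using coord_bij[OF p] by (simp add: induced_def A)
  fix u v assume "u \<in> fst A" "v \<in> fst A"
  define s t where "s = inv_into T a u" and "t = inv_into T a v"
  have s: "s \<in> T" "u = a s" and t: "t \<in> T" "v = a t"
    using \<open>u \<in> fst A\<close> \<open>v \<in> fst A\<close> by (auto simp: s_def t_def A inv_into_into f_inv_into_f)
  \<comment> \<open>Representatives inside the fibre \<open>b = b p\<close>: their
    \<open>a\<close>-values are unchanged, and their \<open>c\<close>- and \<open>d\<close>-values
    are those that \<open>?x\<close> and \<open>?y\<close> retain.\<close>
  define s' t' where "s' = mix T a b s p" and "t' = mix T a b t p"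
  have s': "s' \<in> T" "a s' = a s" "b s' = b p" and t': "t' \<in> T" "a t' = a t" "b t' = b p"
    using s t p by (auto simp: s'_def t'_def mix_ab_in a_mix_ab b_mix_ab)
  note y = two_products.coord_in[OF swap_cd p] two_products.c_coord[OF swap_cd p] two_products.d_coord[OF swap_cd p]
    two_products.coord_eq_iff[OF swap_cd p]
  have eqs: "?x s = ?x t \<longleftrightarrow> c s' = c t'" "?y s = ?y t \<longleftrightarrow> d s' = d t'"
    using coord_eq_iff[OF p] y s t by (auto simp: s'_def t'_def)
  have "(u, v) \<in> snd A \<longleftrightarrow> (s', t') \<in> F"
    using F(1)[OF s'(1) t'(1)] s t s' t' irrefl by auto
  also have "\<dots> \<longleftrightarrow> cart_rule (c s' = c t') (EC (c s') (c t')) (d s' = d t') (ED (d s') (d t'))"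
    by (rule F(2)[OF s'(1) t'(1)])
  finally show "(u, v) \<in> snd A \<longleftrightarrow> cart_rule (?x (inv_into T a u) = ?x (inv_into T a v))
      ((?x (inv_into T a u), ?x (inv_into T a v)) \<in> snd (induced F (?x ` T)))
      (?y (inv_into T a u) = ?y (inv_into T a v))
      ((?y (inv_into T a u), ?y (inv_into T a v)) \<in> snd (induced F (?y ` T)))"
    unfolding s_def[symmetric] t_def[symmetric] induced_def
    using s t F(2)[of "?x s" "?x t"] F(2)[of "?y s" "?y t"] coord_in[OF p] c_coord[OF p] d_coord[OF p] y irrefl eqs
    by (auto simp: s'_def t'_def)
qed

lemma (in two_products) coord_image:
  assumes "p \<in> T"
  shows "coord T c d a b p ` T = coord T a b c d p ` T"
  using coord_commute[OF assms] by (intro image_cong) auto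

lemma wf_induced: "wf_graph G \<Longrightarrow> K \<subseteq> fst G \<Longrightarrow> wf_graph (induced (snd G) K)"
  by (auto simp: wf_graph_def induced_def sym_def intro: finite_subset)

lemma simple_induced: "simple_graph G \<Longrightarrow> K \<subseteq> fst G \<Longrightarrow> simple_graph (induced (snd G) K)"
  unfolding simple_graph_def by (auto simp: wf_induced) (auto simp: induced_def)

text \<open>\<open>x\<close>, \<open>y\<close>, \<open>z\<close>, \<open>w\<close> are the parts
  common to A and C, A and D, B and C, B and D. Each of the four graphs is split by one instance of
  \<open>cart_factor\<close>, and \<open>coord_image\<close> identifies the part found from C or D
  with the one found from A or B.\<close>

lemma cart_refinement:
  assumes simple: "simple_graph A" "simple_graph B" "simple_graph C" "simple_graph D"
    and conn: "connected_graph A" "connected_graph B" "connected_graph C" "connected_graph D"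
    and iso: "graph_iso (gprod cart_rule A B) (gprod cart_rule C D)"
  shows "\<exists>X Y Z W. (simple_graph X \<and> connected_graph X) \<and> (simple_graph Y \<and> connected_graph Y) \<and>
      (simple_graph Z \<and> connected_graph Z) \<and> (simple_graph W \<and> connected_graph W) \<and>
      graph_iso A (gprod cart_rule X Y) \<and> graph_iso B (gprod cart_rule Z W) \<and>
      graph_iso C (gprod cart_rule X Z) \<and> graph_iso D (gprod cart_rule Y W)"
proof -
  have wf: "wf_graph A" "wf_graph B" "wf_graph C" "wf_graph D"
    using simple by (auto simp: simple_graph_def)
  let ?G = "gprod cart_rule A B"
  obtain \<phi> where \<phi>: "bij_betw \<phi> (fst ?G) (fst (gprod cart_rule C D))"
    and E: "\<And>u v. \<lbrakk>u \<in> fst ?G; v \<in> fst ?G\<rbrakk> \<Longrightarrow> (u, v) \<in> snd ?G \<longleftrightarrow> (\<phi> u, \<phi> v) \<in> snd (gprod cart_rule C D)"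
    using iso by (auto simp: graph_iso_def)
  have ne: "fst A \<noteq> {}" "fst B \<noteq> {}" "fst C \<noteq> {}" "fst D \<noteq> {}"
    using conn by (auto simp: connected_graph_def)
  have dist: "gdist (gprod cart_rule G H) s t = gdist G (fst_of s) (fst_of t) + gdist H (snd_of s) (snd_of t)"
    if "wf_graph G" "wf_graph H" "connected_graph G" "connected_graph H"
      "s \<in> fst (gprod cart_rule G H)" "t \<in> fst (gprod cart_rule G H)" for G H s t
    using that(5,6) by (auto simp: fst_gprod gdist_cart[OF that(1-4)])
  define T where "T = fst ?G"
  define a b c d where "a = fst_of" and "b = snd_of" and "c = (\<lambda>t. fst_of (\<phi> t))" and "d = (\<lambda>t. snd_of (\<phi> t))"
  have dist': "gdist A (a s) (a t) + gdist B (b s) (b t) = gdist C (c s) (c t) + gdist D (d s) (d t)"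
    if "s \<in> T" "t \<in> T" for s t
    using that dist[OF wf(1,2) conn(1,2), of s t] dist[OF wf(3,4) conn(3,4), of "\<phi> s" "\<phi> t"]
      gdist_iso[OF wf_gprod[OF wf(1,2)] wf_gprod[OF wf(3,4)] \<phi> E, of s t] bij_betw_apply[OF \<phi>]
    by (simp add: T_def a_def b_def c_def d_def)
  note tp = two_products_gprod[OF ne \<phi> conn[THEN quasi_metric_gdist] dist'[unfolded T_def a_def b_def c_def d_def],
      folded T_def a_def b_def c_def d_def]
  interpret two_products T a b c d "gdist A" "gdist B" "gdist C" "gdist D"
    by (rule tp(1))
  obtain p where p: "p \<in> T"
    using ne by (auto simp: T_def fst_gprod)
  have F: "(s, t) \<in> snd ?G \<longleftrightarrow> cart_rule (a s = a t) ((a s, a t) \<in> snd A) (b s = b t) ((b s, b t) \<in> snd B)"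
     "(s, t) \<in> snd ?G \<longleftrightarrow> cart_rule (c s = c t) ((c s, c t) \<in> snd C) (d s = d t) ((d s, d t) \<in> snd D)"
     "(s, t) \<in> snd ?G \<longleftrightarrow> cart_rule (b s = b t) ((b s, b t) \<in> snd B) (a s = a t) ((a s, a t) \<in> snd A)"
     "(s, t) \<in> snd ?G \<longleftrightarrow> cart_rule (d s = d t) ((d s, d t) \<in> snd D) (c s = c t) ((c s, c t) \<in> snd C)"
    if "s \<in> T" "t \<in> T" for s t
    using that gprod_edge_of[of s cart_rule A B t] gprod_edge_of[of "\<phi> s" cart_rule C D "\<phi> t"] E[of s t] bij_betw_apply[OF \<phi>]
    by (auto simp add: T_def a_def b_def c_def d_def)
  have irr: "(u, u) \<notin> snd A" "(u, u) \<notin> snd B" "(u, u) \<notin> snd C" "(u, u) \<notin> snd D" for u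
    using simple by (auto simp: simple_graph_def)
  define x y z w where "x = induced (snd ?G) (coord T a b c d p ` T)" and "y = induced (snd ?G) (coord T a b d c p ` T)"
    and "z = induced (snd ?G) (coord T b a c d p ` T)" and "w = induced (snd ?G) (coord T b a d c p ` T)"
  have iA: "graph_iso A (gprod cart_rule x y)"
    unfolding x_def y_def
    by (rule cart_factor[OF tp(1) p, where EB = "\<lambda>u v. (u, v) \<in> snd B" and EC = "\<lambda>u v. (u, v) \<in> snd C" and ED = "\<lambda>u v. (u, v) \<in> snd D"])
      (rule tp(2-)[symmetric] irr F | assumption)+
  have iB: "graph_iso B (gprod cart_rule z w)"
    unfolding z_def w_def
    by (rule cart_factor[OF swap_ab p, where EB = "\<lambda>u v. (u, v) \<in> snd A" and EC = "\<lambda>u v. (u, v) \<in> snd C" and ED = "\<lambda>u v. (u, v) \<in> snd D"])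
      (rule tp(2-)[symmetric] irr F | assumption)+
  have iC: "graph_iso C (gprod cart_rule x z)"
    unfolding x_def z_def coord_image[OF p, symmetric] two_products.coord_image[OF swap_ab p, symmetric]
    by (rule cart_factor[OF swap_pairs p, where EB = "\<lambda>u v. (u, v) \<in> snd D" and EC = "\<lambda>u v. (u, v) \<in> snd A" and ED = "\<lambda>u v. (u, v) \<in> snd B"])
      (rule tp(2-)[symmetric] irr F | assumption)+
  have iD: "graph_iso D (gprod cart_rule y w)"
    unfolding y_def w_def two_products.coord_image[OF swap_cd p, symmetric]
      two_products.coord_image[OF two_products.swap_cd[OF swap_ab] p, symmetric]
    by (rule cart_factor[OF two_products.swap_ab[OF swap_pairs] p, where EB = "\<lambda>u v. (u, v) \<in> snd C" and EC = "\<lambda>u v. (u, v) \<in> snd A" and ED = "\<lambda>u v. (u, v) \<in> snd B"])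
      (rule tp(2-)[symmetric] irr F | assumption)+
  have sG: "simple_graph ?G"
    using simple by (auto simp: simple_graph_def wf_gprod) (auto simp: gprod_def)
  have s: "simple_graph x" "simple_graph y" "simple_graph z" "simple_graph w"
    unfolding x_def y_def z_def w_def using coord_in[OF p] two_products.coord_in[OF swap_cd p]
      two_products.coord_in[OF swap_ab p] two_products.coord_in[OF two_products.swap_cd[OF swap_ab] p]
    by (auto intro!: simple_induced[OF sG] simp: T_def)
  then have w': "wf_graph x" "wf_graph y" "wf_graph z" "wf_graph w"
    by (auto simp: simple_graph_def)
  have "connected_graph x \<and> connected_graph y" "connected_graph z \<and> connected_graph w"
    using connected_graph_iso[OF wf(1) wf_gprod[OF w'(1,2)] iA conn(1)] connected_cart[OF w'(1,2)]
      connected_graph_iso[OF wf(2) wf_gprod[OF w'(3,4)] iB conn(2)] connected_cart[OF w'(3,4)] by auto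
  then show ?thesis
    using s iA iB iC iD by blast
qed


section \<open>Connected nonbipartite graphs\<close>

text \<open>Primitivity of the adjacency matrix in the sense of Perron and Frobenius. Walks of equal
  length in two factors combine, so unlike bare connectedness it passes through direct products in
  both directions.\<close>

definition primitive_graph :: "graph \<Rightarrow> bool" where
  "primitive_graph G \<longleftrightarrow> fst G \<noteq> {} \<and> (\<exists>N. \<forall>n\<ge>N. \<forall>u\<in>fst G. \<forall>v\<in>fst G. (u, v) \<in> snd G ^^ n)"

lemma relpow_sym:
  assumes "wf_graph G"
  shows "(u, v) \<in> snd G ^^ n \<Longrightarrow> (v, u) \<in> snd G ^^ n"
proof (induction n arbitrary: v)
  case (Suc n)
  then obtain w where "(u, w) \<in> snd G ^^ n" "(w, v) \<in> snd G"
    by auto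
  then have "(v, w) \<in> snd G" "(w, u) \<in> snd G ^^ n"
    using Suc.IH wf_graph_sym[OF assms] by auto
  then show ?case
    by (rule relpow_Suc_I2)
qed auto

lemma relpow_join: "\<lbrakk>(u, v) \<in> R ^^ i; (v, w) \<in> R ^^ j\<rbrakk> \<Longrightarrow> (u, w) \<in> R ^^ (i + j)"
  by (auto simp: relpow_add)

lemma bipartite_walk:
  assumes "\<forall>(u, v)\<in>R. u \<in> S \<longleftrightarrow> v \<notin> S"
  shows "(u, v) \<in> R ^^ n \<Longrightarrow> (u \<in> S \<longleftrightarrow> v \<in> S) \<longleftrightarrow> even n"
proof (induction n arbitrary: v)
  case (Suc n)
  then obtain w where "(u, w) \<in> R ^^ n" "(w, v) \<in> R"
    by auto
  then show ?case
    using Suc.IH[of w] assms by auto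
qed auto

text \<open>The vertices reached from \<open>u\<close> by even walks would form a bipartition unless
  some edge joins two vertices of the same side; walks of equal parity to its ends close up with
  this edge to an odd walk.\<close>

lemma odd_closed_walk:
  assumes wf: "wf_graph G" and conn: "connected_graph G" and nb: "\<not> bipartite_graph G" and u: "u \<in> fst G"
  obtains k where "odd k" "(u, u) \<in> snd G ^^ k"
proof -
  let ?S = "{v. \<exists>n. even n \<and> (u, v) \<in> snd G ^^ n}"
  have "\<not> (\<forall>(x, y)\<in>snd G. x \<in> ?S \<longleftrightarrow> y \<notin> ?S)"
    using nb unfolding bipartite_graph_def by blast
  then obtain x y where "(x, y) \<in> snd G" "\<not> (x \<in> ?S \<longleftrightarrow> y \<notin> ?S)"
    by (auto simp del: mem_Collect_eq)
  then have xy: "(x, y) \<in> snd G" "x \<in> ?S \<longleftrightarrow> y \<in> ?S"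
    by blast+
  have "x \<in> fst G" "y \<in> fst G"
    using wf_graph_edge[OF wf xy(1)] by auto
  then obtain m n where mn: "(u, x) \<in> snd G ^^ m" "(u, y) \<in> snd G ^^ n"
    using conn u unfolding connected_graph_relpow by blast
  have "\<exists>i j. (u, x) \<in> snd G ^^ i \<and> (u, y) \<in> snd G ^^ j \<and> even (i + j)"
  proof (cases "x \<in> ?S")
    case True
    then obtain i j where "even i" "(u, x) \<in> snd G ^^ i" "even j" "(u, y) \<in> snd G ^^ j"
      using xy by blast
    then show ?thesis
      by (intro exI[of _ i] exI[of _ j]) simp
  next
    case False
    then have "odd m" "odd n"
      using xy mn by blast+
    then show ?thesis
      using mn by (intro exI[of _ m] exI[of _ n]) simp
  qed
  then obtain i j where ij: "(u, x) \<in> snd G ^^ i" "(u, y) \<in> snd G ^^ j" "even (i + j)"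
    by blast
  have "(u, y) \<in> snd G ^^ Suc i"
    using ij(1) xy(1) by auto
  then have "(u, u) \<in> snd G ^^ (Suc i + j)"
    using relpow_sym[OF wf ij(2)] by (rule relpow_join)
  then show ?thesis
    by (rule that[rotated]) (use ij(3) in simp)
qed

text \<open>For the converse, an odd closed walk at \<open>u\<close>, prolonged by steps back and
  forth along one edge, gives closed walks at \<open>u\<close> of every length from \<open>k\<close>
  on; arbitrary pairs are joined by a detour over \<open>u\<close>.\<close>

lemma primitive_graph_iff:
  assumes wf: "wf_graph G"
  shows "primitive_graph G \<longleftrightarrow> connected_graph G \<and> \<not> bipartite_graph G"
proof
  assume "primitive_graph G"
  then obtain N where ne: "fst G \<noteq> {}"
    and N: "\<And>n u v. \<lbrakk>N \<le> n; u \<in> fst G; v \<in> fst G\<rbrakk> \<Longrightarrow> (u, v) \<in> snd G ^^ n"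
    unfolding primitive_graph_def by blast
  have "connected_graph G"
    unfolding connected_graph_relpow using ne N[of N] by blast
  moreover have "\<not> bipartite_graph G"
  proof
    assume "bipartite_graph G"
    then obtain S where S: "\<forall>(u, v)\<in>snd G. u \<in> S \<longleftrightarrow> v \<notin> S"
      unfolding bipartite_graph_def by blast
    obtain u where "u \<in> fst G"
      using ne by blast
    then have "even N" "even (Suc N)"
      using bipartite_walk[OF S N[of N u u]] bipartite_walk[OF S N[of "Suc N" u u]] by auto
    then show False
      by simp
  qed
  ultimately show "connected_graph G \<and> \<not> bipartite_graph G" ..
next
  assume *: "connected_graph G \<and> \<not> bipartite_graph G"
  then obtain u where u: "u \<in> fst G"
    unfolding connected_graph_def by blast
  obtain k where k: "odd k" "(u, u) \<in> snd G ^^ k"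
    using odd_closed_walk[OF wf] * u by blast
  then obtain k' where k': "k = Suc k'"
    using odd_pos not0_implies_Suc by blast
  then obtain z where "(u, z) \<in> snd G"
    using k(2) relpow_Suc_D2 by metis
  then have "(u, u) \<in> snd G ^^ 2"
    using wf_graph_sym[OF wf] by (auto simp: numeral_2_eq_2)
  then have "(u, u) \<in> snd G ^^ (2 + 2 * i)" if "(u, u) \<in> snd G ^^ (2 * i)" for i
    using that by (rule relpow_join)
  then have even: "(u, u) \<in> snd G ^^ (2 * i)" for i
  proof (induction i)
    case (Suc i)
    then have "(u, u) \<in> snd G ^^ (2 + 2 * i)"
      by blast
    then show ?case
      by (metis add.commute mult_Suc_right)
  qed simp
  have closed: "(u, u) \<in> snd G ^^ n" if "k \<le> n" for n
  proof (cases "even n")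
    case True
    then obtain i where "n = 2 * i"
      by (rule evenE)
    then show ?thesis
      using even by blast
  next
    case False
    then have "even (n - k)"
      using k(1) that by simp
    then obtain i where "n - k = 2 * i"
      by (rule evenE)
    then have i: "n = k + 2 * i"
      using that by simp
    show ?thesis
      unfolding i by (rule relpow_join[OF k(2) even])
  qed
  have "\<forall>v\<in>fst G. \<exists>n. (u, v) \<in> snd G ^^ n"
    using * u unfolding connected_graph_relpow by blast
  then obtain l where l: "\<And>v. v \<in> fst G \<Longrightarrow> (u, v) \<in> snd G ^^ l v"
    by metis
  define M where "M = Max (l ` fst G)"
  have M: "l v \<le> M" if "v \<in> fst G" for v
    using that wf by (simp add: M_def wf_graph_def)
  \<comment> \<open>Getting from \<open>v\<close> to \<open>u\<close> and from \<open>u\<close> to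
    \<open>w\<close> costs at most \<open>M\<close> each, so at least \<open>k\<close> steps remain
    for the closed walk.\<close>
  have "(v, w) \<in> snd G ^^ n" if "k + 2 * M \<le> n" "v \<in> fst G" "w \<in> fst G" for v w n
  proof -
    have "(u, u) \<in> snd G ^^ (n - l v - l w)"
      using M[OF that(2)] M[OF that(3)] that(1) by (intro closed) simp
    then have "(v, w) \<in> snd G ^^ (l v + (n - l v - l w) + l w)"
      using relpow_sym[OF wf l[OF that(2)]] l[OF that(3)] by (blast intro: relpow_join)
    moreover have "l v + (n - l v - l w) + l w = n"
      using M[OF that(2)] M[OF that(3)] that(1) by simp
    ultimately show ?thesis
      by simp
  qed
  then show "primitive_graph G"
    using u unfolding primitive_graph_def by blast
qed

section \<open>Walks and primitivity in direct products\<close>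

abbreviation direct_rule :: "bool \<Rightarrow> bool \<Rightarrow> bool \<Rightarrow> bool \<Rightarrow> bool" where
  "direct_rule e p f q \<equiv> p \<and> q"

lemma relpow_direct:
  assumes wf: "wf_graph G" "wf_graph H" and u: "u \<in> fst G" and v: "v \<in> fst H"
  shows "u' \<in> fst G \<Longrightarrow> v' \<in> fst H \<Longrightarrow>
    (prod_encode (u, v), prod_encode (u', v')) \<in> snd (gprod direct_rule G H) ^^ n \<longleftrightarrow>
      (u, u') \<in> snd G ^^ n \<and> (v, v') \<in> snd H ^^ n"
proof (induction n arbitrary: u' v')
  case 0
  then show ?case by auto
next
  case (Suc n)
  let ?R = "snd (gprod direct_rule G H)"
  have edge: "(w, prod_encode (u', v')) \<in> ?R \<longleftrightarrow>
      (\<exists>u''\<in>fst G. \<exists>v''\<in>fst H. w = prod_encode (u'', v'') \<and> (u'', u') \<in> snd G \<and> (v'', v') \<in> snd H)" for w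
    using Suc.prems by (auto simp: gprod_def)
  have "(prod_encode (u, v), prod_encode (u', v')) \<in> ?R ^^ Suc n \<longleftrightarrow>
      (\<exists>u''\<in>fst G. \<exists>v''\<in>fst H. (prod_encode (u, v), prod_encode (u'', v'')) \<in> ?R ^^ n
        \<and> (u'', u') \<in> snd G \<and> (v'', v') \<in> snd H)"
    unfolding relpow.simps relcomp_unfold using edge by auto
  also have "\<dots> \<longleftrightarrow> (\<exists>u''. (u, u'') \<in> snd G ^^ n \<and> (u'', u') \<in> snd G) \<and> (\<exists>v''. (v, v'') \<in> snd H ^^ n \<and> (v'', v') \<in> snd H)"
    using Suc.IH wf_graph_edge[OF wf(1)] wf_graph_edge[OF wf(2)] by blast
  finally show ?case
    by (simp add: relcomp_unfold)
qed

lemma primitive_direct: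
  assumes "wf_graph G" "wf_graph H"
  shows "primitive_graph (gprod direct_rule G H) \<longleftrightarrow> primitive_graph G \<and> primitive_graph H"
proof
  assume L: "primitive_graph (gprod direct_rule G H)"
  then have ne: "fst G \<noteq> {}" "fst H \<noteq> {}"
    by (auto simp: primitive_graph_def fst_gprod)
  obtain N where N: "\<forall>n\<ge>N. \<forall>u\<in>fst (gprod direct_rule G H). \<forall>v\<in>fst (gprod direct_rule G H).
      (u, v) \<in> snd (gprod direct_rule G H) ^^ n"
    using L unfolding primitive_graph_def by blast
  have "(u, u') \<in> snd G ^^ n \<and> (v, v') \<in> snd H ^^ n"
    if "N \<le> n" "u \<in> fst G" "v \<in> fst H" "u' \<in> fst G" "v' \<in> fst H" for n u v u' v'
    using N that relpow_direct[OF assms that(2-5), of n] by (auto simp: fst_gprod)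
  then show "primitive_graph G \<and> primitive_graph H"
    using ne unfolding primitive_graph_def by (meson all_not_in_conv)
next
  assume "primitive_graph G \<and> primitive_graph H"
  then obtain M N where "fst G \<noteq> {}" "fst H \<noteq> {}"
    and M: "\<forall>n\<ge>M. \<forall>u\<in>fst G. \<forall>v\<in>fst G. (u, v) \<in> snd G ^^ n"
    and N: "\<forall>n\<ge>N. \<forall>u\<in>fst H. \<forall>v\<in>fst H. (u, v) \<in> snd H ^^ n"
    unfolding primitive_graph_def by blast
  then show "primitive_graph (gprod direct_rule G H)"
    unfolding primitive_graph_def fst_gprod
    by (intro conjI exI[of _ "max M N"]) (auto simp: relpow_direct[OF assms])
qed

lemma primitive_graph_iso:
  assumes "wf_graph G" "wf_graph H" "graph_iso G H" "primitive_graph G"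
  shows "primitive_graph H"
proof -
  obtain f where f: "bij_betw f (fst G) (fst H)"
    "\<And>u v. \<lbrakk>u \<in> fst G; v \<in> fst G\<rbrakk> \<Longrightarrow> (u, v) \<in> snd G \<longleftrightarrow> (f u, f v) \<in> snd H"
    using assms by (auto simp: graph_iso_def)
  have im: "fst H = f ` fst G"
    using f(1) by (simp add: bij_betw_def)
  show ?thesis
    using assms(4) relpow_iso[OF assms(1,2) f] unfolding primitive_graph_def im by auto
qed

text \<open>The first edge of a closed walk of positive length is a witness. That no vertex is
  isolated is what thinness of direct products rests on.\<close>

lemma primitive_neighbour:
  assumes "primitive_graph G" "wf_graph G" "u \<in> fst G"
  obtains z where "z \<in> fst G" "(u, z) \<in> snd G"
proof -
  obtain N where "\<forall>n\<ge>N. \<forall>u\<in>fst G. \<forall>v\<in>fst G. (u, v) \<in> snd G ^^ n"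
    using assms unfolding primitive_graph_def by blast
  then have "(u, u) \<in> snd G ^^ Suc N"
    using assms le_Suc_eq by blast
  then show ?thesis
    using that wf_graph_edge[OF assms(2)] relpow_Suc_D2 by metis
qed

section \<open>A metric on thin graphs from walk counts\<close>

text \<open>Entries of the powers of the adjacency matrix, taken as reals for use under
  \<open>ln\<close>.\<close>

primrec walks :: "graph \<Rightarrow> nat \<Rightarrow> nat \<Rightarrow> nat \<Rightarrow> real" where
  "walks G 0 u v = of_bool (u = v)"
| "walks G (Suc n) u v = (\<Sum>z\<in>fst G. of_bool ((u, z) \<in> snd G) * walks G n z v)"

lemma walks_nonneg: "0 \<le> walks G n u v"
  by (induction n arbitrary: u) (auto intro!: sum_nonneg)

lemma walks_pos:
  assumes "wf_graph G"
  shows "(u, v) \<in> snd G ^^ n \<Longrightarrow> 0 < walks G n u v"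
proof (induction n arbitrary: u)
  case (Suc n)
  then obtain z where z: "(u, z) \<in> snd G" "(z, v) \<in> snd G ^^ n"
    using relpow_Suc_D2 by metis
  have "0 < of_bool ((u, z) \<in> snd G) * walks G n z v"
    using z Suc.IH by simp
  also have "\<dots> \<le> walks G (Suc n) u v"
    unfolding walks.simps using assms wf_graph_edge[OF assms z(1)]
    by (intro member_le_sum) (auto simp: wf_graph_def walks_nonneg)
  finally show ?case .
qed auto

lemma walks_add:
  assumes "wf_graph G" "u \<in> fst G"
  shows "walks G (m + n) u v = (\<Sum>z\<in>fst G. walks G m u z * walks G n z v)"
  using assms(2)
proof (induction m arbitrary: u)
  case 0
  have "(\<Sum>z\<in>fst G. of_bool (u = z) * walks G n z v) = (\<Sum>z\<in>fst G. if u = z then walks G n z v else 0)"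
    by (intro sum.cong) auto
  then show ?case
    using assms(1) 0 by (simp add: wf_graph_def)
next
  case (Suc m)
  have "walks G (Suc m + n) u v =
      (\<Sum>y\<in>fst G. of_bool ((u, y) \<in> snd G) * (\<Sum>z\<in>fst G. walks G m y z * walks G n z v))"
    using Suc.IH by simp
  also have "\<dots> = (\<Sum>y\<in>fst G. \<Sum>z\<in>fst G. of_bool ((u, y) \<in> snd G) * walks G m y z * walks G n z v)"
    by (simp add: sum_distrib_left mult.assoc)
  also have "\<dots> = (\<Sum>z\<in>fst G. \<Sum>y\<in>fst G. of_bool ((u, y) \<in> snd G) * walks G m y z * walks G n z v)"
    by (rule sum.swap)
  also have "\<dots> = (\<Sum>z\<in>fst G. walks G (Suc m) u z * walks G n z v)"
    by (simp add: sum_distrib_right)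
  finally show ?case .
qed

lemma walks_1: "wf_graph G \<Longrightarrow> v \<in> fst G \<Longrightarrow> walks G 1 u v = of_bool ((u, v) \<in> snd G)"
proof -
  assume "wf_graph G" "v \<in> fst G"
  moreover have "(\<Sum>z\<in>fst G. of_bool ((u, z) \<in> snd G) * of_bool (z = v)) =
      (\<Sum>z\<in>fst G. if z = v then of_bool ((u, z) \<in> snd G) else (0::real))"
    by (intro sum.cong) auto
  ultimately show ?thesis
    by (simp add: wf_graph_def)
qed

lemma walks_sym:
  assumes "wf_graph G"
  shows "u \<in> fst G \<Longrightarrow> v \<in> fst G \<Longrightarrow> walks G n u v = walks G n v u"
proof (induction n arbitrary: u)
  case (Suc n)
  have "walks G (Suc n) u v = (\<Sum>z\<in>fst G. walks G n v z * walks G 1 z u)"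
    using Suc wf_graph_sym[OF assms, of u] by (auto simp: walks_1[OF assms] mult.commute simp del: One_nat_def intro!: sum.cong)
  also have "\<dots> = walks G (n + 1) v u"
    using walks_add[OF assms Suc.prems(2), of n 1 u] by simp
  finally show ?case
    by simp
qed auto

text \<open>The adjacency matrix of the direct product is the Kronecker product of those of the
  factors, and so are its powers.\<close>

lemma walks_direct:
  assumes wf: "wf_graph G" "wf_graph H" and "u \<in> fst G" "v \<in> fst H"
  shows "walks (gprod direct_rule G H) n (prod_encode (u, v)) (prod_encode (u', v')) = walks G n u u' * walks H n v v'"
  using assms(3,4)
proof (induction n arbitrary: u v)
  case (Suc n)
  have "walks (gprod direct_rule G H) (Suc n) (prod_encode (u, v)) (prod_encode (u', v')) =
     (\<Sum>z\<in>fst G \<times> fst H. of_bool ((prod_encode (u, v), prod_encode z) \<in> snd (gprod direct_rule G H)) *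
         walks (gprod direct_rule G H) n (prod_encode z) (prod_encode (u', v')))"
    by (simp add: fst_gprod sum.reindex inj_prod_encode)
  also have "\<dots> = (\<Sum>(x, y)\<in>fst G \<times> fst H. (of_bool ((u, x) \<in> snd G) * walks G n x u') *
      (of_bool ((v, y) \<in> snd H) * walks H n y v'))"
    using Suc by (intro sum.cong) (auto simp: gprod_edge)
  also have "\<dots> = walks G (Suc n) u u' * walks H (Suc n) v v'"
    by (simp add: sum_product sum.cartesian_product)
  finally show ?case .
qed auto

lemma walks_iso:
  assumes f: "bij_betw f (fst G) (fst H)"
    and E: "\<And>u v. \<lbrakk>u \<in> fst G; v \<in> fst G\<rbrakk> \<Longrightarrow> (u, v) \<in> snd G \<longleftrightarrow> (f u, f v) \<in> snd H"
    and "u \<in> fst G" "v \<in> fst G"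
  shows "walks G n u v = walks H n (f u) (f v)"
  using assms(3)
proof (induction n arbitrary: u)
  case 0
  then show ?case
    using f assms(4) by (auto simp: bij_betw_def inj_on_def)
next
  case (Suc n)
  have "walks H (Suc n) (f u) (f v) = (\<Sum>z\<in>fst G. of_bool ((f u, f z) \<in> snd H) * walks H n (f z) (f v))"
    by (simp add: sum.reindex_bij_betw[OF f, symmetric])
  then show ?case
    using Suc E by simp
qed

section \<open>Thin graphs and the logarithmic distance of rows\<close>

definition thin_graph :: "graph \<Rightarrow> bool" where
  "thin_graph G \<longleftrightarrow> (\<forall>u\<in>fst G. \<forall>v\<in>fst G. (\<forall>z\<in>fst G. (u, z) \<in> snd G \<longleftrightarrow> (v, z) \<in> snd G) \<longrightarrow> u = v)"

text \<open>The adjacency matrix \<open>M\<close> is symmetric, so \<open>M\<^sup>k v = 0\<close> implies \<open>\<bar>M\<^sup>k\<^sup>-\<^sup>1 v\<bar>\<^sup>2 = \<langle>M\<^sup>k\<^sup>-\<^sup>2 v, M\<^sup>k v\<rangle> = 0\<close>;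
  here \<open>v\<close> is the difference of the unit vector of \<open>x\<close> and \<open>\<mu>\<close> times that of \<open>y\<close>.\<close>
lemma walks_proportional:
  assumes wf: "wf_graph G" and xy: "x \<in> fst G" "y \<in> fst G"
  shows "\<forall>z\<in>fst G. walks G (Suc n) x z = \<mu> * walks G (Suc n) y z \<Longrightarrow>
    \<forall>z\<in>fst G. walks G 1 x z = \<mu> * walks G 1 y z"
proof (induction n)
  case (Suc n)
  define V where "V k z = walks G k x z - \<mu> * walks G k y z" for k z
  have inner: "(\<Sum>z\<in>fst G. V i z * V j z) =
      walks G (i + j) x x - \<mu> * walks G (i + j) x y - \<mu> * walks G (i + j) y x + \<mu>\<^sup>2 * walks G (i + j) y y" for i j
  proof -
    have "(\<Sum>z\<in>fst G. V i z * V j z) =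
       (\<Sum>z\<in>fst G. walks G i x z * walks G j z x - \<mu> * (walks G i x z * walks G j z y)
           - \<mu> * (walks G i y z * walks G j z x) + \<mu>\<^sup>2 * (walks G i y z * walks G j z y))"
      using walks_sym[OF wf xy(1), of _ j] walks_sym[OF wf xy(2), of _ j]
      by (intro sum.cong) (auto simp: V_def algebra_simps power2_eq_square)
    then show ?thesis
      by (simp add: sum.distrib sum_subtractf walks_add[OF wf] xy sum_distrib_left)
  qed
  \<comment> \<open>The right-hand side of \<open>inner\<close> depends on i + j only, so one step
    may be moved from one argument to the other.\<close>
  have "(\<Sum>z\<in>fst G. V (Suc n) z * V (Suc n) z) = (\<Sum>z\<in>fst G. V n z * V (Suc (Suc n)) z)"
    unfolding inner by simp
  also have "\<dots> = 0"
    using Suc.prems by (intro sum.neutral) (simp add: V_def del: walks.simps)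
  finally have "\<forall>z\<in>fst G. V (Suc n) z * V (Suc n) z = 0"
    using wf by (subst (asm) sum_nonneg_eq_0_iff) (auto simp: wf_graph_def)
  then show ?case
    by (intro Suc.IH) (auto simp: V_def simp del: walks.simps)
qed (simp del: walks.simps)

text \<open>The Funk distance between rows u and v of a matrix power; its symmetrization is the
  Hilbert projective metric.\<close>

definition walk_dist :: "nat \<Rightarrow> graph \<Rightarrow> nat \<Rightarrow> nat \<Rightarrow> real" where
  "walk_dist n G u v = Max ((\<lambda>z. ln (walks G n u z) - ln (walks G n v z)) ` fst G)"

lemma walk_dist_ge:
  "\<lbrakk>wf_graph G; z \<in> fst G\<rbrakk> \<Longrightarrow> ln (walks G n u z) - ln (walks G n v z) \<le> walk_dist n G u v"
  by (simp add: walk_dist_def wf_graph_def)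

lemma walk_dist_attained:
  assumes "wf_graph G" "fst G \<noteq> {}"
  obtains z where "z \<in> fst G" "walk_dist n G u v = ln (walks G n u z) - ln (walks G n v z)"
proof -
  have "walk_dist n G u v \<in> (\<lambda>z. ln (walks G n u z) - ln (walks G n v z)) ` fst G"
    unfolding walk_dist_def using assms by (intro Max_in) (auto simp: wf_graph_def)
  then show ?thesis
    using that by blast
qed

text \<open>If both directions sum to at most zero, all logarithmic ratios equal one constant and
  the two rows are proportional. \<open>walks_proportional\<close> carries this down to the
  adjacency matrix, where a nonzero factor means equal neighbourhoods.\<close>

lemma quasi_metric_walk_dist:
  assumes wf: "wf_graph G" and thin: "thin_graph G" and ne: "fst G \<noteq> {}" and n: "0 < n"
    and pos: "\<And>u v. \<lbrakk>u \<in> fst G; v \<in> fst G\<rbrakk> \<Longrightarrow> 0 < walks G n u v"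
  shows "quasi_metric (fst G) (walk_dist n G)"
  unfolding quasi_metric_def
proof (intro conjI ballI impI)
  show "walk_dist n G u u = 0" for u
    using walk_dist_attained[OF wf ne] by (metis diff_self)
  show "walk_dist n G u w \<le> walk_dist n G u v + walk_dist n G v w" for u v w
  proof -
    obtain z where "z \<in> fst G" "walk_dist n G u w = ln (walks G n u z) - ln (walks G n w z)"
      by (rule walk_dist_attained[OF wf ne])
    then show ?thesis
      using walk_dist_ge[OF wf, of z n u v] walk_dist_ge[OF wf, of z n v w] by simp
  qed
  fix u v assume u: "u \<in> fst G" and v: "v \<in> fst G" and le: "walk_dist n G u v + walk_dist n G v u \<le> 0"
  define l where "l = walk_dist n G u v"
  have "ln (walks G n u z) - ln (walks G n v z) = l" if "z \<in> fst G" for z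
    using le walk_dist_ge[OF wf that, of n u v] walk_dist_ge[OF wf that, of n v u] by (simp add: l_def)
  then have eq: "walks G n u z = exp l * walks G n v z" if "z \<in> fst G" for z
    using that pos[OF u that] pos[OF v that] by (metis diff_add_cancel exp_add exp_ln)
  obtain m where "n = Suc m"
    using n by (auto simp: gr0_conv_Suc)
  then have "walks G 1 u z = exp l * walks G 1 v z" if "z \<in> fst G" for z
    using walks_proportional[OF wf u v, of m "exp l"] eq that by blast
  then have "(u, z) \<in> snd G \<longleftrightarrow> (v, z) \<in> snd G" if "z \<in> fst G" for z
    using that by (auto simp: walks_1[OF wf] simp del: One_nat_def split: if_splits)
      (metis exp_not_eq_zero mult_eq_0_iff of_bool_eq(1,2) zero_neq_one)+
  then show "u = v"
    using thin u v unfolding thin_graph_def by blast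
qed

lemma Max_plus_Times:
  fixes f g :: "'a \<Rightarrow> real"
  assumes "finite X" "X \<noteq> {}" "finite Y" "Y \<noteq> {}"
  shows "Max ((\<lambda>(x, y). f x + g y) ` (X \<times> Y)) = Max (f ` X) + Max (g ` Y)"
proof (rule Max_eqI)
  have "Max (f ` X) \<in> f ` X" "Max (g ` Y) \<in> g ` Y"
    using assms by (auto intro: Max_in)
  then show "Max (f ` X) + Max (g ` Y) \<in> (\<lambda>(x, y). f x + g y) ` (X \<times> Y)"
    by force
qed (use assms in \<open>auto intro!: add_mono\<close>)

text \<open>The logarithm turns the product of counts into a term in x plus a term in y, and the
  maximum of such a sum over a product set splits.\<close>

lemma walk_dist_direct:
  assumes wf: "wf_graph G" "wf_graph H"
    and pos: "\<And>u v. \<lbrakk>u \<in> fst G; v \<in> fst G\<rbrakk> \<Longrightarrow> 0 < walks G n u v" "\<And>u v. \<lbrakk>u \<in> fst H; v \<in> fst H\<rbrakk> \<Longrightarrow> 0 < walks H n u v"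
    and uv: "u \<in> fst G" "u' \<in> fst G" "v \<in> fst H" "v' \<in> fst H"
  shows "walk_dist n (gprod direct_rule G H) (prod_encode (u, v)) (prod_encode (u', v')) =
    walk_dist n G u u' + walk_dist n H v v'"
proof -
  have "(\<lambda>z. ln (walks (gprod direct_rule G H) n (prod_encode (u, v)) z) -
       ln (walks (gprod direct_rule G H) n (prod_encode (u', v')) z)) ` fst (gprod direct_rule G H) =
     (\<lambda>(x, y). (ln (walks G n u x) - ln (walks G n u' x)) + (ln (walks H n v y) - ln (walks H n v' y))) ` (fst G \<times> fst H)"
    unfolding fst_gprod image_image
  proof (rule image_cong[OF refl], clarify)
    fix x y assume xy: "x \<in> fst G" "y \<in> fst H"
    show "ln (walks (gprod direct_rule G H) n (prod_encode (u, v)) (prod_encode (x, y))) -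
       ln (walks (gprod direct_rule G H) n (prod_encode (u', v')) (prod_encode (x, y))) =
       (ln (walks G n u x) - ln (walks G n u' x)) + (ln (walks H n v y) - ln (walks H n v' y))"
      using pos(1)[OF uv(1) xy(1)] pos(1)[OF uv(2) xy(1)] pos(2)[OF uv(3) xy(2)] pos(2)[OF uv(4) xy(2)]
      by (simp add: walks_direct[OF wf] uv ln_mult)
  qed
  then show ?thesis
    unfolding walk_dist_def using wf uv by (subst Max_plus_Times[symmetric]) (auto simp: wf_graph_def)
qed

lemma walk_dist_iso:
  assumes f: "bij_betw f (fst G) (fst H)"
    and E: "\<And>u v. \<lbrakk>u \<in> fst G; v \<in> fst G\<rbrakk> \<Longrightarrow> (u, v) \<in> snd G \<longleftrightarrow> (f u, f v) \<in> snd H"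
    and "u \<in> fst G" "v \<in> fst G"
  shows "walk_dist n G u v = walk_dist n H (f u) (f v)"
proof -
  have "fst H = f ` fst G"
    using f by (simp add: bij_betw_def)
  then show ?thesis
    using assms(3,4) unfolding walk_dist_def by (simp add: image_image walks_iso[OF f E, symmetric])
qed


section \<open>Graphs as blow-ups of weighted thin graphs\<close>

text \<open>Every vertex t of \<open>H\<close> is replaced by \<open>w t\<close> copies that are
  twins of each other. It is a relation, since a thin \<open>H\<close> is determined by
  \<open>G\<close> only up to weighted isomorphism.\<close>

definition blowup :: "graph \<Rightarrow> graph \<Rightarrow> (nat \<Rightarrow> nat) \<Rightarrow> bool" where
  "blowup G H w \<longleftrightarrow> (\<exists>p. (\<forall>u\<in>fst G. p u \<in> fst H) \<and>
      (\<forall>u\<in>fst G. \<forall>v\<in>fst G. (u, v) \<in> snd G \<longleftrightarrow> (p u, p v) \<in> snd H) \<and>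
      (\<forall>t\<in>fst H. card {u \<in> fst G. p u = t} = w t))"

definition weighted_iso :: "graph \<Rightarrow> (nat \<Rightarrow> nat) \<Rightarrow> graph \<Rightarrow> (nat \<Rightarrow> nat) \<Rightarrow> bool" where
  "weighted_iso G w H w' \<longleftrightarrow> (\<exists>f. bij_betw f (fst G) (fst H) \<and>
      (\<forall>u\<in>fst G. \<forall>v\<in>fst G. (u, v) \<in> snd G \<longleftrightarrow> (f u, f v) \<in> snd H) \<and> (\<forall>u\<in>fst G. w' (f u) = w u))"

definition wprod :: "(nat \<Rightarrow> nat) \<Rightarrow> (nat \<Rightarrow> nat) \<Rightarrow> nat \<Rightarrow> nat" where
  "wprod w w' n = w (fst_of n) * w' (snd_of n)"

text \<open>Fibres over the same vertex have equal size; any bijections between them glue to an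
  isomorphism because adjacency is decided in \<open>H\<close>.\<close>

lemma blowup_unique:
  assumes wf: "wf_graph G" "wf_graph G'" and "blowup G H w" "blowup G' H w"
  shows "graph_iso G G'"
proof -
  obtain p where p: "\<And>u. u \<in> fst G \<Longrightarrow> p u \<in> fst H"
      "\<And>u v. \<lbrakk>u \<in> fst G; v \<in> fst G\<rbrakk> \<Longrightarrow> (u, v) \<in> snd G \<longleftrightarrow> (p u, p v) \<in> snd H"
      "\<And>t. t \<in> fst H \<Longrightarrow> card {u \<in> fst G. p u = t} = w t"
    using assms(3) unfolding blowup_def by blast
  obtain q where q: "\<And>u. u \<in> fst G' \<Longrightarrow> q u \<in> fst H"
      "\<And>u v. \<lbrakk>u \<in> fst G'; v \<in> fst G'\<rbrakk> \<Longrightarrow> (u, v) \<in> snd G' \<longleftrightarrow> (q u, q v) \<in> snd H"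
      "\<And>t. t \<in> fst H \<Longrightarrow> card {u \<in> fst G'. q u = t} = w t"
    using assms(4) unfolding blowup_def by blast
  have "\<exists>h. bij_betw h {u \<in> fst G. p u = t} {u \<in> fst G'. q u = t}" if "t \<in> fst H" for t
    using wf p(3)[OF that] q(3)[OF that] by (intro finite_same_card_bij) (auto simp: wf_graph_def)
  then have "\<forall>t\<in>fst H. \<exists>h. bij_betw h {u \<in> fst G. p u = t} {u \<in> fst G'. q u = t}"
    by blast
  from bchoice[OF this] obtain h
    where h: "\<And>t. t \<in> fst H \<Longrightarrow> bij_betw (h t) {u \<in> fst G. p u = t} {u \<in> fst G'. q u = t}"
    by blast
  define f where "f u = h (p u) u" for u
  have f: "f u \<in> fst G'" "q (f u) = p u" if "u \<in> fst G" for u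
    using bij_betw_apply[OF h[OF p(1)[OF that]], of u] that by (auto simp: f_def)
  show ?thesis
  proof (rule graph_isoI[of f])
    show "bij_betw f (fst G) (fst G')"
    proof (rule bij_betw_imageI)
      show "inj_on f (fst G)"
      proof (rule inj_onI)
        fix u v assume uv: "u \<in> fst G" "v \<in> fst G" "f u = f v"
        then have "p u = p v"
          using f(2) by metis
        then show "u = v"
          using h[OF p(1)[OF uv(1)]] uv by (auto simp: bij_betw_def inj_on_def f_def)
      qed
      show "f ` fst G = fst G'"
      proof
        show "fst G' \<subseteq> f ` fst G"
        proof
          fix v assume v: "v \<in> fst G'"
          then have "v \<in> h (q v) ` {u \<in> fst G. p u = q v}"
            using h[OF q(1)[OF v]] by (auto simp: bij_betw_def)
          then obtain u where "u \<in> fst G" "p u = q v" "v = h (q v) u"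
            by blast
          then show "v \<in> f ` fst G"
            by (intro image_eqI[of _ _ u]) (simp_all add: f_def)
        qed
      qed (use f in auto)
    qed
  qed (use f p(2) q(2) in auto)
qed

lemma blowup_weighted_iso:
  assumes "blowup G H w" "weighted_iso H w H' w'"
  shows "blowup G H' w'"
proof -
  obtain p where p: "\<And>u. u \<in> fst G \<Longrightarrow> p u \<in> fst H"
      "\<And>u v. \<lbrakk>u \<in> fst G; v \<in> fst G\<rbrakk> \<Longrightarrow> (u, v) \<in> snd G \<longleftrightarrow> (p u, p v) \<in> snd H"
      "\<And>t. t \<in> fst H \<Longrightarrow> card {u \<in> fst G. p u = t} = w t"
    using assms(1) unfolding blowup_def by blast
  obtain f where f: "bij_betw f (fst H) (fst H')"
      "\<And>u v. \<lbrakk>u \<in> fst H; v \<in> fst H\<rbrakk> \<Longrightarrow> (u, v) \<in> snd H \<longleftrightarrow> (f u, f v) \<in> snd H'"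
      "\<And>u. u \<in> fst H \<Longrightarrow> w' (f u) = w u"
    using assms(2) unfolding weighted_iso_def by blast
  have "card {u \<in> fst G. f (p u) = t'} = w' t'" if "t' \<in> fst H'" for t'
  proof -
    have "t' \<in> f ` fst H"
      using that bij_betw_imp_surj_on[OF f(1)] by simp
    then obtain t where t: "t \<in> fst H" "t' = f t"
      by (rule imageE) simp
    then have "{u \<in> fst G. f (p u) = t'} = {u \<in> fst G. p u = t}"
      using p(1) f(1) by (auto simp: bij_betw_def inj_on_def)
    then show ?thesis
      using p(3) f(3) t by simp
  qed
  then show ?thesis
    unfolding blowup_def using p f bij_betw_apply[OF f(1)] by (intro exI[of _ "\<lambda>u. f (p u)"]) auto
qed

lemma blowup_iso:
  assumes "graph_iso G G'" "blowup G' H w"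
  shows "blowup G H w"
proof -
  obtain p where p: "\<And>u. u \<in> fst G' \<Longrightarrow> p u \<in> fst H"
      "\<And>u v. \<lbrakk>u \<in> fst G'; v \<in> fst G'\<rbrakk> \<Longrightarrow> (u, v) \<in> snd G' \<longleftrightarrow> (p u, p v) \<in> snd H"
      "\<And>t. t \<in> fst H \<Longrightarrow> card {u \<in> fst G'. p u = t} = w t"
    using assms(2) unfolding blowup_def by blast
  obtain f where f: "bij_betw f (fst G) (fst G')"
      "\<And>u v. \<lbrakk>u \<in> fst G; v \<in> fst G\<rbrakk> \<Longrightarrow> (u, v) \<in> snd G \<longleftrightarrow> (f u, f v) \<in> snd G'"
    using assms(1) unfolding graph_iso_def by blast
  have "bij_betw f {u \<in> fst G. p (f u) = t} {u \<in> fst G'. p u = t}" for t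
    using f(1) by (auto simp: bij_betw_def inj_on_def)
  then have "card {u \<in> fst G. p (f u) = t} = card {u \<in> fst G'. p u = t}" for t
    by (rule bij_betw_same_card)
  then show ?thesis
    unfolding blowup_def using p f bij_betw_apply[OF f(1)] by (intro exI[of _ "\<lambda>u. p (f u)"]) auto
qed

lemma blowup_exists:
  assumes wf: "wf_graph H"
  shows "\<exists>G. wf_graph G \<and> blowup G H w"
proof -
  define V where "V = prod_encode ` (SIGMA t:fst H. {..<w t})"
  define G :: graph where "G = (V, {(u, v). u \<in> V \<and> v \<in> V \<and> (fst_of u, fst_of v) \<in> snd H})"
  have "finite V"
    using wf unfolding V_def wf_graph_def by (intro finite_imageI finite_SigmaI) auto
  then have "wf_graph G"
    using wf_graph_sym[OF wf] by (auto simp: wf_graph_def G_def sym_def)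
  moreover have "card {u \<in> V. fst_of u = t} = w t" if "t \<in> fst H" for t
  proof -
    have "{u \<in> V. fst_of u = t} = (\<lambda>i. prod_encode (t, i)) ` {..<w t}"
      using that by (auto simp: V_def)
    then show ?thesis
      by (simp add: card_image inj_on_def)
  qed
  then have "blowup G H w"
    unfolding blowup_def by (intro exI[of _ fst_of]) (auto simp: G_def V_def)
  ultimately show ?thesis
    by blast
qed

lemma blowup_direct:
  assumes "blowup A H w" "blowup B K w'"
  shows "blowup (gprod direct_rule A B) (gprod direct_rule H K) (wprod w w')"
proof -
  obtain p where p: "\<And>u. u \<in> fst A \<Longrightarrow> p u \<in> fst H"
      "\<And>u v. \<lbrakk>u \<in> fst A; v \<in> fst A\<rbrakk> \<Longrightarrow> (u, v) \<in> snd A \<longleftrightarrow> (p u, p v) \<in> snd H"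
      "\<And>t. t \<in> fst H \<Longrightarrow> card {u \<in> fst A. p u = t} = w t"
    using assms(1) unfolding blowup_def by blast
  obtain q where q: "\<And>u. u \<in> fst B \<Longrightarrow> q u \<in> fst K"
      "\<And>u v. \<lbrakk>u \<in> fst B; v \<in> fst B\<rbrakk> \<Longrightarrow> (u, v) \<in> snd B \<longleftrightarrow> (q u, q v) \<in> snd K"
      "\<And>t. t \<in> fst K \<Longrightarrow> card {u \<in> fst B. q u = t} = w' t"
    using assms(2) unfolding blowup_def by blast
  have "card {n \<in> prod_encode ` (fst A \<times> fst B). prod_encode (p (fst_of n), q (snd_of n)) = prod_encode (s, t)} = w s * w' t"
    if "s \<in> fst H" "t \<in> fst K" for s t
  proof -
    have "{n \<in> prod_encode ` (fst A \<times> fst B). prod_encode (p (fst_of n), q (snd_of n)) = prod_encode (s, t)} =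
        prod_encode ` ({u \<in> fst A. p u = s} \<times> {v \<in> fst B. q v = t})"
      by auto
    then show ?thesis
      using p(3)[OF that(1)] q(3)[OF that(2)] by (simp add: card_image inj_prod_encode card_cartesian_product)
  qed
  then show ?thesis
    unfolding blowup_def using p(1,2) q(1,2)
    by (intro exI[of _ "\<lambda>n. prod_encode (p (fst_of n), q (snd_of n))"]) (auto simp: fst_gprod gprod_edge wprod_def)
qed

text \<open>The least label represents each class of vertices with equal neighbourhoods, and the
  thin graph is induced on the representatives.\<close>

lemma thin_blowup_exists:
  assumes wf: "wf_graph G"
  obtains H w where "wf_graph H" "thin_graph H" "blowup G H w" "\<And>t. t \<in> fst H \<Longrightarrow> 0 < w t"
proof -
  define twin where "twin u v \<longleftrightarrow> v \<in> fst G \<and> (\<forall>z. (u, z) \<in> snd G \<longleftrightarrow> (v, z) \<in> snd G)" for u v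
  define p where "p u = (LEAST v. twin u v)" for u
  define w where "w t = card {u \<in> fst G. p u = t}" for t
  define H :: graph where "H = (p ` fst G, snd G \<inter> p ` fst G \<times> p ` fst G)"
  have p: "twin u (p u)" if "u \<in> fst G" for u
    unfolding p_def by (rule LeastI[of _ u]) (use that in \<open>auto simp: twin_def\<close>)
  have p_eq: "p u = p v" if "\<forall>z. (u, z) \<in> snd G \<longleftrightarrow> (v, z) \<in> snd G" for u v
    using that by (simp add: p_def twin_def)
  have E: "(u, v) \<in> snd G \<longleftrightarrow> (p u, p v) \<in> snd G" if "u \<in> fst G" "v \<in> fst G" for u v
    using p[OF that(1)] p[OF that(2)] wf_graph_sym[OF wf] unfolding twin_def by metis
  have sub: "p ` fst G \<subseteq> fst G"
    using p by (auto simp: twin_def)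
  have "wf_graph H"
    using wf sub by (auto simp: wf_graph_def H_def sym_def)
  moreover have "thin_graph H"
    unfolding thin_graph_def
  proof (intro ballI impI)
    fix s t assume st: "s \<in> fst H" "t \<in> fst H" and eq: "\<forall>z\<in>fst H. (s, z) \<in> snd H \<longleftrightarrow> (t, z) \<in> snd H"
    obtain u v where uv: "u \<in> fst G" "v \<in> fst G" "s = p u" "t = p v"
      using st by (auto simp: H_def)
    have "(u, z) \<in> snd G \<longleftrightarrow> (v, z) \<in> snd G" if "z \<in> fst G" for z
      using eq E[OF uv(1) that] E[OF uv(2) that] uv that by (auto simp: H_def)
    then show "s = t"
      unfolding uv using wf_graph_edge[OF wf] by (intro p_eq) blast
  qed
  moreover have "blowup G H w"
    unfolding blowup_def using E by (intro exI[of _ p]) (auto simp: H_def w_def)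
  moreover have "0 < w t" if "t \<in> fst H" for t
    using that wf by (auto simp: w_def H_def wf_graph_def card_gt_0_iff)
  ultimately show ?thesis
    using that by blast
qed

lemma image_eq_of_fibres:
  assumes "\<And>u. u \<in> S \<Longrightarrow> p u \<in> T" "\<And>t. t \<in> T \<Longrightarrow> 0 < card {u \<in> S. p u = t}"
  shows "p ` S = T"
proof
  show "T \<subseteq> p ` S"
  proof
    fix t assume "t \<in> T"
    then have "{u \<in> S. p u = t} \<noteq> {}"
      using assms(2)[of t] by (auto simp: card_gt_0_iff)
    then show "t \<in> p ` S"
      by blast
  qed
qed (use assms in auto)

text \<open>Positive weights make both projections surjective, and over a thin graph two vertices
  have the same image iff they are twins in \<open>G\<close>. The projections therefore have equal
  fibres, and one factors through the other.\<close>

lemma thin_blowup_unique: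
  assumes thin: "thin_graph H" "thin_graph K" and pos: "\<And>t. t \<in> fst H \<Longrightarrow> 0 < w t" "\<And>t. t \<in> fst K \<Longrightarrow> 0 < w' t"
    and "blowup G H w" "blowup G K w'"
  shows "weighted_iso H w K w'"
proof -
  obtain p where p: "\<And>u. u \<in> fst G \<Longrightarrow> p u \<in> fst H"
      "\<And>u v. \<lbrakk>u \<in> fst G; v \<in> fst G\<rbrakk> \<Longrightarrow> (u, v) \<in> snd G \<longleftrightarrow> (p u, p v) \<in> snd H"
      "\<And>t. t \<in> fst H \<Longrightarrow> card {u \<in> fst G. p u = t} = w t"
    using assms(5) unfolding blowup_def by blast
  obtain q where q: "\<And>u. u \<in> fst G \<Longrightarrow> q u \<in> fst K"
      "\<And>u v. \<lbrakk>u \<in> fst G; v \<in> fst G\<rbrakk> \<Longrightarrow> (u, v) \<in> snd G \<longleftrightarrow> (q u, q v) \<in> snd K"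
      "\<And>t. t \<in> fst K \<Longrightarrow> card {u \<in> fst G. q u = t} = w' t"
    using assms(6) unfolding blowup_def by blast
  have surj: "p ` fst G = fst H" "q ` fst G = fst K"
    using pos p(1,3) q(1,3) by (auto intro!: image_eq_of_fibres)
  have twin: "r u = r v \<longleftrightarrow> (\<forall>z\<in>fst G. (u, z) \<in> snd G \<longleftrightarrow> (v, z) \<in> snd G)"
    if "thin_graph L" "r ` fst G = fst L" "u \<in> fst G" "v \<in> fst G"
      "\<And>u v. \<lbrakk>u \<in> fst G; v \<in> fst G\<rbrakk> \<Longrightarrow> (u, v) \<in> snd G \<longleftrightarrow> (r u, r v) \<in> snd L" for r L u v
    using that(1,3,4,5) unfolding thin_graph_def that(2)[symmetric] by auto
  have pq: "p u = p v \<longleftrightarrow> q u = q v" if "u \<in> fst G" "v \<in> fst G" for u v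
    using twin[OF thin(1) surj(1) that p(2)] twin[OF thin(2) surj(2) that q(2)] by simp
  define f where "f t = q (inv_into (fst G) p t)" for t
  have f: "f (p u) = q u" if "u \<in> fst G" for u
    unfolding f_def using that pq[of "inv_into (fst G) p (p u)" u] by (simp add: f_inv_into_f inv_into_into)
  have fibre: "{v \<in> fst G. q v = q u} = {v \<in> fst G. p v = p u}" if "u \<in> fst G" for u
    using pq that by auto
  have "bij_betw f (fst H) (fst K)"
  proof (rule bij_betw_imageI)
    show "inj_on f (fst H)"
      unfolding surj(1)[symmetric] by (auto simp: inj_on_def f pq)
    show "f ` fst H = fst K"
      unfolding surj[symmetric] image_image using f by auto
  qed
  moreover have "\<forall>u\<in>fst H. \<forall>v\<in>fst H. (u, v) \<in> snd H \<longleftrightarrow> (f u, f v) \<in> snd K"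
    unfolding surj(1)[symmetric] using f p(2) q(2) by auto
  moreover have "\<forall>t\<in>fst H. w' (f t) = w t"
  proof
    fix t assume "t \<in> fst H"
    then obtain u where u: "u \<in> fst G" "t = p u"
      unfolding surj(1)[symmetric] by blast
    then show "w' (f t) = w t"
      using p(3)[OF p(1)[OF u(1)]] q(3)[OF q(1)[OF u(1)]] f fibre by simp
  qed
  ultimately show ?thesis
    unfolding weighted_iso_def by blast
qed

lemma primitive_blowup:
  assumes pos: "\<And>t. t \<in> fst H \<Longrightarrow> 0 < w t" and wf: "wf_graph G" and "blowup G H w" and prim: "primitive_graph G"
  shows "primitive_graph H"
proof -
  obtain p where p: "\<And>u. u \<in> fst G \<Longrightarrow> p u \<in> fst H"
      "\<And>u v. \<lbrakk>u \<in> fst G; v \<in> fst G\<rbrakk> \<Longrightarrow> (u, v) \<in> snd G \<longleftrightarrow> (p u, p v) \<in> snd H"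
      "\<And>t. t \<in> fst H \<Longrightarrow> card {u \<in> fst G. p u = t} = w t"
    using assms(3) unfolding blowup_def by blast
  have surj: "fst H = p ` fst G"
    using pos p(1,3) by (intro image_eq_of_fibres[symmetric]) auto
  have "(u, v) \<in> snd G ^^ n \<Longrightarrow> (p u, p v) \<in> snd H ^^ n" for u v n
  proof (induction n arbitrary: v)
    case (Suc n)
    then obtain z where z: "(u, z) \<in> snd G ^^ n" "(z, v) \<in> snd G"
      by auto
    then have "(p z, p v) \<in> snd H"
      using p(2) wf_graph_edge[OF wf] by blast
    then show ?case
      using Suc.IH[OF z(1)] by auto
  qed auto
  then show ?thesis
    using prim unfolding primitive_graph_def surj by blast
qed

text \<open>The neighbourhood of a pair is the product of two nonempty neighbourhoods, and a
  nonempty product determines its factors.\<close>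

lemma thin_direct:
  assumes wf: "wf_graph G" "wf_graph H" and thin: "thin_graph G" "thin_graph H"
    and prim: "primitive_graph G" "primitive_graph H"
  shows "thin_graph (gprod direct_rule G H)"
  unfolding thin_graph_def fst_gprod
proof clarify
  fix u v u' v' assume V: "u \<in> fst G" "v \<in> fst H" "u' \<in> fst G" "v' \<in> fst H"
    and "\<forall>z\<in>prod_encode ` (fst G \<times> fst H). (prod_encode (u, v), z) \<in> snd (gprod direct_rule G H)
      \<longleftrightarrow> (prod_encode (u', v'), z) \<in> snd (gprod direct_rule G H)"
  then have eq: "(u, x) \<in> snd G \<and> (v, y) \<in> snd H \<longleftrightarrow> (u', x) \<in> snd G \<and> (v', y) \<in> snd H"
    if "x \<in> fst G" "y \<in> fst H" for x y
    using that by (auto simp: gprod_edge)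
  obtain x where x: "x \<in> fst G" "(u, x) \<in> snd G"
    by (rule primitive_neighbour[OF prim(1) wf(1) V(1)])
  obtain y where y: "y \<in> fst H" "(v, y) \<in> snd H"
    by (rule primitive_neighbour[OF prim(2) wf(2) V(2)])
  have "(u', x) \<in> snd G" "(v', y) \<in> snd H"
    using eq x y by blast+
  then have "\<forall>z\<in>fst G. (u, z) \<in> snd G \<longleftrightarrow> (u', z) \<in> snd G" "\<forall>z\<in>fst H. (v, z) \<in> snd H \<longleftrightarrow> (v', z) \<in> snd H"
    using eq x y by blast+
  then show "prod_encode (u, v) = prod_encode (u', v')"
    using thin V unfolding thin_graph_def by blast
qed

section \<open>Refinement for the direct product\<close>

lemma Gcd_mult_image:
  fixes f :: "'a \<Rightarrow> nat" and g :: "'b \<Rightarrow> nat"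
  shows "Gcd ((\<lambda>(x, y). f x * g y) ` (X \<times> Y)) = Gcd (f ` X) * Gcd (g ` Y)"
proof (rule dvd_antisym)
  let ?m = "Gcd ((\<lambda>(x, y). f x * g y) ` (X \<times> Y))"
  \<comment> \<open>With x fixed, the gcd over y pulls out the factor \<open>f x\<close>; varying x
    afterwards pulls out the other gcd.\<close>
  have "?m dvd f x * Gcd (g ` Y)" if "x \<in> X" for x
  proof -
    have "?m dvd Gcd ((*) (f x) ` g ` Y)"
      using that by (intro Gcd_greatest) (auto intro!: Gcd_dvd)
    then show ?thesis
      by (simp add: Gcd_mult)
  qed
  then have "?m dvd Gcd ((*) (Gcd (g ` Y)) ` f ` X)"
    by (intro Gcd_greatest) (auto simp: mult.commute)
  then show "?m dvd Gcd (f ` X) * Gcd (g ` Y)"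
    unfolding Gcd_mult by (simp add: mult.commute)
  show "Gcd (f ` X) * Gcd (g ` Y) dvd ?m"
    by (intro Gcd_greatest) (auto intro!: mult_dvd_mono Gcd_dvd)
qed

definition prim_part :: "('a \<Rightarrow> nat) \<Rightarrow> 'a set \<Rightarrow> 'a \<Rightarrow> nat" where
  "prim_part w K t = w t div Gcd (w ` K)"

lemma prim_part_mult: "t \<in> K \<Longrightarrow> Gcd (w ` K) * prim_part w K t = w t"
  by (simp add: prim_part_def)

lemma Gcd_prim_part:
  assumes "t \<in> K" "0 < w t"
  shows "Gcd (prim_part w K ` K) = 1"
proof -
  have "w ` K = (*) (Gcd (w ` K)) ` prim_part w K ` K"
    by (auto simp: image_image prim_part_mult)
  then have "Gcd (w ` K) = Gcd (w ` K) * Gcd (prim_part w K ` K)"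
    by (metis Gcd_mult normalize_nat_def id_apply)
  moreover have "Gcd (w ` K) \<noteq> 0"
    using assms by auto
  ultimately show ?thesis
    by simp
qed

text \<open>Refinement in the multiplicative monoid of naturals, by which the contents are
  distributed over the four factors.\<close>

lemma nat_mult_refine:
  fixes k :: nat
  assumes "k * l = m * n" "0 < k"
  shows "\<exists>x y z w. k = x * y \<and> l = z * w \<and> m = x * z \<and> n = y * w"
proof -
  obtain x y where xy: "k = x * y" "x dvd m" "y dvd n"
    using division_decomp[of k m n] assms(1) by (metis dvd_triv_left)
  then obtain z w where "m = x * z" "n = y * w"
    by (auto elim!: dvdE)
  moreover from this xy assms have "l = z * w"
    by auto
  ultimately show ?thesis
    using xy by blast
qed

text \<open>Along the fibre \<open>b t = b p\<close> the weight has rank one in the two coordinates, hence it is the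
  product of their primitive parts up to its content.\<close>
lemma weight_split:
  fixes T :: "nat set"
  assumes tp: "two_products T a b c d DA DB DC DD" and p: "p \<in> T"
    and w_ab: "\<forall>t\<in>T. w t = wA (a t) * wB (b t)"
    and w_cd: "\<forall>t\<in>T. w t = wC (c t) * wD (d t)"
    and w_pos: "\<forall>t\<in>T. 0 < w t" and t: "t \<in> T"
  shows "wA (a t) = Gcd (wA ` a ` T) * (prim_part w (coord T a b c d p ` T) (coord T a b c d p t) *
    prim_part w (coord T a b d c p ` T) (coord T a b d c p t))"
proof -
  interpret two_products T a b c d DA DB DC DD
    by (rule tp)
  note ab = w_ab[rule_format] and cd = w_cd[rule_format] and pos = w_pos[rule_format]
  let ?x = "coord T a b c d p" and ?y = "coord T a b d c p"
  note x = coord_in[OF p] c_coord[OF p] d_coord[OF p]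
  note y = two_products.coord_in[OF swap_cd p] two_products.c_coord[OF swap_cd p] two_products.d_coord[OF swap_cd p]
  let ?X = "?x ` T" and ?Y = "?y ` T"
  let ?pX = "prim_part w ?X" and ?pY = "prim_part w ?Y"
  \<comment> \<open>On the fibre \<open>b = b p\<close> the weight is \<open>wA\<close> times
    \<open>wB (b p)\<close>; the further factor \<open>w p\<close> is the fourth corner that the
    rank-one identity asks for.\<close>
  define M where "M = wB (b p) * w p"
  define g where "g = Gcd (w ` ?X) * Gcd (w ` ?Y)"
  have M: "0 < M"
    using pos[OF p] ab[OF p] by (simp add: M_def)
  have key: "M * wA (a s) = g * (?pX (?x s) * ?pY (?y s))" if s: "s \<in> T" for s
  proof -
    let ?s = "mix T a b s p"
    have s': "?s \<in> T" "a ?s = a s" "b ?s = b p"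
      using s p by (auto simp: mix_ab_in a_mix_ab b_mix_ab)
    have "M * wA (a s) = w ?s * w p"
      using ab[OF s'(1)] s' by (simp add: M_def)
    \<comment> \<open>\<open>?x s\<close> and \<open>?y s\<close> arise from \<open>?s\<close> and
      \<open>p\<close> by exchanging \<open>d\<close>-values, which preserves the product of
      weights.\<close>
    also have "\<dots> = w (?x s) * w (?y s)"
      using cd[OF s'(1)] cd[OF p] cd[of "?x s"] cd[of "?y s"] x[OF s] y[OF s] by simp
    also have "\<dots> = g * (?pX (?x s) * ?pY (?y s))"
      using prim_part_mult[of "?x s" ?X w] prim_part_mult[of "?y s" ?Y w] s by (simp add: g_def ac_simps)
    finally show ?thesis .
  qed
  have "(\<lambda>(x, y). ?pX x * ?pY y) ` (?X \<times> ?Y) = (\<lambda>s. ?pX (?x s) * ?pY (?y s)) ` T"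
  proof
    show "(\<lambda>(x, y). ?pX x * ?pY y) ` (?X \<times> ?Y) \<subseteq> (\<lambda>s. ?pX (?x s) * ?pY (?y s)) ` T"
    proof clarify
      fix s t assume st: "s \<in> T" "t \<in> T"
      show "?pX (?x s) * ?pY (?y t) \<in> (\<lambda>s. ?pX (?x s) * ?pY (?y s)) ` T"
        using coord_mix[OF p st] mix_cd_in[OF st] by (intro image_eqI[of _ _ "mix T c d s t"]) auto
    qed
  qed auto
  then have one: "Gcd ((\<lambda>s. ?pX (?x s) * ?pY (?y s)) ` T) = 1"
    using Gcd_mult_image[of ?pX ?pY ?X ?Y] Gcd_prim_part[of "?x p" ?X w] Gcd_prim_part[of "?y p" ?Y w]
      pos x(1)[OF p] y(1)[OF p] p by simp
  \<comment> \<open>Taking gcds over all of \<open>T\<close> in \<open>key\<close> evaluates the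
    constant: \<open>g\<close> is \<open>M\<close> times the content of \<open>wA\<close>.\<close>
  have "M * Gcd (wA ` a ` T) = Gcd ((*) M ` wA ` a ` T)"
    by (simp add: Gcd_mult)
  also have "(*) M ` wA ` a ` T = (*) g ` (\<lambda>s. ?pX (?x s) * ?pY (?y s)) ` T"
    unfolding image_image using key by (rule image_cong[OF refl])
  also have "Gcd \<dots> = g"
    using one by (simp add: Gcd_mult)
  finally have "M * wA (a t) = M * (Gcd (wA ` a ` T) * (?pX (?x t) * ?pY (?y t)))"
    using key[OF t] by (simp add: ac_simps)
  then show ?thesis
    using M by simp
qed

text \<open>A fibre of a direct product carries no edges when the base vertex of the other factor
  has no loop. Unlike in the Cartesian case, a factor is therefore the image of the whole graph
  under a coordinate.\<close>

definition projected :: "(nat \<times> nat) set \<Rightarrow> nat set \<Rightarrow> (nat \<Rightarrow> nat) \<Rightarrow> graph" where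
  "projected F T x = (x ` T, map_prod x x ` F)"

lemma wf_projected:
  assumes "wf_graph G"
  shows "wf_graph (projected (snd G) (fst G) x)"
  using assms unfolding wf_graph_def projected_def sym_def by force

text \<open>An edge of A is lifted to \<open>F\<close> by borrowing the \<open>b\<close>-values of
  any edge (q, r) of \<open>F\<close>. Conversely, two edges of \<open>F\<close> with the required
  images in the two factors are merged by taking the \<open>c\<close>-values of one and the
  \<open>d\<close>-values of the other.\<close>

lemma direct_factor:
  fixes T :: "nat set"
  assumes tp: "two_products T a b c d DA DB DC DD" and p: "p \<in> T" and A: "fst A = a ` T"
    and F: "\<And>s t. \<lbrakk>s \<in> T; t \<in> T\<rbrakk> \<Longrightarrow> (s, t) \<in> F \<longleftrightarrow> (a s, a t) \<in> snd A \<and> EB (b s) (b t)"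
      "\<And>s t. \<lbrakk>s \<in> T; t \<in> T\<rbrakk> \<Longrightarrow> (s, t) \<in> F \<longleftrightarrow> EC (c s) (c t) \<and> ED (d s) (d t)"
    and FT: "F \<subseteq> T \<times> T" "F \<noteq> {}"
    and w: "\<And>t. t \<in> T \<Longrightarrow> wA (a t) = wX (coord T a b c d p t) * wY (coord T a b d c p t)"
  shows "weighted_iso A wA (gprod direct_rule (projected F T (coord T a b c d p)) (projected F T (coord T a b d c p)))
    (wprod wX wY)"
proof -
  interpret two_products T a b c d DA DB DC DD
    by (rule tp)
  let ?x = "coord T a b c d p" and ?y = "coord T a b d c p"
  let ?X = "projected F T ?x" and ?Y = "projected F T ?y"
  define f where "f u = (?x (inv_into T a u), ?y (inv_into T a u))" for u
  have bij: "bij_betw f (fst A) (fst ?X \<times> fst ?Y)"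
    unfolding f_def projected_def A using coord_bij[OF p] by simp
  then have "bij_betw (prod_encode \<circ> f) (fst A) (fst (gprod direct_rule ?X ?Y))"
    unfolding fst_gprod by (rule bij_betw_trans) (simp add: bij_betw_def inj_prod_encode)
  then have "bij_betw (\<lambda>u. prod_encode (f u)) (fst A) (fst (gprod direct_rule ?X ?Y))"
    by (simp add: comp_def)
  moreover have "(u, v) \<in> snd A \<longleftrightarrow> (prod_encode (f u), prod_encode (f v)) \<in> snd (gprod direct_rule ?X ?Y)"
    if uv: "u \<in> fst A" "v \<in> fst A" for u v
  proof -
    define s t where "s = inv_into T a u" and "t = inv_into T a v"
    have s: "s \<in> T" "u = a s" and t: "t \<in> T" "v = a t"
      using uv by (auto simp: s_def t_def A inv_into_into f_inv_into_f)
    have "(u, v) \<in> snd A \<longleftrightarrow> (?x s, ?x t) \<in> snd ?X \<and> (?y s, ?y t) \<in> snd ?Y"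
    proof
      assume L: "(u, v) \<in> snd A"
      obtain q r where qr: "(q, r) \<in> F" "q \<in> T" "r \<in> T"
        using FT by auto
      let ?s = "mix T a b s q" and ?t = "mix T a b t r"
      have s': "?s \<in> T" "a ?s = a s" "b ?s = b q" and t': "?t \<in> T" "a ?t = a t" "b ?t = b r"
        using s t qr by (auto simp: mix_ab_in a_mix_ab b_mix_ab)
      have "(?s, ?t) \<in> F"
        using F(1)[OF s'(1) t'(1)] F(1)[OF qr(2,3)] qr(1) s' t' s t L by simp
      moreover
      have "?x ?s = ?x s" "?x ?t = ?x t" "?y ?s = ?y s" "?y ?t = ?y t"
        using coord_split[OF p s'(1) s(1)] coord_split[OF p t'(1) t(1)] s' t' by auto
      ultimately have "(?x s, ?x t) = map_prod ?x ?x (?s, ?t)" "(?y s, ?y t) = map_prod ?y ?y (?s, ?t)"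
        by simp_all
      with \<open>(?s, ?t) \<in> F\<close> show "(?x s, ?x t) \<in> snd ?X \<and> (?y s, ?y t) \<in> snd ?Y"
        unfolding projected_def snd_conv by (intro conjI image_eqI)
    next
      assume "(?x s, ?x t) \<in> snd ?X \<and> (?y s, ?y t) \<in> snd ?Y"
      then obtain s1 t1 s2 t2 where 1: "(s1, t1) \<in> F" "?x s = ?x s1" "?x t = ?x t1"
        and 2: "(s2, t2) \<in> F" "?y s = ?y s2" "?y t = ?y t2"
        unfolding projected_def by auto
      have T: "s1 \<in> T" "t1 \<in> T" "s2 \<in> T" "t2 \<in> T"
        using 1 2 FT by auto
      let ?s = "mix T c d s1 s2" and ?t = "mix T c d t1 t2"
      have st: "?s \<in> T" "?t \<in> T" "(?s, ?t) \<in> F"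
        using F(2)[OF mix_cd_in[OF T(1,3)] mix_cd_in[OF T(2,4)]] F(2)[OF T(1,2)] F(2)[OF T(3,4)] 1(1) 2(1) T
        by (auto simp: mix_cd_in c_mix_cd d_mix_cd)
      have "a ?s = a s" "a ?t = a t"
        using coord_split[OF p st(1) s(1)] coord_split[OF p st(2) t(1)] coord_mix[OF p T(1,3)] coord_mix[OF p T(2,4)] 1 2
        by auto
      then show "(u, v) \<in> snd A"
        using F(1)[OF st(1,2)] st(3) s t by simp
    qed
    moreover have "f u = (?x s, ?y s)" "f v = (?x t, ?y t)"
      by (simp_all add: f_def s_def t_def)
    moreover have "?x s \<in> fst ?X" "?y s \<in> fst ?Y" "?x t \<in> fst ?X" "?y t \<in> fst ?Y"
      using s t by (simp_all add: projected_def)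
    ultimately show ?thesis
      by (simp add: gprod_edge)
  qed
  moreover have "wprod wX wY (prod_encode (f u)) = wA u" if "u \<in> fst A" for u
    using that w[of "inv_into T a u"] by (simp add: wprod_def f_def A inv_into_into f_inv_into_f)
  ultimately show ?thesis
    unfolding weighted_iso_def by blast
qed

lemma projected_commute:
  assumes "two_products T a b c d DA DB DC DD" "p \<in> T" "F \<subseteq> T \<times> T"
  shows "projected F T (coord T c d a b p) = projected F T (coord T a b c d p)"
  unfolding projected_def
  using two_products.coord_commute[OF assms(1,2)] assms(3)
  by (intro arg_cong2[where f = Pair] image_cong) (auto simp: map_prod_def)


text \<open>Every weight is a content times two primitive parts. The primitive parts are taken from
  the common factors and hence serve both decompositions, so only the contents remain to be refined
  as integers.\<close>

lemma thin_refinement: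
  assumes wf: "wf_graph A" "wf_graph B" "wf_graph C" "wf_graph D"
    and thin: "thin_graph A" "thin_graph B" "thin_graph C" "thin_graph D"
    and prim: "primitive_graph A" "primitive_graph B" "primitive_graph C" "primitive_graph D"
    and pos: "\<forall>t\<in>fst A. 0 < wA t" "\<forall>t\<in>fst B. 0 < wB t"
    and iso: "weighted_iso (gprod direct_rule A B) (wprod wA wB) (gprod direct_rule C D) (wprod wC wD)"
  shows "\<exists>X Y Z W wX wY wZ wW. wf_graph X \<and> wf_graph Y \<and> wf_graph Z \<and> wf_graph W \<and>
      weighted_iso A wA (gprod direct_rule X Y) (wprod wX wY) \<and>
      weighted_iso B wB (gprod direct_rule Z W) (wprod wZ wW) \<and>
      weighted_iso C wC (gprod direct_rule X Z) (wprod wX wZ) \<and>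
      weighted_iso D wD (gprod direct_rule Y W) (wprod wY wW)"
proof -
  let ?G = "gprod direct_rule A B"
  obtain \<phi> where \<phi>: "bij_betw \<phi> (fst ?G) (fst (gprod direct_rule C D))"
    and E: "\<And>u v. \<lbrakk>u \<in> fst ?G; v \<in> fst ?G\<rbrakk> \<Longrightarrow> (u, v) \<in> snd ?G \<longleftrightarrow> (\<phi> u, \<phi> v) \<in> snd (gprod direct_rule C D)"
    and weight: "\<And>u. u \<in> fst ?G \<Longrightarrow> wprod wC wD (\<phi> u) = wprod wA wB u"
    using iso unfolding weighted_iso_def by blast
  have ne: "fst A \<noteq> {}" "fst B \<noteq> {}" "fst C \<noteq> {}" "fst D \<noteq> {}"
    using prim by (auto simp: primitive_graph_def)
  have ex: "\<exists>N. \<forall>n\<ge>N. \<forall>u\<in>fst G. \<forall>v\<in>fst G. 0 < walks G n u v" if "wf_graph G" "primitive_graph G" for G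
    using that walks_pos unfolding primitive_graph_def by meson
  obtain NA where NA: "\<forall>n\<ge>NA. \<forall>u\<in>fst A. \<forall>v\<in>fst A. 0 < walks A n u v"
    using ex[OF wf(1) prim(1)] by blast
  obtain NB where NB: "\<forall>n\<ge>NB. \<forall>u\<in>fst B. \<forall>v\<in>fst B. 0 < walks B n u v"
    using ex[OF wf(2) prim(2)] by blast
  obtain NC where NC: "\<forall>n\<ge>NC. \<forall>u\<in>fst C. \<forall>v\<in>fst C. 0 < walks C n u v"
    using ex[OF wf(3) prim(3)] by blast
  obtain ND where ND: "\<forall>n\<ge>ND. \<forall>u\<in>fst D. \<forall>v\<in>fst D. 0 < walks D n u v"
    using ex[OF wf(4) prim(4)] by blast
  \<comment> \<open>One length beyond all four bounds; the successor keeps it positive, as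
    \<open>quasi_metric_walk_dist\<close> demands.\<close>
  define n where "n = Suc (NA + NB + NC + ND)"
  have walks: "\<And>u v. \<lbrakk>u \<in> fst A; v \<in> fst A\<rbrakk> \<Longrightarrow> 0 < walks A n u v" "\<And>u v. \<lbrakk>u \<in> fst B; v \<in> fst B\<rbrakk> \<Longrightarrow> 0 < walks B n u v"
      "\<And>u v. \<lbrakk>u \<in> fst C; v \<in> fst C\<rbrakk> \<Longrightarrow> 0 < walks C n u v" "\<And>u v. \<lbrakk>u \<in> fst D; v \<in> fst D\<rbrakk> \<Longrightarrow> 0 < walks D n u v"
    using NA NB NC ND by (simp_all add: n_def del: walks.simps)
  have n: "0 < n"
    by (simp add: n_def)
  have dist: "walk_dist n (gprod direct_rule G H) s t = walk_dist n G (fst_of s) (fst_of t) + walk_dist n H (snd_of s) (snd_of t)"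
    if "wf_graph G" "wf_graph H" "\<And>u v. \<lbrakk>u \<in> fst G; v \<in> fst G\<rbrakk> \<Longrightarrow> 0 < walks G n u v"
      "\<And>u v. \<lbrakk>u \<in> fst H; v \<in> fst H\<rbrakk> \<Longrightarrow> 0 < walks H n u v"
      "s \<in> fst (gprod direct_rule G H)" "t \<in> fst (gprod direct_rule G H)" for G H s t
    using that(5,6) by (auto simp: fst_gprod walk_dist_direct[OF that(1-4)])
  define T where "T = fst ?G"
  define a b c d where "a = fst_of" and "b = snd_of" and "c = (\<lambda>t. fst_of (\<phi> t))" and "d = (\<lambda>t. snd_of (\<phi> t))"
  have dist': "walk_dist n A (a s) (a t) + walk_dist n B (b s) (b t) = walk_dist n C (c s) (c t) + walk_dist n D (d s) (d t)"
    if "s \<in> T" "t \<in> T" for s t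
    using that dist[OF wf(1,2) walks(1,2), of s t] dist[OF wf(3,4) walks(3,4), of "\<phi> s" "\<phi> t"]
      walk_dist_iso[OF \<phi> E, of s t n] bij_betw_apply[OF \<phi>]
    by (simp add: T_def a_def b_def c_def d_def)
  note tp' = two_products_gprod[OF ne \<phi> quasi_metric_walk_dist[OF wf(1) thin(1) ne(1) n walks(1)]
      quasi_metric_walk_dist[OF wf(2) thin(2) ne(2) n walks(2)] quasi_metric_walk_dist[OF wf(3) thin(3) ne(3) n walks(3)]
      quasi_metric_walk_dist[OF wf(4) thin(4) ne(4) n walks(4)] dist'[unfolded T_def a_def b_def c_def d_def],
      folded T_def a_def b_def c_def d_def]
  have tp: "two_products T a b c d (walk_dist n A) (walk_dist n B) (walk_dist n C) (walk_dist n D)"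
      "a ` T = fst A" "b ` T = fst B" "c ` T = fst C" "d ` T = fst D"
    by (rule tp'; assumption)+
  interpret two_products T a b c d "walk_dist n A" "walk_dist n B" "walk_dist n C" "walk_dist n D"
    by (rule tp(1))
  obtain p where p: "p \<in> T"
    using ne by (auto simp: T_def fst_gprod)
  have F: "(s, t) \<in> snd ?G \<longleftrightarrow> (a s, a t) \<in> snd A \<and> (b s, b t) \<in> snd B"
     "(s, t) \<in> snd ?G \<longleftrightarrow> (c s, c t) \<in> snd C \<and> (d s, d t) \<in> snd D"
     "(s, t) \<in> snd ?G \<longleftrightarrow> (b s, b t) \<in> snd B \<and> (a s, a t) \<in> snd A"
     "(s, t) \<in> snd ?G \<longleftrightarrow> (d s, d t) \<in> snd D \<and> (c s, c t) \<in> snd C"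
    if "s \<in> T" "t \<in> T" for s t
    using that gprod_edge_of[of s direct_rule A B t] gprod_edge_of[of "\<phi> s" direct_rule C D "\<phi> t"] E[of s t] bij_betw_apply[OF \<phi>]
    by (auto simp add: T_def a_def b_def c_def d_def)
  have wfG: "wf_graph ?G"
    by (rule wf_gprod[OF wf(1,2)])
  have FT: "snd ?G \<subseteq> T \<times> T"
    using wfG by (simp add: wf_graph_def T_def)
  have "primitive_graph ?G"
    using primitive_direct[OF wf(1,2)] prim by simp
  then have F_ne: "snd ?G \<noteq> {}"
    using primitive_neighbour[OF _ wfG] p unfolding T_def by blast
  define w where "w t = wA (a t) * wB (b t)" for t
  have w_ab: "\<forall>t\<in>T. w t = wA (a t) * wB (b t)" "\<forall>t\<in>T. w t = wB (b t) * wA (a t)"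
    and w_cd: "\<forall>t\<in>T. w t = wC (c t) * wD (d t)" "\<forall>t\<in>T. w t = wD (d t) * wC (c t)"
    using weight by (simp_all add: w_def wprod_def a_def b_def c_def d_def T_def mult.commute)
  have w_pos: "\<forall>t\<in>T. 0 < w t"
  proof
    fix t assume that: "t \<in> T"
    have "a t \<in> fst A" "b t \<in> fst B"
      using imageI[OF that, of a] imageI[OF that, of b] tp(2,3) by simp_all
    then show "0 < w t"
      using pos by (simp add: w_def)
  qed
  \<comment> \<open>Coordinates of the parts common to A and C, A and D, B and C, B and D.\<close>
  define x y z v where "x = coord T a b c d p" and "y = coord T a b d c p"
    and "z = coord T b a c d p" and "v = coord T b a d c p"
  define px py pz pv where "px = prim_part w (x ` T)" and "py = prim_part w (y ` T)"
    and "pz = prim_part w (z ` T)" and "pv = prim_part w (v ` T)"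
  define kA kB kC kD where "kA = Gcd (wA ` a ` T)" and "kB = Gcd (wB ` b ` T)"
    and "kC = Gcd (wC ` c ` T)" and "kD = Gcd (wD ` d ` T)"
  note commute = coord_commute[OF p, symmetric] two_products.coord_commute[OF swap_ab p, symmetric]
    two_products.coord_commute[OF swap_cd p, symmetric]
    two_products.coord_commute[OF two_products.swap_cd[OF swap_ab] p, symmetric]
  note image = coord_image[OF p] two_products.coord_image[OF swap_ab p]
    two_products.coord_image[OF swap_cd p] two_products.coord_image[OF two_products.swap_cd[OF swap_ab] p]
  have splitA: "wA (a t) = kA * (px (x t) * py (y t))" if "t \<in> T" for t
    using weight_split[OF tp(1) p w_ab(1) w_cd(1) w_pos that]
    by (simp add: kA_def px_def py_def x_def y_def)
  have splitB: "wB (b t) = kB * (pz (z t) * pv (v t))" if "t \<in> T" for t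
    using weight_split[OF swap_ab p w_ab(2) w_cd(1) w_pos that]
    by (simp add: kB_def pz_def pv_def z_def v_def)
  have splitC: "wC (c t) = kC * (px (x t) * pz (z t))" if "t \<in> T" for t
    using weight_split[OF swap_pairs p w_cd(1) w_ab(1) w_pos that]
    by (simp add: kC_def px_def pz_def x_def z_def image commute[OF that])
  have splitD: "wD (d t) = kD * (py (y t) * pv (v t))" if "t \<in> T" for t
    using weight_split[OF two_products.swap_ab[OF swap_pairs] p w_cd(2) w_ab(1) w_pos that]
    by (simp add: kD_def py_def pv_def y_def v_def image commute[OF that])
  \<comment> \<open>Evaluated at \<open>p\<close> in both decompositions, the positive weight shows
    the same primitive parts; they cancel and leave an equation between contents.\<close>
  have "w p = (kA * kB) * (px (x p) * py (y p) * pz (z p) * pv (v p))"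
    using bspec[OF w_ab(1) p] splitA[OF p] splitB[OF p] by (simp add: ac_simps)
  moreover have "w p = (kC * kD) * (px (x p) * py (y p) * pz (z p) * pv (v p))"
    using bspec[OF w_cd(1) p] splitC[OF p] splitD[OF p] by (simp add: ac_simps)
  ultimately have "kA * kB = kC * kD" "0 < kA"
    using bspec[OF w_pos p] by (metis mult_cancel2 mult_is_0 neq0_conv)+
  then obtain kx ky kz kv where k: "kA = kx * ky" "kB = kz * kv" "kC = kx * kz" "kD = ky * kv"
    using nat_mult_refine by blast
  define wX wY wZ wV where "wX u = kx * px u" and "wY u = ky * py u" and "wZ u = kz * pz u" and "wV u = kv * pv u" for u
  have wA: "wA (a t) = wX (x t) * wY (y t)" and wB: "wB (b t) = wZ (z t) * wV (v t)"
    and wC: "wC (c t) = wX (x t) * wZ (z t)" and wD: "wD (d t) = wY (y t) * wV (v t)" if "t \<in> T" for t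
    using splitA[OF that] splitB[OF that] splitC[OF that] splitD[OF that]
    by (simp_all add: k wX_def wY_def wZ_def wV_def ac_simps)
  let ?P = "projected (snd ?G) T"
  have "weighted_iso A wA (gprod direct_rule (?P x) (?P y)) (wprod wX wY)"
    unfolding x_def y_def
    by (rule direct_factor[OF tp(1) p tp(2)[symmetric], where EB = "\<lambda>u v. (u, v) \<in> snd B" and EC = "\<lambda>u v. (u, v) \<in> snd C" and ED = "\<lambda>u v. (u, v) \<in> snd D"])
      (rule F FT F_ne wA[unfolded x_def y_def] | assumption)+
  moreover have "weighted_iso B wB (gprod direct_rule (?P z) (?P v)) (wprod wZ wV)"
    unfolding z_def v_def
    by (rule direct_factor[OF swap_ab p tp(3)[symmetric], where EB = "\<lambda>u v. (u, v) \<in> snd A" and EC = "\<lambda>u v. (u, v) \<in> snd C" and ED = "\<lambda>u v. (u, v) \<in> snd D"])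
      (rule F FT F_ne wB[unfolded z_def v_def] | assumption)+
  moreover have "weighted_iso C wC (gprod direct_rule (?P x) (?P z)) (wprod wX wZ)"
    unfolding x_def z_def projected_commute[OF tp(1) p FT, symmetric] projected_commute[OF swap_ab p FT, symmetric]
    by (rule direct_factor[OF swap_pairs p tp(4)[symmetric], where EB = "\<lambda>u v. (u, v) \<in> snd D" and EC = "\<lambda>u v. (u, v) \<in> snd A" and ED = "\<lambda>u v. (u, v) \<in> snd B"])
      (rule F FT F_ne | assumption | simp add: commute wC[unfolded x_def z_def])+
  moreover have "weighted_iso D wD (gprod direct_rule (?P y) (?P v)) (wprod wY wV)"
    unfolding y_def v_def projected_commute[OF swap_cd p FT, symmetric]
      projected_commute[OF two_products.swap_cd[OF swap_ab] p FT, symmetric]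
    by (rule direct_factor[OF two_products.swap_ab[OF swap_pairs] p tp(5)[symmetric], where EB = "\<lambda>u v. (u, v) \<in> snd C" and EC = "\<lambda>u v. (u, v) \<in> snd A" and ED = "\<lambda>u v. (u, v) \<in> snd B"])
      (rule F FT F_ne | assumption | simp add: commute wD[unfolded y_def v_def])+
  moreover have "wf_graph (?P f)" for f
    using wf_projected[OF wfG] by (simp add: T_def)
  ultimately show ?thesis
    by blast
qed

text \<open>The metric argument runs on the thin quotients, with weights remembering the numbers of
  twins. Blowing up the four common factors returns to the given graphs, as blow-ups commute with
  the direct product and are unique up to isomorphism.\<close>

lemma direct_refinement:
  assumes wf: "wf_graph A" "wf_graph B" "wf_graph C" "wf_graph D"
    and prim: "primitive_graph A" "primitive_graph B" "primitive_graph C" "primitive_graph D"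
    and iso: "graph_iso (gprod direct_rule A B) (gprod direct_rule C D)"
  shows "\<exists>X Y Z W. (wf_graph X \<and> primitive_graph X) \<and> (wf_graph Y \<and> primitive_graph Y) \<and>
      (wf_graph Z \<and> primitive_graph Z) \<and> (wf_graph W \<and> primitive_graph W) \<and>
      graph_iso A (gprod direct_rule X Y) \<and> graph_iso B (gprod direct_rule Z W) \<and>
      graph_iso C (gprod direct_rule X Z) \<and> graph_iso D (gprod direct_rule Y W)"
proof -
  obtain HA wA where A: "wf_graph HA" "thin_graph HA" "blowup A HA wA" "\<And>t. t \<in> fst HA \<Longrightarrow> 0 < wA t"
    using thin_blowup_exists[OF wf(1)] by blast
  obtain HB wB where B: "wf_graph HB" "thin_graph HB" "blowup B HB wB" "\<And>t. t \<in> fst HB \<Longrightarrow> 0 < wB t"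
    using thin_blowup_exists[OF wf(2)] by blast
  obtain HC wC where C: "wf_graph HC" "thin_graph HC" "blowup C HC wC" "\<And>t. t \<in> fst HC \<Longrightarrow> 0 < wC t"
    using thin_blowup_exists[OF wf(3)] by blast
  obtain HD wD where D: "wf_graph HD" "thin_graph HD" "blowup D HD wD" "\<And>t. t \<in> fst HD \<Longrightarrow> 0 < wD t"
    using thin_blowup_exists[OF wf(4)] by blast
  have pos: "\<forall>t\<in>fst HA. 0 < wA t" "\<forall>t\<in>fst HB. 0 < wB t"
    using A(4) B(4) by blast+
  have pA: "primitive_graph HA" by (rule primitive_blowup[OF A(4) wf(1) A(3) prim(1)])
  have pB: "primitive_graph HB" by (rule primitive_blowup[OF B(4) wf(2) B(3) prim(2)])
  have pC: "primitive_graph HC" by (rule primitive_blowup[OF C(4) wf(3) C(3) prim(3)])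
  have pD: "primitive_graph HD" by (rule primitive_blowup[OF D(4) wf(4) D(3) prim(4)])
  have "weighted_iso (gprod direct_rule HA HB) (wprod wA wB) (gprod direct_rule HC HD) (wprod wC wD)"
  proof (rule thin_blowup_unique)
    show "blowup (gprod direct_rule A B) (gprod direct_rule HA HB) (wprod wA wB)"
      by (rule blowup_direct[OF A(3) B(3)])
    show "blowup (gprod direct_rule A B) (gprod direct_rule HC HD) (wprod wC wD)"
      by (rule blowup_iso[OF iso blowup_direct[OF C(3) D(3)]])
    show "thin_graph (gprod direct_rule HA HB)" "thin_graph (gprod direct_rule HC HD)"
      using A B C D pA pB pC pD by (auto intro: thin_direct)
  qed (use A B C D in \<open>auto simp: wprod_def fst_gprod\<close>)
  then obtain X Y Z W wX wY wZ wW where H: "wf_graph X" "wf_graph Y" "wf_graph Z" "wf_graph W"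
    and iso': "weighted_iso HA wA (gprod direct_rule X Y) (wprod wX wY)"
      "weighted_iso HB wB (gprod direct_rule Z W) (wprod wZ wW)"
      "weighted_iso HC wC (gprod direct_rule X Z) (wprod wX wZ)"
      "weighted_iso HD wD (gprod direct_rule Y W) (wprod wY wW)"
    using thin_refinement[OF A(1) B(1) C(1) D(1) A(2) B(2) C(2) D(2) pA pB pC pD pos, of wC wD] by blast
  obtain X' Y' Z' W' where wf': "wf_graph X'" "wf_graph Y'" "wf_graph Z'" "wf_graph W'"
    and bl: "blowup X' X wX" "blowup Y' Y wY" "blowup Z' Z wZ" "blowup W' W wW"
    using H blowup_exists by metis
  have "graph_iso A (gprod direct_rule X' Y')"
    by (rule blowup_unique[OF wf(1) wf_gprod[OF wf'(1,2)] blowup_weighted_iso[OF A(3) iso'(1)] blowup_direct[OF bl(1,2)]])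
  moreover have "graph_iso B (gprod direct_rule Z' W')"
    by (rule blowup_unique[OF wf(2) wf_gprod[OF wf'(3,4)] blowup_weighted_iso[OF B(3) iso'(2)] blowup_direct[OF bl(3,4)]])
  moreover have "graph_iso C (gprod direct_rule X' Z')"
    by (rule blowup_unique[OF wf(3) wf_gprod[OF wf'(1,3)] blowup_weighted_iso[OF C(3) iso'(3)] blowup_direct[OF bl(1,3)]])
  moreover have "graph_iso D (gprod direct_rule Y' W')"
    by (rule blowup_unique[OF wf(4) wf_gprod[OF wf'(2,4)] blowup_weighted_iso[OF D(3) iso'(4)] blowup_direct[OF bl(2,4)]])
  \<comment> \<open>Primitivity descends from A and B to their factors, which together are all
    four.\<close>
  moreover from calculation have "primitive_graph X' \<and> primitive_graph Y'" "primitive_graph Z' \<and> primitive_graph W'"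
    using primitive_graph_iso[OF wf(1) wf_gprod[OF wf'(1,2)] _ prim(1)]
      primitive_graph_iso[OF wf(2) wf_gprod[OF wf'(3,4)] _ prim(2)]
      primitive_direct[OF wf'(1,2)] primitive_direct[OF wf'(3,4)] by blast+
  ultimately show ?thesis
    using wf' by blast
qed

section \<open>The three rings\<close>

text \<open>Provides connected graphs with every positive number of vertices, so that all primes
  occur as sizes.\<close>

definition complete_graph :: "nat \<Rightarrow> graph" where
  "complete_graph n = ({..<n}, {(u, v). u < n \<and> v < n \<and> u \<noteq> v})"

lemma complete_graph:
  assumes "0 < n"
  shows "simple_graph (complete_graph n)" "connected_graph (complete_graph n)" "card (fst (complete_graph n)) = n"
proof -
  show "simple_graph (complete_graph n)"
    by (auto simp: simple_graph_def wf_graph_def complete_graph_def sym_def)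
  show "connected_graph (complete_graph n)"
    unfolding connected_graph_def
  proof (intro conjI ballI)
    show "(u, v) \<in> (snd (complete_graph n))\<^sup>*" if "u \<in> fst (complete_graph n)" "v \<in> fst (complete_graph n)" for u v
      using that by (cases "u = v") (auto simp: complete_graph_def)
  qed (use assms in \<open>auto simp: complete_graph_def\<close>)
qed (simp add: complete_graph_def)

lemma one_vertex_iso:
  assumes "wf_graph G" "card (fst G) = 1" "fst U = {0}" "\<And>v. v \<in> fst G \<Longrightarrow> (v, v) \<in> snd G \<longleftrightarrow> (0, 0) \<in> snd U"
  shows "graph_iso G U"
proof -
  obtain v where "fst G = {v}"
    using assms(2) card_1_singletonE by blast
  then show ?thesis
    using assms by (intro graph_isoI[of "\<lambda>_. 0"]) (auto simp: bij_betw_def)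
qed

lemma cartesian_prod_eq: "cartesian_prod G H = gprod cart_rule G H"
  by (simp add: cartesian_prod_def gprod_def)

lemma direct_prod_eq:
  assumes "wf_graph G" "wf_graph H"
  shows "direct_prod G H = gprod direct_rule G H"
  using wf_graph_edge[OF assms(1)] wf_graph_edge[OF assms(2)] by (auto simp: direct_prod_def gprod_def)

section \<open>The monoid of the Cartesian product\<close>

abbreviation simple_connected :: "graph \<Rightarrow> bool" where
  "simple_connected G \<equiv> simple_graph G \<and> connected_graph G"

lemma simple_connected_K1: "simple_connected K1"
  by (auto simp: K1_def simple_graph_def wf_graph_def connected_graph_def sym_def)

lemma simple_connected_iso:
  "\<lbrakk>simple_connected G; wf_graph H; graph_iso G H\<rbrakk> \<Longrightarrow> simple_connected H"
  using simple_graph_iso connected_graph_iso by (metis simple_graph_def)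

interpretation cartesian: graph_monoid simple_connected cartesian_prod cart_rule K1
proof
  fix G H
  show "simple_connected G \<Longrightarrow> wf_graph H \<Longrightarrow> graph_iso G H \<Longrightarrow> simple_connected H"
    by (rule simple_connected_iso)
  show "simple_connected (gprod cart_rule G H)" if "simple_connected G" "simple_connected H"
    using that connected_cart[of G H] wf_gprod[of G H] by (auto simp: simple_graph_def) (auto simp: gprod_def)
  show "graph_iso G K1" if "simple_connected G" "card (fst G) = 1"
    using that by (intro one_vertex_iso) (auto simp: simple_graph_def K1_def)
  show "\<exists>G. simple_connected G \<and> card (fst G) = n" if "0 < n" for n
    using complete_graph[OF that] by blast
next
  fix A B C D
  assume "simple_connected A" "simple_connected B" "simple_connected C" "simple_connected D"
    "graph_iso (gprod cart_rule A B) (gprod cart_rule C D)"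
  then show "\<exists>X Y Z W. simple_connected X \<and> simple_connected Y \<and> simple_connected Z \<and> simple_connected W \<and>
      graph_iso A (gprod cart_rule X Y) \<and> graph_iso B (gprod cart_rule Z W) \<and>
      graph_iso C (gprod cart_rule X Z) \<and> graph_iso D (gprod cart_rule Y W)"
    using cart_refinement by simp
next
  show "simple_connected K1"
    by (rule simple_connected_K1)
qed (auto simp: cartesian_prod_eq simple_graph_def connected_graph_def K1_def)

section \<open>The monoid of the direct product\<close>

abbreviation nonbip_connected :: "graph \<Rightarrow> bool" where
  "nonbip_connected G \<equiv> wf_graph G \<and> connected_graph G \<and> \<not> bipartite_graph G"

lemma nonbip_connected_iff: "nonbip_connected G \<longleftrightarrow> wf_graph G \<and> primitive_graph G"
  using primitive_graph_iff by blast

definition reflexive_closure :: "graph \<Rightarrow> graph" where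
  "reflexive_closure G = (fst G, snd G \<union> Id_on (fst G))"

lemma wf_reflexive_closure: "wf_graph G \<Longrightarrow> wf_graph (reflexive_closure G)"
  by (auto simp: wf_graph_def reflexive_closure_def sym_def)

text \<open>A loop excludes every bipartition, and adding loops does not change which vertices are
  joined by walks.\<close>

lemma primitive_reflexive_closure:
  assumes wf: "wf_graph G"
  shows "primitive_graph (reflexive_closure G) \<longleftrightarrow> connected_graph G"
proof -
  have eq: "(snd G \<union> Id_on (fst G))\<^sup>* = (snd G)\<^sup>*"
    by (rule rtrancl_subset) auto
  then have "connected_graph (reflexive_closure G) \<longleftrightarrow> connected_graph G"
    by (simp add: connected_graph_def reflexive_closure_def)
  moreover have "\<not> bipartite_graph (reflexive_closure G)" if "fst G \<noteq> {}"
    using that by (force simp: bipartite_graph_def reflexive_closure_def)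
  ultimately show ?thesis
    unfolding primitive_graph_iff[OF wf_reflexive_closure[OF wf]] by (auto simp: connected_graph_def)
qed

interpretation direct: graph_monoid nonbip_connected direct_prod direct_rule K1_loop
proof
  fix G H
  show "direct_prod G H = gprod direct_rule G H" if "nonbip_connected G" "nonbip_connected H"
    using that by (simp add: direct_prod_eq)
  show "nonbip_connected H" if "nonbip_connected G" "wf_graph H" "graph_iso G H"
    using that unfolding nonbip_connected_iff using primitive_graph_iso by blast
  show "nonbip_connected (gprod direct_rule G H)" if "nonbip_connected G" "nonbip_connected H"
    using that unfolding nonbip_connected_iff by (simp add: wf_gprod primitive_direct)
  show "graph_iso G K1_loop" if G: "nonbip_connected G" "card (fst G) = 1"
  proof (rule one_vertex_iso)
    obtain v where v: "fst G = {v}"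
      using G card_1_singletonE by blast
    \<comment> \<open>The empty edge relation is bipartite, so a single nonbipartite vertex must
      carry a loop.\<close>
    have "snd G \<noteq> {}"
      using G by (auto simp: bipartite_graph_def)
    then show "(u, u) \<in> snd G \<longleftrightarrow> (0, 0) \<in> snd K1_loop" if "u \<in> fst G" for u
      using that G v by (auto simp: wf_graph_def K1_loop_def)
  qed (use G in \<open>auto simp: K1_loop_def\<close>)
  \<comment> \<open>Loops are added since the complete graphs on one and two vertices are
    bipartite.\<close>
  show "\<exists>G. nonbip_connected G \<and> card (fst G) = n" if "0 < n" for n
    using complete_graph[OF that] unfolding nonbip_connected_iff
    by (intro exI[of _ "reflexive_closure (complete_graph n)"])
      (auto simp: wf_reflexive_closure primitive_reflexive_closure simple_graph_def, simp add: reflexive_closure_def)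
next
  fix A B C D
  assume "nonbip_connected A" "nonbip_connected B" "nonbip_connected C" "nonbip_connected D"
    "graph_iso (gprod direct_rule A B) (gprod direct_rule C D)"
  then show "\<exists>X Y Z W. nonbip_connected X \<and> nonbip_connected Y \<and> nonbip_connected Z \<and> nonbip_connected W \<and>
      graph_iso A (gprod direct_rule X Y) \<and> graph_iso B (gprod direct_rule Z W) \<and>
      graph_iso C (gprod direct_rule X Z) \<and> graph_iso D (gprod direct_rule Y W)"
    unfolding nonbip_connected_iff using direct_refinement by simp
next
  show "nonbip_connected K1_loop"
    by (auto simp: K1_loop_def wf_graph_def connected_graph_def bipartite_graph_def sym_def)
qed (auto simp: connected_graph_def K1_loop_def)

section \<open>The monoid of the strong product\<close>

abbreviation strong_rule :: "bool \<Rightarrow> bool \<Rightarrow> bool \<Rightarrow> bool \<Rightarrow> bool" where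
  "strong_rule e p f q \<equiv> e \<and> f \<and> (p \<or> q) \<or> \<not> (e \<and> f) \<and> (e \<or> p) \<and> (f \<or> q)"

text \<open>The first disjunct of \<open>strong_rule\<close> reproduces the convention on loops,
  which makes this an identity for all graphs.\<close>

lemma strong_prod_eq: "strong_prod G H = gprod strong_rule G H"
  by (auto simp: strong_prod_def gprod_def split: if_splits)

text \<open>Once every vertex has a loop, "equal or adjacent" in each coordinate is plain adjacency
  in each coordinate.\<close>

lemma reflexive_closure_strong:
  "reflexive_closure (gprod strong_rule G H) = gprod direct_rule (reflexive_closure G) (reflexive_closure H)"
  (is "?L = ?R")
proof (rule prod_eqI)
  show "fst ?L = fst ?R"
    by (simp add: reflexive_closure_def fst_gprod)
  have "(m, n) \<in> snd ?L \<longleftrightarrow> (m, n) \<in> snd ?R" for m n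
  proof -
    obtain u v u' v' where "m = prod_encode (u, v)" "n = prod_encode (u', v')"
      by (metis prod_decode_inverse surj_pair)
    then show ?thesis
      by (auto simp: reflexive_closure_def gprod_edge gprod_vertex Id_on_iff)
  qed
  then show "snd ?L = snd ?R"
    by (intro equalityI subrelI) blast+
qed

lemma reflexive_closure_iso:
  assumes "graph_iso G H"
  shows "graph_iso (reflexive_closure G) (reflexive_closure H)"
proof -
  obtain f where f: "bij_betw f (fst G) (fst H)"
    "\<And>u v. \<lbrakk>u \<in> fst G; v \<in> fst G\<rbrakk> \<Longrightarrow> (u, v) \<in> snd G \<longleftrightarrow> (f u, f v) \<in> snd H"
    using assms by (auto simp: graph_iso_def)
  then show ?thesis
    by (intro graph_isoI[of f]) (auto simp: reflexive_closure_def bij_betw_def inj_on_def)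
qed

lemma reflexive_closure_iso_cancel:
  assumes "simple_graph G" "simple_graph H" "graph_iso (reflexive_closure G) (reflexive_closure H)"
  shows "graph_iso G H"
proof -
  obtain f where f: "bij_betw f (fst G) (fst H)"
    and E: "\<And>u v. \<lbrakk>u \<in> fst G; v \<in> fst G\<rbrakk> \<Longrightarrow>
      (u, v) \<in> snd G \<union> Id_on (fst G) \<longleftrightarrow> (f u, f v) \<in> snd H \<union> Id_on (fst H)"
    using assms by (auto simp: graph_iso_def reflexive_closure_def)
  show ?thesis
  proof (rule graph_isoI[OF f])
    fix u v assume uv: "u \<in> fst G" "v \<in> fst G"
    show "(u, v) \<in> snd G \<longleftrightarrow> (f u, f v) \<in> snd H"
    proof (cases "u = v")
      case True
      then show ?thesis
        using assms by (simp add: simple_graph_def)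
    next
      case False
      then have "f u \<noteq> f v"
        using f uv by (auto simp: bij_betw_def inj_on_def)
      then show ?thesis
        using E[OF uv] False by auto
    qed
  qed
qed

definition loopless :: "graph \<Rightarrow> graph" where
  "loopless G = (fst G, snd G - Id)"

lemma simple_loopless: "wf_graph G \<Longrightarrow> simple_graph (loopless G)"
  by (auto simp: simple_graph_def wf_graph_def loopless_def sym_def)

lemma reflexive_closure_loopless:
  "\<lbrakk>wf_graph G; \<And>v. v \<in> fst G \<Longrightarrow> (v, v) \<in> snd G\<rbrakk> \<Longrightarrow> reflexive_closure (loopless G) = G"
  by (cases G) (auto simp: reflexive_closure_def loopless_def wf_graph_def)

text \<open>A loop at a pair is a loop at both of its entries. Factors of a reflexive graph are thus
  reflexive closures of their own loopless parts.\<close>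

lemma reflexive_factors:
  assumes "graph_iso (reflexive_closure A) (gprod direct_rule X Y)" "fst X \<noteq> {}" "fst Y \<noteq> {}"
  shows "\<And>u. u \<in> fst X \<Longrightarrow> (u, u) \<in> snd X" "\<And>v. v \<in> fst Y \<Longrightarrow> (v, v) \<in> snd Y"
proof -
  obtain f where f: "bij_betw f (fst A) (fst (gprod direct_rule X Y))"
    and E: "\<And>u v. \<lbrakk>u \<in> fst A; v \<in> fst A\<rbrakk> \<Longrightarrow>
      (u, v) \<in> snd A \<union> Id_on (fst A) \<longleftrightarrow> (f u, f v) \<in> snd (gprod direct_rule X Y)"
    using assms by (auto simp: graph_iso_def reflexive_closure_def)
  have loop: "(n, n) \<in> snd (gprod direct_rule X Y)" if n: "n \<in> fst (gprod direct_rule X Y)" for n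
  proof -
    obtain u where "u \<in> fst A" "n = f u"
      using n bij_betw_imp_surj_on[OF f] by blast
    then show ?thesis
      using E[of u u] by auto
  qed
  have "(u, u) \<in> snd X \<and> (v, v) \<in> snd Y" if "u \<in> fst X" "v \<in> fst Y" for u v
    using loop[of "prod_encode (u, v)"] that by (simp add: gprod_vertex gprod_edge)
  then show "\<And>u. u \<in> fst X \<Longrightarrow> (u, u) \<in> snd X" "\<And>v. v \<in> fst Y \<Longrightarrow> (v, v) \<in> snd Y"
    using assms by blast+
qed

lemma simple_connected_strong:
  assumes "simple_connected G" "simple_connected H"
  shows "simple_connected (gprod strong_rule G H)"
proof -
  have wf: "wf_graph G" "wf_graph H"
    using assms by (auto simp: simple_graph_def)
  then have "primitive_graph (reflexive_closure (gprod strong_rule G H))"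
    using assms unfolding reflexive_closure_strong
    by (simp add: primitive_direct wf_reflexive_closure primitive_reflexive_closure)
  then have "connected_graph (gprod strong_rule G H)"
    using primitive_reflexive_closure wf wf_gprod by blast
  moreover have "simple_graph (gprod strong_rule G H)"
    using assms wf_gprod[OF wf] by (auto simp: simple_graph_def) (auto simp: gprod_def)
  ultimately show ?thesis
    by simp
qed

text \<open>Reflexive closures turn the given isomorphism into one of direct products. The factors
  found there carry all loops, so deleting loops loses no information, and
  \<open>reflexive_closure_iso_cancel\<close> leads back to simple graphs.\<close>

lemma strong_refinement:
  assumes sc: "simple_connected A" "simple_connected B" "simple_connected C" "simple_connected D"
    and iso: "graph_iso (gprod strong_rule A B) (gprod strong_rule C D)"
  shows "\<exists>X Y Z W. simple_connected X \<and> simple_connected Y \<and> simple_connected Z \<and> simple_connected W \<and>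
      graph_iso A (gprod strong_rule X Y) \<and> graph_iso B (gprod strong_rule Z W) \<and>
      graph_iso C (gprod strong_rule X Z) \<and> graph_iso D (gprod strong_rule Y W)"
proof -
  let ?r = reflexive_closure
  have wf: "wf_graph A" "wf_graph B" "wf_graph C" "wf_graph D"
    using sc by (auto simp: simple_graph_def)
  have "primitive_graph (?r A)" "primitive_graph (?r B)" "primitive_graph (?r C)" "primitive_graph (?r D)"
    using sc wf by (auto simp: primitive_reflexive_closure)
  then obtain X Y Z W where W: "wf_graph X" "wf_graph Y" "wf_graph Z" "wf_graph W"
    and prim: "primitive_graph X" "primitive_graph Y" "primitive_graph Z" "primitive_graph W"
    and i: "graph_iso (?r A) (gprod direct_rule X Y)" "graph_iso (?r B) (gprod direct_rule Z W)"
      "graph_iso (?r C) (gprod direct_rule X Z)" "graph_iso (?r D) (gprod direct_rule Y W)"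
    using direct_refinement[OF wf[THEN wf_reflexive_closure]] reflexive_closure_iso[OF iso]
    unfolding reflexive_closure_strong by blast
  have ne: "fst X \<noteq> {}" "fst Y \<noteq> {}" "fst Z \<noteq> {}" "fst W \<noteq> {}"
    using prim by (auto simp: primitive_graph_def)
  have eq: "?r (loopless X) = X" "?r (loopless Y) = Y" "?r (loopless Z) = Z" "?r (loopless W) = W"
    using reflexive_factors[OF i(1) ne(1,2)] reflexive_factors[OF i(2) ne(3,4)] W
    by (simp_all add: reflexive_closure_loopless)
  have sc': "simple_connected (loopless X)" "simple_connected (loopless Y)"
      "simple_connected (loopless Z)" "simple_connected (loopless W)"
    using prim W simple_loopless primitive_reflexive_closure eq by (metis simple_graph_def)+
  have factor: "graph_iso G (gprod strong_rule (loopless P) (loopless Q))"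
    if "simple_graph G" "graph_iso (?r G) (gprod direct_rule (?r (loopless P)) (?r (loopless Q)))"
      "simple_connected (loopless P)" "simple_connected (loopless Q)" for G P Q
  proof (rule reflexive_closure_iso_cancel[OF that(1)])
    show "simple_graph (gprod strong_rule (loopless P) (loopless Q))"
      using simple_connected_strong[OF that(3,4)] by (rule conjunct1)
    show "graph_iso (?r G) (?r (gprod strong_rule (loopless P) (loopless Q)))"
      unfolding reflexive_closure_strong by (rule that(2))
  qed
  have "graph_iso A (gprod strong_rule (loopless X) (loopless Y))"
      "graph_iso B (gprod strong_rule (loopless Z) (loopless W))"
      "graph_iso C (gprod strong_rule (loopless X) (loopless Z))"
      "graph_iso D (gprod strong_rule (loopless Y) (loopless W))"
    using factor[of A X Y] factor[of B Z W] factor[of C X Z] factor[of D Y W] sc sc' i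
    unfolding eq by blast+
  then show ?thesis
    using sc' by blast
qed

interpretation strong: graph_monoid simple_connected strong_prod strong_rule K1
proof
  fix G H
  show "simple_connected G \<Longrightarrow> wf_graph H \<Longrightarrow> graph_iso G H \<Longrightarrow> simple_connected H"
    by (rule simple_connected_iso)
  show "simple_connected (gprod strong_rule G H)" if "simple_connected G" "simple_connected H"
    using that by (rule simple_connected_strong)
  show "graph_iso G K1" if "simple_connected G" "card (fst G) = 1"
    by (rule cartesian.Cl_one_vertex[OF that])
  show "\<exists>G. simple_connected G \<and> card (fst G) = n" if "0 < n" for n
    by (rule cartesian.Cl_exists[OF that])
next
  fix A B C D
  assume "simple_connected A" "simple_connected B" "simple_connected C" "simple_connected D"
    "graph_iso (gprod strong_rule A B) (gprod strong_rule C D)"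
  then show "\<exists>X Y Z W. simple_connected X \<and> simple_connected Y \<and> simple_connected Z \<and> simple_connected W \<and>
      graph_iso A (gprod strong_rule X Y) \<and> graph_iso B (gprod strong_rule Z W) \<and>
      graph_iso C (gprod strong_rule X Z) \<and> graph_iso D (gprod strong_rule Y W)"
    by (rule strong_refinement)
next
  show "simple_connected K1"
    by (rule simple_connected_K1)
qed (auto simp: strong_prod_eq simple_graph_def connected_graph_def K1_def)

theorem mainTheorem3:
  shows "Z_poly_ring \<simeq> graph_ring conn_simple_classes cartesian_prod K1
       \<and> Z_poly_ring \<simeq> graph_ring conn_simple_classes strong_prod K1
       \<and> Z_poly_ring \<simeq> graph_ring conn_nonbip_classes direct_prod K1_loop"
  using cartesian.Z_poly_ring_iso strong.Z_poly_ring_iso direct.Z_poly_ring_iso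
  by (simp add: conn_simple_classes_def conn_nonbip_classes_def)

end
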